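(* Assume the following about the parameters: for every $\delta>0$ there exists $k_0=k_0(\delta)>0$ such that $\alpha(n,m)\le \delta\,(n+m)(d(n)+d(m))$ whenever $n+m>k_0$; and the function $d(\cdot)$ is uniformly bounded. Then for every $a\ge 2$ and all positive $A$ and $T$ there exists a constant $C=C(a,A,T)$ such that every weak solution $f$ of the Smoluchowski system whose initial data satisfy $$\iint X_a(x,0)\,X_1(y,0)\,\phi_0(x-y)\,dx\,dy\le A,$$ $$\operatorname*{ess\,sup}_x\int X_a(y,0)\,\phi_0(x-y)\,dy\le A,\qquad \int X_a(x,0)\,dx\le A,$$ also satisfies $$\int_0^T\!\int Y_{a-1}\,dx\,dt\le C,\qquad \int_0^T\!\int \hat Y_{a-1}\,dx\,dt\le C,$$ and $$\sup_{t\in[0,T]}\int X_a(x,t)\,dx\le C.$$ Moreover, the constant $C$ can be chosen to be independent of $T$ when the dimension satisfies $d>2$.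
   Context: The integer $d\ge 1$ (written without argument) is the spatial dimension; $\mathbb{N}=\{1,2,\dots\}$; spatial integrals are over $\mathbb{R}^d$. The parameters are the diffusion rates $d(\cdot):\mathbb{N}\to[0,\infty)$ and the coagulation propensities $\alpha:\mathbb{N}^2\to[0,\infty)$, with $\alpha(n,m)=\alpha(m,n)$; they are fixed, and constants may depend on them and on the dimension. The Smoluchowski system for $f=(f_n)_{n\in\mathbb{N}}$, $f_n:\mathbb{R}^d\times[0,\infty)\to[0,\infty)$, is $\partial_t f_n=d(n)\Delta f_n+Q_n(f)$, where $Q_n=Q_n^+-Q_n^-$, $Q_n^+(f)=\sum_{m=1}^{n-1}\alpha(m,n-m)f_mf_{n-m}$, $Q_n^-(f)=2f_n\sum_{m=1}^\infty\alpha(n,m)f_m$. A weak solution with initial data $f^0=(f^0_n)$ means: $Q_n^\pm(f)\in L^1(\mathbb{R}^d\times[0,T])$ for every $T\in[0,\infty)$ and $n\in\mathbb{N}$, and $f_n(\cdot,t)=S_t^{d(n)}f_n^0+\int_0^tS_{t-s}^{d(n)}Q_n(f)(\cdot,s)\,ds$, where $S_t^D$ is the semigroup of the equation $u_t=D\Delta u$. Moments: $X_a(x,t)=\sum_n n^af_n(x,t)$ (so $X_a(x,0)=\sum_n n^a f_n^0(x)$), $$Y_a(x,t)=\sum_{n,m}nm(n^a+m^a)(d(n)+d(m))f_n(x,t)f_m(x,t),$$ $$\hat Y_a(x,t)=\sum_{n,m}(n^am+m^an)\,\alpha(n,m)f_n(x,t)f_m(x,t).$$ The function $\phi_0$ on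 $\mathbb{R}^d$ is: $\phi_0(x)=|x|^{2-d}$ if $d\ge3$; $\phi_0(x)=-\frac1{2\pi}\log|x|\,\mathbf 1(|x|\le1)$ if $d=2$; $\phi_0(x)=\frac12(1-|x|)\,\mathbf 1(2|x|\le1)$ if $d=1$. *)

theory Defs
  imports "HOL-Analysis.Analysis" "HOL-Probability.Essential_Supremum"
begin

text \<open>
  Space is an arbitrary Euclidean space of dimension \<open>DIM('a) \<ge> 1\<close>. Particle masses range over the
  positive integers: values of the parameters and of \<open>f\<close> at mass \<open>0\<close> are never used, and infinite
  sums over masses are written as sums over \<open>Suc i\<close>. Sums and integrals of nonnegative
  quantities are taken in \<^typ>\<open>ennreal\<close>, so that divergence yields \<open>\<infinity>\<close> and not a default value.
\<close>

definition coag_gain :: "(nat \<Rightarrow> nat \<Rightarrow> real) \<Rightarrow> nat \<Rightarrow> (nat \<Rightarrow> real) \<Rightarrow> real" where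
  "coag_gain \<alpha> n c = (\<Sum>m = 1..n - 1. \<alpha> m (n - m) * c m * c (n - m))"

definition coag_loss :: "(nat \<Rightarrow> nat \<Rightarrow> real) \<Rightarrow> nat \<Rightarrow> (nat \<Rightarrow> real) \<Rightarrow> ennreal" where
  "coag_loss \<alpha> n c = 2 * ennreal (c n) * (\<Sum>i. ennreal (\<alpha> n (Suc i) * c (Suc i)))"

definition coag :: "(nat \<Rightarrow> nat \<Rightarrow> real) \<Rightarrow> nat \<Rightarrow> (nat \<Rightarrow> real) \<Rightarrow> real" where
  "coag \<alpha> n c = coag_gain \<alpha> n c - enn2real (coag_loss \<alpha> n c)"

text \<open>
  The heat semigroup of \<open>u\<^sub>t = D \<Delta>u\<close>, given by convolution with the Gaussian kernel; it is the
  identity if \<open>t = 0\<close> or if there is no diffusion (\<open>D = 0\<close>).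
\<close>

definition heat_semigroup ::
    "real \<Rightarrow> real \<Rightarrow> ('a::euclidean_space \<Rightarrow> real) \<Rightarrow> 'a \<Rightarrow> real" where
  "heat_semigroup D t g x =
     (if D * t = 0 then g x
      else (LINT y|lebesgue. (4 * pi * D * t) powr (- real DIM('a) / 2) *
              exp (- (norm (x - y))\<^sup>2 / (4 * D * t)) * g y))"

text \<open>
  The Duhamel identity is one between elements of \<open>L\<^sup>1\<close> at each time: it holds for every
  \<open>t \<ge> 0\<close> and almost every \<open>x\<close>. Measurability of the loss term follows from that of \<open>f\<close>, so for it
  membership in \<open>L\<^sup>1\<close> amounts to finiteness of the integral, which makes it finite almost
  everywhere. By Fubini the integrals in the Duhamel term then converge for almost every \<open>x\<close>;
  those in \<open>heat_semigroup (d n) t (f0 n)\<close> converge when \<open>f0 n\<close> is integrable.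
\<close>

definition weak_solution ::
    "(nat \<Rightarrow> real) \<Rightarrow> (nat \<Rightarrow> nat \<Rightarrow> real) \<Rightarrow> (nat \<Rightarrow> 'a::euclidean_space \<Rightarrow> real) \<Rightarrow>
     (nat \<Rightarrow> 'a \<Rightarrow> real \<Rightarrow> real) \<Rightarrow> bool" where
  "weak_solution d \<alpha> f0 f \<longleftrightarrow>
     (\<forall>n\<ge>1. f0 n \<in> borel_measurable lebesgue \<and> (\<forall>x. 0 \<le> f0 n x)) \<and>
     (\<forall>n\<ge>1. (\<lambda>(x, t). f n x t) \<in> borel_measurable (lebesgue_on (UNIV \<times> {0..})) \<and>
            (\<forall>x. \<forall>t\<ge>0. 0 \<le> f n x t)) \<and>
     (\<forall>n\<ge>1. \<forall>T\<ge>0.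
        integrable (lebesgue_on (UNIV \<times> {0..T})) (\<lambda>(x, t). coag_gain \<alpha> n (\<lambda>k. f k x t)) \<and>
        (\<integral>\<^sup>+(x, t). coag_loss \<alpha> n (\<lambda>k. f k x t) \<partial>lebesgue_on (UNIV \<times> {0..T})) < \<infinity>) \<and>
     (\<forall>n\<ge>1. \<forall>t\<ge>0. AE x in lebesgue.
        f n x t = heat_semigroup (d n) t (f0 n) x +
          (LINT s:{0..t}|lebesgue.
             heat_semigroup (d n) (t - s) (\<lambda>y. coag \<alpha> n (\<lambda>k. f k y s)) x))"

text \<open>
  The moments at a point \<open>(x, t)\<close>, as functions of the sequence \<open>c n = f n x t\<close>.
\<close>

definition moment_X :: "real \<Rightarrow> (nat \<Rightarrow> real) \<Rightarrow> ennreal" where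
  "moment_X a c = (\<Sum>i. let n = Suc i in ennreal (real n powr a * c n))"

definition moment_Y :: "(nat \<Rightarrow> real) \<Rightarrow> real \<Rightarrow> (nat \<Rightarrow> real) \<Rightarrow> ennreal" where
  "moment_Y d a c = (\<Sum>i. \<Sum>j. let n = Suc i; m = Suc j in
     ennreal (real n * real m * (real n powr a + real m powr a) * (d n + d m) * c n * c m))"

definition moment_Yhat :: "(nat \<Rightarrow> nat \<Rightarrow> real) \<Rightarrow> real \<Rightarrow> (nat \<Rightarrow> real) \<Rightarrow> ennreal" where
  "moment_Yhat \<alpha> a c = (\<Sum>i. \<Sum>j. let n = Suc i; m = Suc j in
     ennreal ((real n powr a * real m + real m powr a * real n) * \<alpha> n m * c n * c m))"

definition phi0 :: "'a::euclidean_space \<Rightarrow> real" where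
  "phi0 x =
     (if DIM('a) \<ge> 3 then norm x powr (2 - real DIM('a))
      else if DIM('a) = 2 then - (1 / (2 * pi)) * ln (norm x) * of_bool (norm x \<le> 1)
      else 1 / 2 * (1 - norm x) * of_bool (2 * norm x \<le> 1))"

definition initial_bounds :: "real \<Rightarrow> real \<Rightarrow> (nat \<Rightarrow> 'a::euclidean_space \<Rightarrow> real) \<Rightarrow> bool" where
  "initial_bounds a A f0 \<longleftrightarrow>
     (\<integral>\<^sup>+x. \<integral>\<^sup>+y. moment_X a (\<lambda>n. f0 n x) * moment_X 1 (\<lambda>n. f0 n y) *
        ennreal (phi0 (x - y)) \<partial>lebesgue \<partial>lebesgue) \<le> ennreal A \<and>
     esssup lebesgue (\<lambda>x. \<integral>\<^sup>+y. moment_X a (\<lambda>n. f0 n y) * ennreal (phi0 (x - y)) \<partial>lebesgue)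
       \<le> ennreal A \<and>
     (\<integral>\<^sup>+x. moment_X a (\<lambda>n. f0 n x) \<partial>lebesgue) \<le> ennreal A"

definition solution_bounds ::
    "(nat \<Rightarrow> real) \<Rightarrow> (nat \<Rightarrow> nat \<Rightarrow> real) \<Rightarrow> real \<Rightarrow> real \<Rightarrow> real \<Rightarrow>
     (nat \<Rightarrow> 'a::euclidean_space \<Rightarrow> real \<Rightarrow> real) \<Rightarrow> bool" where
  "solution_bounds d \<alpha> a T C f \<longleftrightarrow>
     (\<integral>\<^sup>+t\<in>{0..T}. (\<integral>\<^sup>+x. moment_Y d (a - 1) (\<lambda>n. f n x t) \<partial>lebesgue) \<partial>lebesgue) \<le> ennreal C \<and>
     (\<integral>\<^sup>+t\<in>{0..T}. (\<integral>\<^sup>+x. moment_Yhat \<alpha> (a - 1) (\<lambda>n. f n x t) \<partial>lebesgue) \<partial>lebesgue) \<le> ennreal C \<and>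
     (SUP t\<in>{0..T}. \<integral>\<^sup>+x. moment_X a (\<lambda>n. f n x t) \<partial>lebesgue) \<le> ennreal C"

end

theory Submission
  imports Defs "HOL-Probability.Distributions"
begin

text \<open>
  Write \<open>X\<^sub>a\<close> and \<open>X\<^sub>1\<close> for the moments and let \<open>\<Phi>\<close> be the fundamental solution of \<open>-\<Delta>\<close>. Diffusion alone
  makes the interaction energy \<open>\<integral>\<integral> X\<^sub>a(x) X\<^sub>1(y) \<Phi>(x - y) dx dy\<close> decrease, and the rate of decrease is
  exactly half of \<open>\<integral> Y\<^sub>a\<^sub>-\<^sub>1 dx\<close>, because \<open>-\<Delta>\<Phi>\<close> is a point mass and the two factors diffuse with rates
  \<open>d n\<close> and \<open>d m\<close>. Coagulation conserves \<open>X\<^sub>1\<close> and raises \<open>X\<^sub>a\<close> at a rate of at most a multiple of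
  \<open>Yhat\<^sub>a\<^sub>-\<^sub>1\<close>, since \<open>(j + k)\<^sup>a - j\<^sup>a - k\<^sup>a\<close> is at most a multiple of \<open>j\<^sup>a\<^sup>-\<^sup>1 k + k\<^sup>a\<^sup>-\<^sup>1 j\<close>. So the energy gains at
  most a multiple of \<open>sup (\<Phi> * X\<^sub>1) \<integral> Yhat\<^sub>a\<^sub>-\<^sub>1 dx\<close> per unit of time, and the potential \<open>\<Phi> * X\<^sub>1\<close> never exceeds its
  initial bound. The hypothesis on \<open>\<alpha>\<close> makes \<open>Yhat\<^sub>a\<^sub>-\<^sub>1\<close> an arbitrarily small multiple of \<open>Y\<^sub>a\<^sub>-\<^sub>1\<close>, up to
  collisions of small particles, and the total number of collisions is bounded by the initial number of
  particles. For a small enough multiple the gain is absorbed by the dissipation. This bounds the integrals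
  of \<open>Y\<^sub>a\<^sub>-\<^sub>1\<close> and \<open>Yhat\<^sub>a\<^sub>-\<^sub>1\<close>, and then \<open>\<integral> X\<^sub>a dx\<close>, which grows at most at the rate of a multiple of
  \<open>\<integral> Yhat\<^sub>a\<^sub>-\<^sub>1 dx\<close>.

  Three devices make this rigorous for weak solutions. First, \<open>\<Phi>\<close> is replaced by
  \<open>\<Phi>\<^sub>e\<^sub>,\<^sub>\<tau> = \<integral>\<^sub>e\<^sup>\<tau> p\<^sub>\<theta> d\<theta>\<close>, where \<open>p\<^sub>\<theta>\<close> is the heat kernel. It satisfies \<open>-\<Delta>\<Phi>\<^sub>e\<^sub>,\<^sub>\<tau> = p\<^sub>e - p\<^sub>\<tau>\<close>, it is
  bounded, and it interacts with the Duhamel formula through the semigroup property alone, so that no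
  derivative of a solution appears (\<open>truncated_potential_balance\<close>, \<open>potential_balance\<close>, \<open>energy_balance\<close>). The limit
  \<open>e \<rightarrow> 0\<close> recovers the dissipation (\<open>nn_integral_mult_le_liminf_overlap\<close>). The error term with \<open>p\<^sub>\<tau>\<close> costs
  \<open>T p\<^sub>\<tau>(0)\<close>. In dimension at least 3 a large \<open>\<tau>\<close> makes this at most 1, and \<open>\<Phi>\<^sub>e\<^sub>,\<^sub>\<tau>\<close> is bounded by a multiple
  of \<open>phi0\<close> uniformly in \<open>\<tau>\<close>; hence the constant does not depend on \<open>T\<close>. For a constant
  that may depend on \<open>T\<close>, the choice \<open>\<tau> = 1\<close> serves in every dimension.

  Secondly, moments are cut off at mass \<open>N\<close>. The cut-off weights \<open>n\<close> and \<open>n\<^sup>a\<close>, set to zero beyond \<open>N\<close>, keep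
  the two inequalities for coagulation, and they make every quantity finite, so that absorption is
  legitimate. All bounds are uniform in \<open>N\<close> (\<open>truncated_moment_bounds\<close>).

  Thirdly, gain and loss are kept as nonnegative extended quantities on opposite sides of each identity.
  Then the order of integration may always be exchanged; finiteness enters where terms cancel.
  A weak solution is first replaced by one that is jointly Borel measurable and agrees with it almost
  everywhere at every time (\<open>weak_solution_imp_mild\<close>).
\<close>

section \<open>The heat kernel and its semigroup\<close>

definition heat_kernel :: "real \<Rightarrow> 'a::euclidean_space \<Rightarrow> real" where
  "heat_kernel \<theta> z =
     (4 * pi * \<theta>) powr (- real DIM('a) / 2) * exp (- (norm z)\<^sup>2 / (4 * \<theta>))"

text \<open>
  The case \<open>\<theta> = 0\<close> covers both the initial time and components that do not diffuse.
\<close>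

definition heat :: "real \<Rightarrow> ('a::euclidean_space \<Rightarrow> ennreal) \<Rightarrow> 'a \<Rightarrow> ennreal" where
  "heat \<theta> g x =
     (if \<theta> = 0 then g x else \<integral>\<^sup>+y. ennreal (heat_kernel \<theta> (x - y)) * g y \<partial>lborel)"

lemma heat_kernel_nonneg [simp]: "0 \<le> heat_kernel \<theta> z"
  by (simp add: heat_kernel_def)

lemma heat_kernel_minus_commute: "heat_kernel \<theta> (x - y) = heat_kernel \<theta> (y - x)"
  by (simp add: heat_kernel_def norm_minus_commute)

lemma borel_measurable_heat_kernel [measurable (raw)]:
  assumes [measurable]: "f \<in> borel_measurable M" "g \<in> borel_measurable M"
  shows "(\<lambda>x. heat_kernel (f x) (g x :: 'a::euclidean_space)) \<in> borel_measurable M"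
  unfolding heat_kernel_def by measurable

text \<open>
  The factorisation over coordinates reduces the total mass and the semigroup property of the kernel to
  known facts about one-dimensional normal densities.
\<close>

lemma heat_kernel_eq_prod_normal_density:
  fixes z :: "'a::euclidean_space"
  assumes "\<theta> > 0"
  shows "heat_kernel \<theta> z = (\<Prod>b\<in>Basis. normal_density 0 (sqrt (2 * \<theta>)) (z \<bullet> b))"
proof -
  have norm_sq: "(norm z)\<^sup>2 = (\<Sum>b\<in>Basis. (z \<bullet> b)\<^sup>2)"
    by (metis (no_types, lifting) euclidean_inner[of z z] power2_norm_eq_inner power2_eq_square sum.cong)
  have "(4 * pi * \<theta>) powr (- real DIM('a) / 2) = ((4 * pi * \<theta>) powr (- 1 / 2)) powr real DIM('a)"
    by (simp add: powr_powr)
  also have "\<dots> = ((4 * pi * \<theta>) powr (- 1 / 2)) ^ DIM('a)"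
    using assms by (intro powr_realpow) simp
  also have "(4 * pi * \<theta>) powr (- 1 / 2) = 1 / sqrt (4 * pi * \<theta>)"
    using assms by (simp add: powr_minus_divide powr_half_sqrt)
  finally have "(4 * pi * \<theta>) powr (- real DIM('a) / 2) = (\<Prod>b\<in>(Basis::'a set). 1 / sqrt (4 * pi * \<theta>))"
    by simp
  moreover have "exp (- (norm z)\<^sup>2 / (4 * \<theta>)) = (\<Prod>b\<in>Basis. exp (- (z \<bullet> b)\<^sup>2 / (4 * \<theta>)))"
    by (simp add: norm_sq exp_sum[symmetric] sum_divide_distrib sum_negf)
  ultimately show ?thesis
    using assms unfolding heat_kernel_def
    by (simp add: normal_density_def prod_dividef power_divide mult.assoc)
qed

lemma nn_integral_heat_kernel:
  assumes "\<theta> > 0"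
  shows "(\<integral>\<^sup>+z. ennreal (heat_kernel \<theta> (z :: 'a::euclidean_space)) \<partial>lborel) = 1"
proof -
  have 1: "(\<integral>\<^sup>+t. ennreal (normal_density 0 (sqrt (2 * \<theta>)) t) \<partial>lborel) = 1"
    using assms by (subst nn_integral_eq_integral) auto
  have "(\<integral>\<^sup>+z. ennreal (heat_kernel \<theta> (z :: 'a)) \<partial>lborel)
      = (\<integral>\<^sup>+z. (\<Prod>b\<in>Basis. ennreal (normal_density 0 (sqrt (2 * \<theta>)) ((z::'a) \<bullet> b))) \<partial>lborel)"
    using assms by (simp add: heat_kernel_eq_prod_normal_density prod_ennreal)
  also have "\<dots> = 1"
    by (subst nn_integral_lborel_prod) (auto simp: 1)
  finally show ?thesis .
qed

lemma nn_integral_heat_kernel_shift: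
  fixes x :: "'a::euclidean_space"
  assumes "\<theta> > 0"
  shows "(\<integral>\<^sup>+z. ennreal (heat_kernel \<theta> (z - x)) \<partial>lborel) = 1"
    and "(\<integral>\<^sup>+z. ennreal (heat_kernel \<theta> (x - z)) \<partial>lborel) = 1"
proof -
  show "(\<integral>\<^sup>+z. ennreal (heat_kernel \<theta> (z - x)) \<partial>lborel) = 1"
  proof -
    have "(\<integral>\<^sup>+z. ennreal (heat_kernel \<theta> (z - x)) \<partial>distr lborel borel ((+) x)) = 1"
      by (subst nn_integral_distr) (simp_all add: nn_integral_heat_kernel assms)
    then show ?thesis
      by (simp add: lborel_distr_plus)
  qed
  then show "(\<integral>\<^sup>+z. ennreal (heat_kernel \<theta> (x - z)) \<partial>lborel) = 1"
    by (subst heat_kernel_minus_commute)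
qed

lemma heat_kernel_convolution:
  fixes x z :: "'a::euclidean_space"
  assumes "\<theta> > 0" "\<sigma> > 0"
  shows "(\<integral>\<^sup>+y. ennreal (heat_kernel \<theta> (x - y) * heat_kernel \<sigma> (y - z)) \<partial>lborel)
       = ennreal (heat_kernel (\<theta> + \<sigma>) (x - z))"
proof -
  let ?n = "\<lambda>s. normal_density 0 (sqrt (2 * s))"
  have 1: "(\<integral>\<^sup>+t. ennreal (?n \<theta> (a - t) * ?n \<sigma> t) \<partial>lborel) = ennreal (?n (\<theta> + \<sigma>) a)" for a
    using conv_normal_density_zero_mean[of "sqrt (2 * \<theta>)" "sqrt (2 * \<sigma>)"] assms
    by (simp add: fun_eq_iff algebra_simps)
  have "(\<integral>\<^sup>+y. ennreal (heat_kernel \<theta> (x - y) * heat_kernel \<sigma> (y - z)) \<partial>lborel)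
      = (\<integral>\<^sup>+y. ennreal (heat_kernel \<theta> (x - y) * heat_kernel \<sigma> (y - z)) \<partial>distr lborel borel ((+) z))"
    by (simp add: lborel_distr_plus)
  also have "\<dots> = (\<integral>\<^sup>+y. ennreal (heat_kernel \<theta> ((x - z) - y) * heat_kernel \<sigma> y) \<partial>lborel)"
    by (subst nn_integral_distr) (simp_all add: algebra_simps)
  also have "\<dots> = (\<integral>\<^sup>+y. (\<Prod>b\<in>Basis. ennreal (?n \<theta> ((x - z) \<bullet> b - (y \<bullet> b)) * ?n \<sigma> (y \<bullet> b))) \<partial>lborel)"
    using assms
    by (simp add: heat_kernel_eq_prod_normal_density prod_ennreal prod.distrib inner_diff_left)
  also have "\<dots> = (\<Prod>b\<in>Basis. \<integral>\<^sup>+t. ennreal (?n \<theta> ((x - z) \<bullet> b - t) * ?n \<sigma> t) \<partial>lborel)"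
    by (subst nn_integral_lborel_prod) auto
  also have "\<dots> = ennreal (heat_kernel (\<theta> + \<sigma>) (x - z))"
    using assms by (simp add: 1 heat_kernel_eq_prod_normal_density prod_ennreal)
  finally show ?thesis .
qed

text \<open>
  The kernel at the origin is the least upper bound of the kernel for all later times; below it serves as
  the constant \<open>(4 \<pi> \<epsilon>) powr (- d / 2)\<close>.
\<close>

lemma heat_kernel_le:
  fixes z :: "'a::euclidean_space"
  assumes "0 < \<epsilon>" "\<epsilon> \<le> \<theta>"
  shows "heat_kernel \<theta> z \<le> heat_kernel \<epsilon> (0 :: 'a)"
proof -
  have "heat_kernel \<theta> z \<le> (4 * pi * \<theta>) powr (- real DIM('a) / 2) * 1"
    unfolding heat_kernel_def using assms by (intro mult_left_mono) auto
  also have "\<dots> \<le> (4 * pi * \<epsilon>) powr (- real DIM('a) / 2)"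
    using assms by (auto intro!: powr_mono2')
  finally show ?thesis by (simp add: heat_kernel_def)
qed

text \<open>
  Half of the exponent is given up to turn \<open>p\<^sub>\<epsilon>\<close> into \<open>p\<^sub>2\<^sub>\<epsilon>\<close>; what remains is small away from the origin. As
  \<open>p\<^sub>2\<^sub>\<epsilon>\<close> has mass 1, the mass of \<open>p\<^sub>\<epsilon>\<close> outside a ball tends to 0.
\<close>

lemma heat_kernel_tail:
  fixes z :: "'a::euclidean_space"
  assumes "\<epsilon> > 0" "r \<ge> 0" "r \<le> norm z"
  shows "heat_kernel \<epsilon> z \<le> 2 powr (real DIM('a) / 2) * exp (- r\<^sup>2 / (8 * \<epsilon>)) * heat_kernel (2 * \<epsilon>) z"
proof -
  have "(4 * pi * \<epsilon>) powr (- real DIM('a) / 2)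
      = (4 * pi * (2 * \<epsilon>) / 2) powr (- real DIM('a) / 2)" by (simp add: mult.assoc)
  also have "\<dots> = (4 * pi * (2 * \<epsilon>)) powr (- real DIM('a) / 2) * 2 powr (real DIM('a) / 2)"
    using assms by (subst powr_divide) (auto simp: powr_minus_divide)
  finally have 1: "(4 * pi * \<epsilon>) powr (- real DIM('a) / 2)
     = (4 * pi * (2 * \<epsilon>)) powr (- real DIM('a) / 2) * 2 powr (real DIM('a) / 2)" .
  have "exp (- (norm z)\<^sup>2 / (4 * \<epsilon>)) = exp (- (norm z)\<^sup>2 / (8 * \<epsilon>)) * exp (- (norm z)\<^sup>2 / (8 * \<epsilon>))"
    by (simp add: exp_add[symmetric])
  also have "\<dots> \<le> exp (- r\<^sup>2 / (8 * \<epsilon>)) * exp (- (norm z)\<^sup>2 / (8 * \<epsilon>))"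
    using assms by (intro mult_right_mono) (auto simp: divide_simps power_mono)
  finally have "(4 * pi * \<epsilon>) powr (- real DIM('a) / 2) * exp (- (norm z)\<^sup>2 / (4 * \<epsilon>))
     \<le> (4 * pi * \<epsilon>) powr (- real DIM('a) / 2) * (exp (- r\<^sup>2 / (8 * \<epsilon>)) * exp (- (norm z)\<^sup>2 / (8 * \<epsilon>)))"
    by (intro mult_left_mono) auto
  then show ?thesis
    unfolding heat_kernel_def 1 by (simp add: algebra_simps)
qed

lemma heat_zero [simp]: "heat 0 g = g"
  by (simp add: heat_def fun_eq_iff)

lemma heat_pos_eq:
  "\<theta> > 0 \<Longrightarrow> heat \<theta> g x = (\<integral>\<^sup>+y. ennreal (heat_kernel \<theta> (x - y)) * g y \<partial>lborel)"
  by (simp add: heat_def)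

lemma borel_measurable_heat [measurable (raw)]:
  fixes h :: "'b \<Rightarrow> 'a::euclidean_space \<Rightarrow> ennreal"
  assumes [measurable]: "f \<in> borel_measurable M" "case_prod h \<in> borel_measurable (M \<Otimes>\<^sub>M borel)"
    "g \<in> borel_measurable M"
  shows "(\<lambda>w. heat (f w) (h w) (g w)) \<in> borel_measurable M"
  unfolding heat_def by measurable

lemma heat_cong_AE:
  assumes "AE x in lborel. g x = h x" "\<theta> > 0"
  shows "heat \<theta> g = heat \<theta> h"
  using assms by (auto simp: heat_pos_eq fun_eq_iff intro!: nn_integral_cong_AE)

lemma heat_mono: "(\<And>y. g y \<le> h y) \<Longrightarrow> heat \<theta> g x \<le> heat \<theta> h x"
  by (auto simp: heat_def intro!: nn_integral_mono mult_left_mono)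

lemma heat_cmult:
  assumes [measurable]: "g \<in> borel_measurable borel"
  shows "heat \<theta> (\<lambda>y. c * g y) x = c * heat \<theta> g x"
  by (auto simp: heat_def nn_integral_cmult[symmetric] mult_ac)

lemma heat_add:
  assumes [measurable]: "g \<in> borel_measurable borel" "h \<in> borel_measurable borel"
  shows "heat \<theta> (\<lambda>y. g y + h y) x = heat \<theta> g x + heat \<theta> h x"
  by (auto simp: heat_def nn_integral_add[symmetric] distrib_left)

lemma heat_sum:
  assumes [measurable]: "\<And>i. i \<in> I \<Longrightarrow> g i \<in> borel_measurable borel"
  shows "heat \<theta> (\<lambda>y. \<Sum>i\<in>I. g i y) x = (\<Sum>i\<in>I. heat \<theta> (g i) x)"
  by (auto simp: heat_def nn_integral_sum[symmetric] sum_distrib_left)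

lemma heat_le:
  fixes x :: "'a::euclidean_space"
  assumes "0 < \<epsilon>" "\<epsilon> \<le> \<theta>" and [measurable]: "g \<in> borel_measurable borel"
  shows "heat \<theta> g x \<le> ennreal (heat_kernel \<epsilon> (0 :: 'a)) * (\<integral>\<^sup>+y. g y \<partial>lborel)"
proof -
  have "heat \<theta> g x \<le> (\<integral>\<^sup>+y. ennreal (heat_kernel \<epsilon> (0 :: 'a)) * g y \<partial>lborel)"
    using assms heat_kernel_le[OF assms(1,2)]
    by (auto simp: heat_pos_eq intro!: nn_integral_mono mult_right_mono ennreal_leI)
  then show ?thesis by (simp add: nn_integral_cmult)
qed

lemma nn_integral_heat:
  assumes "0 \<le> \<theta>" and [measurable]: "g \<in> borel_measurable borel"
  shows "(\<integral>\<^sup>+x. heat \<theta> g x \<partial>lborel) = (\<integral>\<^sup>+y. g (y :: 'a::euclidean_space) \<partial>lborel)"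
proof (cases "\<theta> = 0")
  case False
  then have \<theta>: "\<theta> > 0" using assms by simp
  have "(\<integral>\<^sup>+x. heat \<theta> g x \<partial>lborel) = (\<integral>\<^sup>+y. \<integral>\<^sup>+x. ennreal (heat_kernel \<theta> (x - y)) * g y \<partial>lborel \<partial>lborel)"
    unfolding heat_pos_eq[OF \<theta>] by (subst lborel_pair.Fubini') auto
  also have "\<dots> = (\<integral>\<^sup>+y. g y \<partial>lborel)"
    by (simp add: nn_integral_multc nn_integral_heat_kernel_shift \<theta>)
  finally show ?thesis .
qed simp

lemma heat_self_adjoint:
  assumes "0 \<le> \<theta>" and [measurable]: "g \<in> borel_measurable borel" "h \<in> borel_measurable borel"
  shows "(\<integral>\<^sup>+x. g x * heat \<theta> h x \<partial>lborel) = (\<integral>\<^sup>+x. heat \<theta> g x * h (x :: 'a::euclidean_space) \<partial>lborel)"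
proof (cases "\<theta> = 0")
  case False
  then have \<theta>: "\<theta> > 0" using assms by simp
  have "(\<integral>\<^sup>+x. g x * heat \<theta> h x \<partial>lborel)
      = (\<integral>\<^sup>+x. \<integral>\<^sup>+y. g x * (ennreal (heat_kernel \<theta> (x - y)) * h y) \<partial>lborel \<partial>lborel)"
    unfolding heat_pos_eq[OF \<theta>] by (simp add: nn_integral_cmult)
  also have "\<dots> = (\<integral>\<^sup>+y. \<integral>\<^sup>+x. g x * (ennreal (heat_kernel \<theta> (x - y)) * h y) \<partial>lborel \<partial>lborel)"
    by (subst lborel_pair.Fubini') auto
  also have "\<dots> = (\<integral>\<^sup>+y. \<integral>\<^sup>+x. (ennreal (heat_kernel \<theta> (y - x)) * g x) * h y \<partial>lborel \<partial>lborel)"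
    by (subst heat_kernel_minus_commute) (simp add: mult_ac)
  also have "\<dots> = (\<integral>\<^sup>+x. heat \<theta> g x * h x \<partial>lborel)"
    unfolding heat_pos_eq[OF \<theta>] by (simp add: nn_integral_multc)
  finally show ?thesis .
qed simp

lemma heat_heat:
  fixes x :: "'a::euclidean_space"
  assumes "0 \<le> \<theta>" "0 \<le> \<sigma>" and [measurable]: "g \<in> borel_measurable borel"
  shows "heat \<theta> (heat \<sigma> g) x = heat (\<theta> + \<sigma>) g x"
proof (cases "\<theta> = 0 \<or> \<sigma> = 0")
  case False
  then have pos: "\<theta> > 0" "\<sigma> > 0" using assms by auto
  have "heat \<theta> (heat \<sigma> g) x = (\<integral>\<^sup>+y. \<integral>\<^sup>+z. ennreal (heat_kernel \<theta> (x - y)) * (ennreal (heat_kernel \<sigma> (y - z)) * g z) \<partial>lborel \<partial>lborel)"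
    using pos by (simp add: heat_pos_eq nn_integral_cmult)
  also have "\<dots> = (\<integral>\<^sup>+z. \<integral>\<^sup>+y. ennreal (heat_kernel \<theta> (x - y)) * (ennreal (heat_kernel \<sigma> (y - z)) * g z) \<partial>lborel \<partial>lborel)"
    by (subst lborel_pair.Fubini') auto
  also have "\<dots> = (\<integral>\<^sup>+z. \<integral>\<^sup>+y. ennreal (heat_kernel \<theta> (x - y) * heat_kernel \<sigma> (y - z)) * g z \<partial>lborel \<partial>lborel)"
    by (simp add: ennreal_mult mult_ac)
  also have "\<dots> = heat (\<theta> + \<sigma>) g x"
    using pos by (simp add: heat_pos_eq nn_integral_multc heat_kernel_convolution)
  finally show ?thesis .
qed auto

section \<open>From Duhamel formulas to balance laws\<close>

lemma borel_measurable_indicator_interval [measurable (raw)]: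
  fixes f g h :: "'b \<Rightarrow> real"
  assumes [measurable]: "f \<in> borel_measurable M" "g \<in> borel_measurable M" "h \<in> borel_measurable M"
  shows "(\<lambda>x. indicator {f x..g x} (h x) :: ennreal) \<in> borel_measurable M"
  unfolding indicator_def atLeastAtMost_iff by measurable

lemma nn_integral_interval_combine:
  fixes g :: "real \<Rightarrow> ennreal"
  assumes [measurable]: "g \<in> borel_measurable borel" and "a \<le> b" "b \<le> c"
  shows "(\<integral>\<^sup>+x\<in>{a..b}. g x \<partial>lborel) + (\<integral>\<^sup>+x\<in>{b..c}. g x \<partial>lborel) = (\<integral>\<^sup>+x\<in>{a..c}. g x \<partial>lborel)"
proof -
  have "(\<integral>\<^sup>+x\<in>{a..b}. g x \<partial>lborel) + (\<integral>\<^sup>+x\<in>{b..c}. g x \<partial>lborel)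
      = (\<integral>\<^sup>+x. g x * indicator {a..b} x + g x * indicator {b..c} x \<partial>lborel)"
    by (subst nn_integral_add) auto
  also have "\<dots> = (\<integral>\<^sup>+x\<in>{a..c}. g x \<partial>lborel)"
    using AE_lborel_singleton[of b] assms
    by (intro nn_integral_cong_AE) (auto simp: indicator_def elim!: eventually_mono)
  finally show ?thesis .
qed

lemma nn_integral_interval_translate:
  fixes g :: "real \<Rightarrow> ennreal"
  assumes [measurable]: "g \<in> borel_measurable borel"
  shows "(\<integral>\<^sup>+x\<in>{a..b}. g (x + c) \<partial>lborel) = (\<integral>\<^sup>+x\<in>{a + c..b + c}. g x \<partial>lborel)"
  by (subst nn_integral_real_affine[where c = 1 and t = c])
     (auto simp: indicator_def add.commute intro!: nn_integral_cong)

lemma nn_integral_interval_rescale: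
  fixes g :: "real \<Rightarrow> ennreal"
  assumes [measurable]: "g \<in> borel_measurable borel" and "0 \<le> l" "0 \<le> t"
  shows "(\<integral>\<^sup>+x\<in>{e..e + l * t}. g x \<partial>lborel) = ennreal l * (\<integral>\<^sup>+s\<in>{0..t}. g (e + l * s) \<partial>lborel)"
proof (cases "l = 0")
  case True
  have "(\<integral>\<^sup>+x\<in>{e}. g x \<partial>lborel) = (\<integral>\<^sup>+x. 0 \<partial>(lborel :: real measure))"
    using AE_lborel_singleton[of e]
    by (intro nn_integral_cong_AE) (auto simp: indicator_def elim!: eventually_mono)
  then show ?thesis using True by simp
next
  case False
  then have l: "l > 0" using assms by simp
  show ?thesis
    using l by (subst nn_integral_real_affine[where c = l and t = e])
      (auto simp: indicator_def zero_le_mult_iff intro!: arg_cong2[where f = "(*)"] nn_integral_cong)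
qed

text \<open>
  Both sides are integrals over \<open>{e..\<tau> + l * t}\<close>, split at \<open>e + l * t\<close> and at \<open>\<tau>\<close>. The two short pieces are
  written as time integrals: this is \<open>d/dt \<integral>\<^sub>e\<^sup>\<tau> g(\<theta> + l t) d\<theta> = l (g(\<tau> + l t) - g(e + l t))\<close> without
  derivatives and without subtraction.
\<close>

lemma nn_integral_shift_balance:
  fixes g :: "real \<Rightarrow> ennreal"
  assumes [measurable]: "g \<in> borel_measurable borel" and "0 \<le> l" "0 \<le> t" "e \<le> \<tau>"
  shows "(\<integral>\<^sup>+\<theta>\<in>{e..\<tau>}. g (\<theta> + l * t) \<partial>lborel) + ennreal l * (\<integral>\<^sup>+s\<in>{0..t}. g (e + l * s) \<partial>lborel)
       = (\<integral>\<^sup>+\<theta>\<in>{e..\<tau>}. g \<theta> \<partial>lborel) + ennreal l * (\<integral>\<^sup>+s\<in>{0..t}. g (\<tau> + l * s) \<partial>lborel)"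
proof -
  have "0 \<le> l * t" using assms by simp
  then have "(\<integral>\<^sup>+x\<in>{e..e + l * t}. g x \<partial>lborel) + (\<integral>\<^sup>+x\<in>{e + l * t..\<tau> + l * t}. g x \<partial>lborel)
      = (\<integral>\<^sup>+x\<in>{e..\<tau>}. g x \<partial>lborel) + (\<integral>\<^sup>+x\<in>{\<tau>..\<tau> + l * t}. g x \<partial>lborel)"
    using assms by (subst (1 2) nn_integral_interval_combine) auto
  then show ?thesis
    using assms by (simp add: nn_integral_interval_translate nn_integral_interval_rescale add.commute)
qed

text \<open>
  The contribution at time \<open>t\<close> of a source \<open>M\<close> that is tested against \<open>p\<^sub>\<theta>\<close>: the semigroup with rate \<open>l\<close>, run
  from time \<open>s\<close> to \<open>t\<close>, adds \<open>l * (t - s)\<close> to the index.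
\<close>

definition duhamel :: "real \<Rightarrow> (real \<Rightarrow> real \<Rightarrow> ennreal) \<Rightarrow> real \<Rightarrow> real \<Rightarrow> ennreal" where
  "duhamel l M \<theta> t = (\<integral>\<^sup>+s\<in>{0..t}. M s (\<theta> + l * (t - s)) \<partial>lborel)"

lemma borel_measurable_duhamel [measurable (raw)]:
  assumes [measurable]: "case_prod M \<in> borel_measurable (borel \<Otimes>\<^sub>M borel)"
    "f \<in> borel_measurable N" "g \<in> borel_measurable N"
  shows "(\<lambda>x. duhamel l M (f x) (g x)) \<in> borel_measurable N"
  unfolding duhamel_def by measurable

lemma nn_integral_triangle:
  fixes h :: "real \<Rightarrow> real \<Rightarrow> ennreal"
  assumes [measurable]: "case_prod h \<in> borel_measurable (borel \<Otimes>\<^sub>M borel)"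
  shows "(\<integral>\<^sup>+r\<in>{0..t}. (\<integral>\<^sup>+s\<in>{0..r}. h s r \<partial>lborel) \<partial>lborel)
       = (\<integral>\<^sup>+s\<in>{0..t}. (\<integral>\<^sup>+r\<in>{s..t}. h s r \<partial>lborel) \<partial>lborel)"
proof -
  have "(\<integral>\<^sup>+r\<in>{0..t}. (\<integral>\<^sup>+s\<in>{0..r}. h s r \<partial>lborel) \<partial>lborel)
      = (\<integral>\<^sup>+r. \<integral>\<^sup>+s. h s r * indicator {0..r} s * indicator {0..t} r \<partial>lborel \<partial>lborel)"
    by (simp add: nn_integral_multc)
  also have "\<dots> = (\<integral>\<^sup>+s. \<integral>\<^sup>+r. h s r * indicator {0..r} s * indicator {0..t} r \<partial>lborel \<partial>lborel)"
    unfolding indicator_def by (subst lborel_pair.Fubini') auto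
  also have "\<dots> = (\<integral>\<^sup>+s. \<integral>\<^sup>+r. h s r * indicator {s..t} r * indicator {0..t} s \<partial>lborel \<partial>lborel)"
    by (intro nn_integral_cong) (auto simp: indicator_def)
  also have "\<dots> = (\<integral>\<^sup>+s\<in>{0..t}. (\<integral>\<^sup>+r\<in>{s..t}. h s r \<partial>lborel) \<partial>lborel)"
    by (simp add: nn_integral_multc)
  finally show ?thesis .
qed

text \<open>
  The preceding identity, applied for each source time \<open>s\<close> to the remaining time \<open>t - s\<close>, and integrated over
  \<open>s\<close>.
\<close>

lemma duhamel_shift_balance:
  assumes [measurable]: "case_prod M \<in> borel_measurable (borel \<Otimes>\<^sub>M borel)"
    and "0 \<le> l" "0 \<le> t" "e \<le> \<tau>"
  shows "(\<integral>\<^sup>+\<theta>\<in>{e..\<tau>}. duhamel l M \<theta> t \<partial>lborel) + ennreal l * (\<integral>\<^sup>+r\<in>{0..t}. duhamel l M e r \<partial>lborel)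
       = (\<integral>\<^sup>+s\<in>{0..t}. (\<integral>\<^sup>+\<theta>\<in>{e..\<tau>}. M s \<theta> \<partial>lborel) \<partial>lborel)
         + ennreal l * (\<integral>\<^sup>+r\<in>{0..t}. duhamel l M \<tau> r \<partial>lborel)"
proof -
  have A: "(\<integral>\<^sup>+\<theta>\<in>{e..\<tau>}. duhamel l M \<theta> t \<partial>lborel)
      = (\<integral>\<^sup>+s\<in>{0..t}. (\<integral>\<^sup>+\<theta>\<in>{e..\<tau>}. M s (\<theta> + l * (t - s)) \<partial>lborel) \<partial>lborel)"
  proof -
    have "(\<integral>\<^sup>+\<theta>\<in>{e..\<tau>}. duhamel l M \<theta> t \<partial>lborel)
        = (\<integral>\<^sup>+\<theta>. \<integral>\<^sup>+s. M s (\<theta> + l * (t - s)) * indicator {0..t} s * indicator {e..\<tau>} \<theta> \<partial>lborel \<partial>lborel)"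
      unfolding duhamel_def by (simp add: nn_integral_multc)
    also have "\<dots> = (\<integral>\<^sup>+s. \<integral>\<^sup>+\<theta>. M s (\<theta> + l * (t - s)) * indicator {e..\<tau>} \<theta> * indicator {0..t} s \<partial>lborel \<partial>lborel)"
      by (subst lborel_pair.Fubini') (auto simp: mult_ac)
    finally show ?thesis by (simp add: nn_integral_multc)
  qed
  have B: "ennreal l * (\<integral>\<^sup>+r\<in>{0..t}. duhamel l M c r \<partial>lborel)
      = (\<integral>\<^sup>+s\<in>{0..t}. (ennreal l * (\<integral>\<^sup>+\<sigma>\<in>{0..t - s}. M s (c + l * \<sigma>) \<partial>lborel)) \<partial>lborel)" for c
  proof -
    have shift: "(\<integral>\<^sup>+r\<in>{s..t}. M s (c + l * (r - s)) \<partial>lborel) = (\<integral>\<^sup>+\<sigma>\<in>{0..t - s}. M s (c + l * \<sigma>) \<partial>lborel)" for s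
    proof -
      have [measurable]: "(\<lambda>\<sigma>. M s (c + l * (\<sigma> - s))) \<in> borel_measurable borel" by measurable
      show ?thesis
        using nn_integral_interval_translate[where g = "\<lambda>\<sigma>. M s (c + l * (\<sigma> - s))" and a = 0
            and b = "t - s" and c = s] by simp
    qed
    have "(\<integral>\<^sup>+r\<in>{0..t}. duhamel l M c r \<partial>lborel)
      = (\<integral>\<^sup>+s\<in>{0..t}. (\<integral>\<^sup>+r\<in>{s..t}. M s (c + l * (r - s)) \<partial>lborel) \<partial>lborel)"
      unfolding duhamel_def by (rule nn_integral_triangle) measurable
    also have "\<dots> = (\<integral>\<^sup>+s\<in>{0..t}. (\<integral>\<^sup>+\<sigma>\<in>{0..t - s}. M s (c + l * \<sigma>) \<partial>lborel) \<partial>lborel)"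
      by (simp add: shift)
    finally show ?thesis
      by (simp add: nn_integral_cmult mult.assoc)
  qed
  have "(\<integral>\<^sup>+\<theta>\<in>{e..\<tau>}. duhamel l M \<theta> t \<partial>lborel) + ennreal l * (\<integral>\<^sup>+r\<in>{0..t}. duhamel l M e r \<partial>lborel)
      = (\<integral>\<^sup>+s\<in>{0..t}. ((\<integral>\<^sup>+\<theta>\<in>{e..\<tau>}. M s (\<theta> + l * (t - s)) \<partial>lborel)
          + ennreal l * (\<integral>\<^sup>+\<sigma>\<in>{0..t - s}. M s (e + l * \<sigma>) \<partial>lborel)) \<partial>lborel)"
    unfolding A B by (subst nn_integral_add[symmetric]) (auto simp: distrib_right)
  also have "\<dots> = (\<integral>\<^sup>+s\<in>{0..t}. ((\<integral>\<^sup>+\<theta>\<in>{e..\<tau>}. M s \<theta> \<partial>lborel)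
          + ennreal l * (\<integral>\<^sup>+\<sigma>\<in>{0..t - s}. M s (\<tau> + l * \<sigma>) \<partial>lborel)) \<partial>lborel)"
  proof (rule nn_integral_cong)
    fix s :: real
    have "M s \<in> borel_measurable borel" by measurable
    from nn_integral_shift_balance[OF this, of l "t - s" e \<tau>] assms
    show "((\<integral>\<^sup>+\<theta>\<in>{e..\<tau>}. M s (\<theta> + l * (t - s)) \<partial>lborel)
            + ennreal l * (\<integral>\<^sup>+\<sigma>\<in>{0..t - s}. M s (e + l * \<sigma>) \<partial>lborel)) * indicator {0..t} s
        = ((\<integral>\<^sup>+\<theta>\<in>{e..\<tau>}. M s \<theta> \<partial>lborel)
            + ennreal l * (\<integral>\<^sup>+\<sigma>\<in>{0..t - s}. M s (\<tau> + l * \<sigma>) \<partial>lborel)) * indicator {0..t} s"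
      by (cases "s \<in> {0..t}") auto
  qed
  also have "\<dots> = (\<integral>\<^sup>+s\<in>{0..t}. (\<integral>\<^sup>+\<theta>\<in>{e..\<tau>}. M s \<theta> \<partial>lborel) \<partial>lborel)
         + ennreal l * (\<integral>\<^sup>+r\<in>{0..t}. duhamel l M \<tau> r \<partial>lborel)"
    unfolding B by (subst nn_integral_add[symmetric]) (auto simp: distrib_right)
  finally show ?thesis .
qed

text \<open>
  The passage from a Duhamel formula to a balance law. If \<open>G \<theta> t\<close> is a solution tested against \<open>p\<^sub>\<theta>\<close>, then
  evolution by the semigroup with rate \<open>l\<close> only shifts \<open>\<theta>\<close> by \<open>l t\<close>, which is the hypothesis. Integrating over
  \<open>\<theta> \<in> {e..\<tau>}\<close> tests against \<open>\<Phi>\<^sub>e\<^sub>,\<^sub>\<tau>\<close>; the conclusion is the time-integrated form of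
  \<open>d/dt \<integral> G = l (G \<tau> - G e) + \<integral> P - \<integral> R\<close>, where the sources appear without the semigroup. That matters because
  components with different diffusion rates can then be added.
\<close>

lemma truncated_potential_balance:
  assumes [measurable]: "case_prod G \<in> borel_measurable (borel \<Otimes>\<^sub>M borel)"
      "Z \<in> borel_measurable borel"
      "case_prod P \<in> borel_measurable (borel \<Otimes>\<^sub>M borel)"
      "case_prod R \<in> borel_measurable (borel \<Otimes>\<^sub>M borel)"
    and "0 \<le> l" "0 \<le> t" "e \<le> \<tau>"
    and eq: "\<And>\<theta> r. e \<le> \<theta> \<Longrightarrow> 0 \<le> r \<Longrightarrow> r \<le> t \<Longrightarrow>
               G \<theta> r + duhamel l R \<theta> r = Z (\<theta> + l * r) + duhamel l P \<theta> r"
    and fin: "(\<integral>\<^sup>+r\<in>{0..t}. duhamel l R \<tau> r \<partial>lborel) < \<infinity>"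
  shows "(\<integral>\<^sup>+\<theta>\<in>{e..\<tau>}. G \<theta> t \<partial>lborel) + ennreal l * (\<integral>\<^sup>+r\<in>{0..t}. G e r \<partial>lborel)
           + (\<integral>\<^sup>+s\<in>{0..t}. (\<integral>\<^sup>+\<theta>\<in>{e..\<tau>}. R s \<theta> \<partial>lborel) \<partial>lborel)
       = (\<integral>\<^sup>+\<theta>\<in>{e..\<tau>}. Z \<theta> \<partial>lborel) + ennreal l * (\<integral>\<^sup>+r\<in>{0..t}. G \<tau> r \<partial>lborel)
           + (\<integral>\<^sup>+s\<in>{0..t}. (\<integral>\<^sup>+\<theta>\<in>{e..\<tau>}. P s \<theta> \<partial>lborel) \<partial>lborel)"
proof -
  have I: "(\<integral>\<^sup>+\<theta>\<in>{e..\<tau>}. G \<theta> t \<partial>lborel) + (\<integral>\<^sup>+\<theta>\<in>{e..\<tau>}. duhamel l R \<theta> t \<partial>lborel)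
      = (\<integral>\<^sup>+\<theta>\<in>{e..\<tau>}. Z (\<theta> + l * t) \<partial>lborel) + (\<integral>\<^sup>+\<theta>\<in>{e..\<tau>}. duhamel l P \<theta> t \<partial>lborel)"
    using assms by (subst (1 2) nn_integral_add[symmetric])
       (auto simp: distrib_right[symmetric] eq indicator_def intro!: nn_integral_cong)
  have T: "(\<integral>\<^sup>+r\<in>{0..t}. G c r \<partial>lborel) + (\<integral>\<^sup>+r\<in>{0..t}. duhamel l R c r \<partial>lborel)
      = (\<integral>\<^sup>+r\<in>{0..t}. Z (c + l * r) \<partial>lborel) + (\<integral>\<^sup>+r\<in>{0..t}. duhamel l P c r \<partial>lborel)" if "e \<le> c" for c
    using assms that by (subst (1 2) nn_integral_add[symmetric])
       (auto simp: distrib_right[symmetric] eq indicator_def intro!: nn_integral_cong)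
  note bR = duhamel_shift_balance[of R l t e \<tau>, OF assms(4-7)]
  note bP = duhamel_shift_balance[of P l t e \<tau>, OF assms(3,5,6,7)]
  note bZ = nn_integral_shift_balance[of Z l t e \<tau>, OF assms(2,5,6,7)]
  define L where "L = ennreal l"
  note bR = bR[folded L_def] and bP = bP[folded L_def] and bZ = bZ[folded L_def]
  define X where "X = (\<integral>\<^sup>+\<theta>\<in>{e..\<tau>}. G \<theta> t \<partial>lborel) + L * (\<integral>\<^sup>+r\<in>{0..t}. G e r \<partial>lborel)
           + (\<integral>\<^sup>+s\<in>{0..t}. (\<integral>\<^sup>+\<theta>\<in>{e..\<tau>}. R s \<theta> \<partial>lborel) \<partial>lborel)"
  define Y where "Y = (\<integral>\<^sup>+\<theta>\<in>{e..\<tau>}. Z \<theta> \<partial>lborel) + L * (\<integral>\<^sup>+r\<in>{0..t}. G \<tau> r \<partial>lborel)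
           + (\<integral>\<^sup>+s\<in>{0..t}. (\<integral>\<^sup>+\<theta>\<in>{e..\<tau>}. P s \<theta> \<partial>lborel) \<partial>lborel)"
  define J where "J = L * (\<integral>\<^sup>+r\<in>{0..t}. duhamel l R \<tau> r \<partial>lborel)"
  have "X + J = (\<integral>\<^sup>+\<theta>\<in>{e..\<tau>}. G \<theta> t \<partial>lborel) + L * (\<integral>\<^sup>+r\<in>{0..t}. G e r \<partial>lborel)
      + ((\<integral>\<^sup>+\<theta>\<in>{e..\<tau>}. duhamel l R \<theta> t \<partial>lborel) + L * (\<integral>\<^sup>+r\<in>{0..t}. duhamel l R e r \<partial>lborel))"
    unfolding bR X_def J_def by (simp add: add_ac)
  also have "\<dots> = (\<integral>\<^sup>+\<theta>\<in>{e..\<tau>}. G \<theta> t \<partial>lborel) + (\<integral>\<^sup>+\<theta>\<in>{e..\<tau>}. duhamel l R \<theta> t \<partial>lborel)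
      + L * ((\<integral>\<^sup>+r\<in>{0..t}. G e r \<partial>lborel) + (\<integral>\<^sup>+r\<in>{0..t}. duhamel l R e r \<partial>lborel))"
    by (simp add: distrib_left add_ac)
  also have "\<dots> = ((\<integral>\<^sup>+\<theta>\<in>{e..\<tau>}. Z (\<theta> + l * t) \<partial>lborel) + L * (\<integral>\<^sup>+r\<in>{0..t}. Z (e + l * r) \<partial>lborel))
      + ((\<integral>\<^sup>+\<theta>\<in>{e..\<tau>}. duhamel l P \<theta> t \<partial>lborel) + L * (\<integral>\<^sup>+r\<in>{0..t}. duhamel l P e r \<partial>lborel))"
    unfolding I T[OF order_refl] by (simp add: distrib_left add_ac)
  also have "\<dots> = (\<integral>\<^sup>+\<theta>\<in>{e..\<tau>}. Z \<theta> \<partial>lborel) + (\<integral>\<^sup>+s\<in>{0..t}. (\<integral>\<^sup>+\<theta>\<in>{e..\<tau>}. P s \<theta> \<partial>lborel) \<partial>lborel)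
      + L * ((\<integral>\<^sup>+r\<in>{0..t}. Z (\<tau> + l * r) \<partial>lborel) + (\<integral>\<^sup>+r\<in>{0..t}. duhamel l P \<tau> r \<partial>lborel))"
    unfolding bZ bP by (simp add: distrib_left add_ac)
  also have "\<dots> = Y + J"
    unfolding T[OF \<open>e \<le> \<tau>\<close>, symmetric] Y_def J_def by (simp add: distrib_left add_ac)
  finally have "X + J = Y + J" .
  moreover have "J < \<infinity>"
    using fin unfolding J_def L_def by (simp add: ennreal_mult_less_top)
  ultimately have "X = Y"
    using ennreal_add_left_cancel[of J X Y] by (auto simp: add.commute)
  then show ?thesis unfolding X_def Y_def L_def .
qed

section \<open>Mild solutions of a linear equation with sources\<close>

lemma heat_nn_integral:
  fixes h :: "'b \<Rightarrow> 'a::euclidean_space \<Rightarrow> ennreal"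
  assumes [measurable]: "case_prod h \<in> borel_measurable (M \<Otimes>\<^sub>M borel)" and "sigma_finite_measure M"
  shows "heat \<theta> (\<lambda>y. \<integral>\<^sup>+s. h s y \<partial>M) x = (\<integral>\<^sup>+s. heat \<theta> (h s) x \<partial>M)"
proof (cases "\<theta> = 0")
  case False
  interpret M: sigma_finite_measure M by fact
  interpret pair_sigma_finite M "lborel :: 'a measure" by standard
  have "heat \<theta> (\<lambda>y. \<integral>\<^sup>+s. h s y \<partial>M) x = (\<integral>\<^sup>+y. \<integral>\<^sup>+s. ennreal (heat_kernel \<theta> (x - y)) * h s y \<partial>M \<partial>lborel)"
    using False by (simp add: heat_def nn_integral_cmult)
  also have "\<dots> = (\<integral>\<^sup>+s. \<integral>\<^sup>+y. ennreal (heat_kernel \<theta> (x - y)) * h s y \<partial>lborel \<partial>M)"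
    by (rule Fubini') measurable
  finally show ?thesis using False by (simp add: heat_def)
qed simp

lemma nn_integral_time_heat:
  fixes M :: "real \<Rightarrow> 'a::euclidean_space \<Rightarrow> ennreal"
  assumes [measurable]: "case_prod M \<in> borel_measurable (borel \<Otimes>\<^sub>M borel)" and "0 \<le> D"
  shows "(\<integral>\<^sup>+x. (\<integral>\<^sup>+s\<in>{0..t}. heat (D * (t - s)) (M s) x \<partial>lborel) \<partial>lborel)
       = (\<integral>\<^sup>+s\<in>{0..t}. (\<integral>\<^sup>+x. M s x \<partial>lborel) \<partial>lborel)"
proof -
  have "(\<integral>\<^sup>+x. (\<integral>\<^sup>+s\<in>{0..t}. heat (D * (t - s)) (M s) x \<partial>lborel) \<partial>lborel)
      = (\<integral>\<^sup>+s. (\<integral>\<^sup>+x. heat (D * (t - s)) (M s) x * indicator {0..t} s \<partial>lborel) \<partial>lborel)"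
    by (subst lborel_pair.Fubini') auto
  also have "\<dots> = (\<integral>\<^sup>+s\<in>{0..t}. (\<integral>\<^sup>+x. M s x \<partial>lborel) \<partial>lborel)"
    using assms by (intro nn_integral_cong)
      (auto simp: indicator_def nn_integral_multc nn_integral_heat)
  finally show ?thesis .
qed


text \<open>
  A single component with diffusion rate \<open>D\<close>, gain \<open>P\<close> and loss \<open>R\<close>, seen as a solution of a linear equation. The
  loss stands on the left-hand side, so no subtraction occurs.
\<close>

locale mild_solution =
  fixes D :: real and u0 :: "'a::euclidean_space \<Rightarrow> ennreal" and u P R :: "real \<Rightarrow> 'a \<Rightarrow> ennreal"
  assumes D_nonneg: "0 \<le> D"
    and measurable_u0 [measurable]: "u0 \<in> borel_measurable borel"
    and measurable_u [measurable]: "case_prod u \<in> borel_measurable (borel \<Otimes>\<^sub>M borel)"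
    and measurable_P [measurable]: "case_prod P \<in> borel_measurable (borel \<Otimes>\<^sub>M borel)"
    and measurable_R [measurable]: "case_prod R \<in> borel_measurable (borel \<Otimes>\<^sub>M borel)"
    and mild: "0 \<le> t \<Longrightarrow> AE x in lborel.
        u t x + (\<integral>\<^sup>+s\<in>{0..t}. heat (D * (t - s)) (R s) x \<partial>lborel)
        = heat (D * t) u0 x + (\<integral>\<^sup>+s\<in>{0..t}. heat (D * (t - s)) (P s) x \<partial>lborel)"
    and finite_u0: "(\<integral>\<^sup>+x. u0 x \<partial>lborel) < \<infinity>"
    and finite_P: "(\<integral>\<^sup>+s\<in>{0..t}. (\<integral>\<^sup>+x. P s x \<partial>lborel) \<partial>lborel) < \<infinity>"
    and finite_R: "(\<integral>\<^sup>+s\<in>{0..t}. (\<integral>\<^sup>+x. R s x \<partial>lborel) \<partial>lborel) < \<infinity>"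
begin

lemma heat_duhamel_integral:
  assumes [measurable]: "case_prod M \<in> borel_measurable (borel \<Otimes>\<^sub>M borel)" and "0 \<le> \<theta>"
  shows "heat \<theta> (\<lambda>x. \<integral>\<^sup>+s\<in>{0..t}. heat (D * (t - s)) (M s) x \<partial>lborel) x
       = duhamel D (\<lambda>s \<theta>. heat \<theta> (M s) x) \<theta> t"
proof -
  have "heat \<theta> (\<lambda>x. \<integral>\<^sup>+s\<in>{0..t}. heat (D * (t - s)) (M s) x \<partial>lborel) x
      = (\<integral>\<^sup>+s. heat \<theta> (\<lambda>x. indicator {0..t} s * heat (D * (t - s)) (M s) x) x \<partial>lborel)"
    by (subst heat_nn_integral) (auto simp: mult.commute sigma_finite_lborel)
  also have "\<dots> = duhamel D (\<lambda>s \<theta>. heat \<theta> (M s) x) \<theta> t"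
    unfolding duhamel_def
    using assms D_nonneg
    by (intro nn_integral_cong) (auto simp: indicator_def heat_cmult heat_heat)
  finally show ?thesis .
qed

text \<open>
  Applying the heat semigroup turns an identity that holds almost everywhere into one that holds at every
  point, as \<open>heat \<theta> g\<close> depends only on the class of \<open>g\<close> when \<open>\<theta> > 0\<close>.
\<close>

lemma heat_mild:
  assumes "0 < \<theta>" "0 \<le> t"
  shows "heat \<theta> (u t) x + duhamel D (\<lambda>s \<theta>. heat \<theta> (R s) x) \<theta> t
       = heat (\<theta> + D * t) u0 x + duhamel D (\<lambda>s \<theta>. heat \<theta> (P s) x) \<theta> t"
proof -
  have "heat \<theta> (\<lambda>x. u t x + (\<integral>\<^sup>+s\<in>{0..t}. heat (D * (t - s)) (R s) x \<partial>lborel))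
      = heat \<theta> (\<lambda>x. heat (D * t) u0 x + (\<integral>\<^sup>+s\<in>{0..t}. heat (D * (t - s)) (P s) x \<partial>lborel))"
    using assms by (intro heat_cong_AE mild) auto
  from fun_cong[OF this, of x] show ?thesis
    using assms D_nonneg by (simp add: heat_add heat_duhamel_integral heat_heat)
qed

lemma mass_balance:
  assumes "0 \<le> t"
  shows "(\<integral>\<^sup>+x. u t x \<partial>lborel) + (\<integral>\<^sup>+s\<in>{0..t}. (\<integral>\<^sup>+x. R s x \<partial>lborel) \<partial>lborel)
       = (\<integral>\<^sup>+x. u0 x \<partial>lborel) + (\<integral>\<^sup>+s\<in>{0..t}. (\<integral>\<^sup>+x. P s x \<partial>lborel) \<partial>lborel)"
proof -
  have "(\<integral>\<^sup>+x. u t x + (\<integral>\<^sup>+s\<in>{0..t}. heat (D * (t - s)) (R s) x \<partial>lborel) \<partial>lborel)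
      = (\<integral>\<^sup>+x. heat (D * t) u0 x + (\<integral>\<^sup>+s\<in>{0..t}. heat (D * (t - s)) (P s) x \<partial>lborel) \<partial>lborel)"
    using assms by (intro nn_integral_cong_AE mild)
  then show ?thesis
    using assms D_nonneg by (simp add: nn_integral_add nn_integral_time_heat nn_integral_heat)
qed

definition mass_bound :: "real \<Rightarrow> ennreal" where
  "mass_bound T = (\<integral>\<^sup>+x. u0 x \<partial>lborel) + (\<integral>\<^sup>+s\<in>{0..T}. (\<integral>\<^sup>+x. P s x \<partial>lborel) \<partial>lborel)"

lemma mass_bound_finite: "mass_bound T < \<infinity>"
  using finite_u0 finite_P unfolding mass_bound_def by simp

lemma mass_le:
  assumes "0 \<le> t" "t \<le> T"
  shows "(\<integral>\<^sup>+x. u t x \<partial>lborel) \<le> mass_bound T"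
proof -
  have "(\<integral>\<^sup>+x. u t x \<partial>lborel) \<le> (\<integral>\<^sup>+x. u0 x \<partial>lborel) + (\<integral>\<^sup>+s\<in>{0..t}. (\<integral>\<^sup>+x. P s x \<partial>lborel) \<partial>lborel)"
    using mass_balance[OF assms(1)] by (metis le_iff_add)
  also have "\<dots> \<le> mass_bound T"
    unfolding mass_bound_def using assms
    by (intro add_left_mono nn_integral_mono) (auto simp: indicator_def)
  finally show ?thesis .
qed

end

lemma duhamel_le:
  assumes "\<And>s r. 0 \<le> s \<Longrightarrow> s \<le> t \<Longrightarrow> \<theta> \<le> r \<Longrightarrow> M s r \<le> B s" and "0 \<le> l"
  shows "duhamel l M \<theta> t \<le> (\<integral>\<^sup>+s\<in>{0..t}. B s \<partial>lborel)"
  unfolding duhamel_def using assms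
  by (intro nn_integral_mono) (auto simp: indicator_def)

text \<open>
  Supplies the finiteness that the cancellation in the balance law requires: kernels at times beyond \<open>\<theta>\<close> are
  bounded, and the sources are integrable.
\<close>

lemma nn_integral_duhamel_finite:
  assumes "\<And>s r. 0 \<le> s \<Longrightarrow> s \<le> t \<Longrightarrow> \<theta> \<le> r \<Longrightarrow> M s r \<le> B s" and "0 \<le> l"
    and "(\<integral>\<^sup>+s\<in>{0..t}. B s \<partial>lborel) < \<infinity>"
  shows "(\<integral>\<^sup>+r\<in>{0..t}. duhamel l M \<theta> r \<partial>lborel) < \<infinity>"
proof -
  define c where "c = (\<integral>\<^sup>+s\<in>{0..t}. B s \<partial>lborel)"
  have "duhamel l M \<theta> r \<le> c" if "r \<in> {0..t}" for r
  proof -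
    have "duhamel l M \<theta> r \<le> (\<integral>\<^sup>+s\<in>{0..r}. B s \<partial>lborel)"
      using assms that by (intro duhamel_le) auto
    also have "\<dots> \<le> c"
      unfolding c_def using that by (intro nn_integral_mono) (auto simp: indicator_def)
    finally show ?thesis .
  qed
  then have "(\<integral>\<^sup>+r\<in>{0..t}. duhamel l M \<theta> r \<partial>lborel) \<le> (\<integral>\<^sup>+r\<in>{0..t}. c \<partial>lborel)"
    by (intro nn_integral_mono) (auto simp: indicator_def)
  also have "\<dots> = c * emeasure lborel {0..t}"
    by (simp add: nn_integral_cmult)
  also have "\<dots> < \<infinity>"
    using assms(3) unfolding c_def by (cases "0 \<le> t") (auto simp: ennreal_mult_less_top)
  finally show ?thesis .
qed

text \<open>
  Convolution with \<open>\<Phi>\<^sub>e\<^sub>,\<^sub>\<tau> = \<integral>\<^sub>e\<^sup>\<tau> p\<^sub>\<theta> d\<theta>\<close>, an approximation of the fundamental solution of \<open>-\<Delta>\<close>.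
\<close>

definition potential :: "real \<Rightarrow> real \<Rightarrow> ('a::euclidean_space \<Rightarrow> ennreal) \<Rightarrow> 'a \<Rightarrow> ennreal" where
  "potential e \<tau> g x = (\<integral>\<^sup>+\<theta>\<in>{e..\<tau>}. heat \<theta> g x \<partial>lborel)"

lemma borel_measurable_potential [measurable (raw)]:
  fixes h :: "'b \<Rightarrow> 'a::euclidean_space \<Rightarrow> ennreal"
  assumes [measurable]: "case_prod h \<in> borel_measurable (M \<Otimes>\<^sub>M borel)" "g \<in> borel_measurable M"
  shows "(\<lambda>w. potential e \<tau> (h w) (g w)) \<in> borel_measurable M"
  unfolding potential_def by measurable

context mild_solution begin

lemma potential_balance:
  assumes "0 < e" "e \<le> \<tau>" "0 \<le> t"
  shows "potential e \<tau> (u t) x + ennreal D * (\<integral>\<^sup>+s\<in>{0..t}. heat e (u s) x \<partial>lborel)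
           + (\<integral>\<^sup>+s\<in>{0..t}. potential e \<tau> (R s) x \<partial>lborel)
       = potential e \<tau> u0 x + ennreal D * (\<integral>\<^sup>+s\<in>{0..t}. heat \<tau> (u s) x \<partial>lborel)
           + (\<integral>\<^sup>+s\<in>{0..t}. potential e \<tau> (P s) x \<partial>lborel)"
proof -
  define c where "c = ennreal (heat_kernel \<tau> (0 :: 'a))"
  have "(\<integral>\<^sup>+r\<in>{0..t}. duhamel D (\<lambda>s \<theta>. heat \<theta> (R s) x) \<tau> r \<partial>lborel) < \<infinity>"
  proof (rule nn_integral_duhamel_finite)
    show "heat r (R s) x \<le> c * (\<integral>\<^sup>+y. R s y \<partial>lborel)" if "\<tau> \<le> r" for s r
      unfolding c_def using that assms by (intro heat_le) auto
    show "(\<integral>\<^sup>+s\<in>{0..t}. (c * (\<integral>\<^sup>+y. R s y \<partial>lborel)) \<partial>lborel) < \<infinity>"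
      using finite_R[of t] unfolding c_def
      by (simp add: mult.assoc nn_integral_cmult ennreal_mult_less_top)
  qed (rule D_nonneg)
  then show ?thesis
    unfolding potential_def using assms D_nonneg
    by (intro truncated_potential_balance[where G = "\<lambda>\<theta> r. heat \<theta> (u r) x" and Z = "\<lambda>\<theta>. heat \<theta> u0 x"
        and P = "\<lambda>s \<theta>. heat \<theta> (P s) x" and R = "\<lambda>s \<theta>. heat \<theta> (R s) x"])
      (auto simp: heat_mild)
qed

end

section \<open>The interaction energy of two components\<close>

definition overlap :: "real \<Rightarrow> ('a::euclidean_space \<Rightarrow> ennreal) \<Rightarrow> ('a \<Rightarrow> ennreal) \<Rightarrow> ennreal" where
  "overlap \<theta> g h = (\<integral>\<^sup>+x. g x * heat \<theta> h x \<partial>lborel)"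

definition energy :: "real \<Rightarrow> real \<Rightarrow> ('a::euclidean_space \<Rightarrow> ennreal) \<Rightarrow> ('a \<Rightarrow> ennreal) \<Rightarrow> ennreal" where
  "energy e \<tau> g h = (\<integral>\<^sup>+x. g x * potential e \<tau> h x \<partial>lborel)"

lemma borel_measurable_overlap [measurable (raw)]:
  fixes h :: "'b \<Rightarrow> 'a::euclidean_space \<Rightarrow> ennreal"
  assumes [measurable]: "f \<in> borel_measurable M" "case_prod g \<in> borel_measurable (M \<Otimes>\<^sub>M borel)"
    "case_prod h \<in> borel_measurable (M \<Otimes>\<^sub>M borel)"
  shows "(\<lambda>w. overlap (f w) (g w) (h w)) \<in> borel_measurable M"
  unfolding overlap_def by measurable

lemma borel_measurable_energy [measurable (raw)]:
  fixes h :: "'b \<Rightarrow> 'a::euclidean_space \<Rightarrow> ennreal"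
  assumes [measurable]: "case_prod g \<in> borel_measurable (M \<Otimes>\<^sub>M borel)"
    "case_prod h \<in> borel_measurable (M \<Otimes>\<^sub>M borel)"
  shows "(\<lambda>w. energy e \<tau> (g w) (h w)) \<in> borel_measurable M"
  unfolding energy_def by measurable

lemma energy_eq_integral_overlap:
  assumes [measurable]: "g \<in> borel_measurable borel" "h \<in> borel_measurable borel"
  shows "energy e \<tau> g h = (\<integral>\<^sup>+\<theta>\<in>{e..\<tau>}. overlap \<theta> g h \<partial>lborel)"
proof -
  have "energy e \<tau> g h = (\<integral>\<^sup>+x. \<integral>\<^sup>+\<theta>. g x * (heat \<theta> h x * indicator {e..\<tau>} \<theta>) \<partial>lborel \<partial>lborel)"
    unfolding energy_def potential_def by (simp add: nn_integral_cmult)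
  also have "\<dots> = (\<integral>\<^sup>+\<theta>. \<integral>\<^sup>+x. (g x * heat \<theta> h x) * indicator {e..\<tau>} \<theta> \<partial>lborel \<partial>lborel)"
    by (subst lborel_pair.Fubini') (auto simp: mult.assoc)
  finally show ?thesis by (simp add: overlap_def nn_integral_multc)
qed

lemma overlap_commute:
  assumes "0 \<le> \<theta>" "g \<in> borel_measurable borel" "h \<in> borel_measurable borel"
  shows "overlap \<theta> g h = overlap \<theta> h g"
  unfolding overlap_def using heat_self_adjoint[OF assms] by (simp add: mult.commute)

lemma overlap_le:
  fixes g h :: "'a::euclidean_space \<Rightarrow> ennreal"
  assumes "0 < e" "e \<le> \<theta>" and [measurable]: "g \<in> borel_measurable borel" "h \<in> borel_measurable borel"
  shows "overlap \<theta> g h \<le> ennreal (heat_kernel e (0 :: 'a))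
           * ((\<integral>\<^sup>+x. g x \<partial>lborel) * (\<integral>\<^sup>+x. h x \<partial>lborel))"
proof -
  have "overlap \<theta> g h \<le> (\<integral>\<^sup>+x. g x * (ennreal (heat_kernel e (0 :: 'a)) * (\<integral>\<^sup>+y. h y \<partial>lborel)) \<partial>lborel)"
    unfolding overlap_def using assms by (intro nn_integral_mono mult_left_mono heat_le) auto
  then show ?thesis by (simp add: nn_integral_multc mult_ac)
qed

text \<open>
  The bookkeeping of the product rule. Here \<open>c\<close> stands for integrals over the square \<open>[0,t]\<^sup>2\<close> of source times,
  and \<open>l\<close> and \<open>u\<close> for those over its two triangles. All terms are finite, so the identity is linear arithmetic
  over the reals.
\<close>

lemma product_rule_arithmetic:
  fixes a :: ennreal
  assumes fin: "z < \<infinity>" "rS < \<infinity>" "rQ < \<infinity>" "qP < \<infinity>" "qR < \<infinity>"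
      "cPS < \<infinity>" "cPQ < \<infinity>" "cRS < \<infinity>" "cRQ < \<infinity>"
    and a: "a + pR = b + pP" and b: "b + rQ = z + rS"
    and p: "pP + cPQ = qP + cPS" "pR + cRQ = qR + cRS"
    and x: "xP + lPQ = qP + lPS" "xR + lRQ = qR + lRS"
    and y: "yS + uRS = rS + uPS" "yQ + uRQ = rQ + uPQ"
    and c: "cPS = lPS + uPS" "cPQ = lPQ + uPQ" "cRS = lRS + uRS" "cRQ = lRQ + uRQ"
  shows "a + xR + yQ = z + xP + yS"
proof -
  have lu: "lPS < \<infinity>" "uPS < \<infinity>" "lPQ < \<infinity>" "uPQ < \<infinity>" "lRS < \<infinity>" "uRS < \<infinity>" "lRQ < \<infinity>" "uRQ < \<infinity>"
    using fin c by (auto simp: less_top[symmetric])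
  have fp: "pP < \<infinity>" "pR < \<infinity>" "xP < \<infinity>" "xR < \<infinity>" "yS < \<infinity>" "yQ < \<infinity>" "b < \<infinity>"
    using p x y b fin lu by (metis ennreal_add_less_top infinity_ennreal_def)+
  then have "a < \<infinity>"
    using a by (metis ennreal_add_less_top infinity_ennreal_def)
  note F = fin lu fp this
  have R: "enn2real s + enn2real t = enn2real v + enn2real w"
    if "s + t = v + w" "s < \<infinity>" "t < \<infinity>" "v < \<infinity>" "w < \<infinity>" for s t v w
    using that by (metis enn2real_plus infinity_ennreal_def)
  have C: "enn2real s = enn2real t + enn2real v" if "s = t + v" "t < \<infinity>" "v < \<infinity>" for s t v
    using that by (metis enn2real_plus infinity_ennreal_def)
  have "enn2real a + enn2real xR + enn2real yQ = enn2real z + enn2real xP + enn2real yS"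
    using R[OF a] R[OF b] R[OF p(1)] R[OF p(2)] R[OF x(1)] R[OF x(2)] R[OF y(1)] R[OF y(2)]
      C[OF c(1)] C[OF c(2)] C[OF c(3)] C[OF c(4)] F
    by simp
  then have "enn2real (a + xR + yQ) = enn2real (z + xP + yS)"
    using F by (simp add: enn2real_plus)
  then show ?thesis
    using F by (metis ennreal_add_less_top ennreal_enn2real infinity_ennreal_def)
qed

lemma set_nn_integral_cmult:
  fixes f :: "real \<Rightarrow> ennreal"
  assumes [measurable]: "f \<in> borel_measurable borel"
  shows "(\<integral>\<^sup>+s\<in>{a..b}. (c * f s) \<partial>lborel) = c * (\<integral>\<^sup>+s\<in>{a..b}. f s \<partial>lborel)"
  by (simp add: mult.assoc nn_integral_cmult)

lemma set_nn_integral_multc: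
  fixes f :: "real \<Rightarrow> ennreal"
  assumes "f \<in> borel_measurable borel"
  shows "(\<integral>\<^sup>+s\<in>{a..b}. (f s * c) \<partial>lborel) = (\<integral>\<^sup>+s\<in>{a..b}. f s \<partial>lborel) * c"
  using set_nn_integral_cmult[OF assms, of c a b] by (simp add: mult.commute)

lemma nn_integral_square_eq_triangles:
  fixes h :: "real \<Rightarrow> real \<Rightarrow> ennreal"
  assumes [measurable]: "case_prod h \<in> borel_measurable (borel \<Otimes>\<^sub>M borel)"
  shows "(\<integral>\<^sup>+s\<in>{0..t}. (\<integral>\<^sup>+r\<in>{0..t}. h s r \<partial>lborel) \<partial>lborel)
       = (\<integral>\<^sup>+s\<in>{0..t}. (\<integral>\<^sup>+r\<in>{0..s}. h s r \<partial>lborel) \<partial>lborel)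
         + (\<integral>\<^sup>+r\<in>{0..t}. (\<integral>\<^sup>+s\<in>{0..r}. h s r \<partial>lborel) \<partial>lborel)"
proof -
  have "(\<integral>\<^sup>+s\<in>{0..t}. (\<integral>\<^sup>+r\<in>{0..t}. h s r \<partial>lborel) \<partial>lborel)
      = (\<integral>\<^sup>+s\<in>{0..t}. ((\<integral>\<^sup>+r\<in>{0..s}. h s r \<partial>lborel) + (\<integral>\<^sup>+r\<in>{s..t}. h s r \<partial>lborel)) \<partial>lborel)"
  proof (rule nn_integral_cong)
    fix s :: real
    have "h s \<in> borel_measurable borel" by measurable
    from nn_integral_interval_combine[OF this, of 0 s t]
    show "(\<integral>\<^sup>+r\<in>{0..t}. h s r \<partial>lborel) * indicator {0..t} s
        = ((\<integral>\<^sup>+r\<in>{0..s}. h s r \<partial>lborel) + (\<integral>\<^sup>+r\<in>{s..t}. h s r \<partial>lborel)) * indicator {0..t} s"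
      by (cases "s \<in> {0..t}") auto
  qed
  then show ?thesis
    by (simp add: nn_integral_triangle[OF assms] distrib_right nn_integral_add)
qed

context mild_solution begin

lemma overlap_mild:
  assumes "0 < \<theta>" "0 \<le> t" and [measurable]: "h \<in> borel_measurable borel"
  shows "overlap \<theta> h (u t) + duhamel D (\<lambda>s \<theta>. overlap \<theta> h (R s)) \<theta> t
       = overlap (\<theta> + D * t) h u0 + duhamel D (\<lambda>s \<theta>. overlap \<theta> h (P s)) \<theta> t"
proof -
  have I: "(\<integral>\<^sup>+x. h x * duhamel D (\<lambda>s \<theta>. heat \<theta> (M s) x) \<theta> t \<partial>lborel)
      = duhamel D (\<lambda>s \<theta>. overlap \<theta> h (M s)) \<theta> t"
    if [measurable]: "case_prod M \<in> borel_measurable (borel \<Otimes>\<^sub>M (borel :: 'a measure))" for M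
  proof -
    have "(\<integral>\<^sup>+x. h x * duhamel D (\<lambda>s \<theta>. heat \<theta> (M s) x) \<theta> t \<partial>lborel)
        = (\<integral>\<^sup>+x. \<integral>\<^sup>+s. h x * (heat (\<theta> + D * (t - s)) (M s) x * indicator {0..t} s) \<partial>lborel \<partial>lborel)"
      unfolding duhamel_def by (simp add: nn_integral_cmult)
    also have "\<dots> = (\<integral>\<^sup>+s. \<integral>\<^sup>+x. (h x * heat (\<theta> + D * (t - s)) (M s) x) * indicator {0..t} s \<partial>lborel \<partial>lborel)"
      by (subst lborel_pair.Fubini') (auto simp: mult.assoc)
    finally show ?thesis by (simp add: nn_integral_multc overlap_def duhamel_def)
  qed
  have [measurable]: "(\<lambda>x. duhamel D (\<lambda>s \<theta>. heat \<theta> (R s) x) \<theta> t) \<in> borel_measurable borel"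
    "(\<lambda>x. duhamel D (\<lambda>s \<theta>. heat \<theta> (P s) x) \<theta> t) \<in> borel_measurable borel"
    unfolding duhamel_def by measurable
  have "(\<integral>\<^sup>+x. h x * (heat \<theta> (u t) x + duhamel D (\<lambda>s \<theta>. heat \<theta> (R s) x) \<theta> t) \<partial>lborel)
      = (\<integral>\<^sup>+x. h x * (heat (\<theta> + D * t) u0 x + duhamel D (\<lambda>s \<theta>. heat \<theta> (P s) x) \<theta> t) \<partial>lborel)"
    using assms by (simp add: heat_mild)
  then show ?thesis
    by (simp add: distrib_left nn_integral_add I flip: overlap_def)
qed

end

locale mild_pair =
  A: mild_solution D u0 u P R + B: mild_solution E v0 v S Q
  for D :: real and u0 :: "'a::euclidean_space \<Rightarrow> ennreal" and u P R
    and E :: real and v0 :: "'a \<Rightarrow> ennreal" and v S Q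
begin

lemma square_finite:
  assumes "0 < \<theta>" and [measurable]: "case_prod X \<in> borel_measurable (borel \<Otimes>\<^sub>M (borel :: 'a measure))"
    "case_prod Y \<in> borel_measurable (borel \<Otimes>\<^sub>M (borel :: 'a measure))"
    and X: "(\<integral>\<^sup>+s\<in>{0..t}. (\<integral>\<^sup>+x. X s x \<partial>lborel) \<partial>lborel) < \<infinity>"
    and Y: "(\<integral>\<^sup>+s\<in>{0..t}. (\<integral>\<^sup>+x. Y s x \<partial>lborel) \<partial>lborel) < \<infinity>"
  shows "(\<integral>\<^sup>+s\<in>{0..t}. (\<integral>\<^sup>+r\<in>{0..t}. overlap (\<theta> + D * (t - s) + E * (t - r)) (X s) (Y r) \<partial>lborel) \<partial>lborel) < \<infinity>"
proof -
  define c where "c = ennreal (heat_kernel \<theta> (0 :: 'a))"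
  have "(\<integral>\<^sup>+s\<in>{0..t}. (\<integral>\<^sup>+r\<in>{0..t}. overlap (\<theta> + D * (t - s) + E * (t - r)) (X s) (Y r) \<partial>lborel) \<partial>lborel)
    \<le> (\<integral>\<^sup>+s\<in>{0..t}. (\<integral>\<^sup>+r\<in>{0..t}. (c * ((\<integral>\<^sup>+x. X s x \<partial>lborel) * (\<integral>\<^sup>+x. Y r x \<partial>lborel))) \<partial>lborel) \<partial>lborel)"
    unfolding c_def using assms A.D_nonneg B.D_nonneg
    by (intro nn_integral_mono) (auto simp: indicator_def intro!: nn_integral_mono overlap_le)
  also have "\<dots> = c * ((\<integral>\<^sup>+s\<in>{0..t}. (\<integral>\<^sup>+x. X s x \<partial>lborel) \<partial>lborel) * (\<integral>\<^sup>+s\<in>{0..t}. (\<integral>\<^sup>+x. Y s x \<partial>lborel) \<partial>lborel))"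
    by (simp add: set_nn_integral_cmult set_nn_integral_multc)
  also have "\<dots> < \<infinity>"
    using X Y by (auto simp: c_def ennreal_mult_less_top)
  finally show ?thesis .
qed

lemma line_finite:
  fixes X :: "real \<Rightarrow> 'a \<Rightarrow> ennreal"
  assumes "0 < \<theta>" and [measurable]: "case_prod X \<in> borel_measurable (borel \<Otimes>\<^sub>M (borel :: 'a measure))"
    "g \<in> borel_measurable borel" "f \<in> borel_measurable borel"
    and X: "(\<integral>\<^sup>+s\<in>{0..t}. (\<integral>\<^sup>+x. X s x \<partial>lborel) \<partial>lborel) < \<infinity>"
    and g: "(\<integral>\<^sup>+x. g x \<partial>lborel) < \<infinity>" and f: "\<And>s. 0 \<le> s \<Longrightarrow> s \<le> t \<Longrightarrow> \<theta> \<le> f s"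
  shows "(\<integral>\<^sup>+s\<in>{0..t}. overlap (f s) (X s) g \<partial>lborel) < \<infinity>"
proof -
  define c where "c = ennreal (heat_kernel \<theta> (0 :: 'a))"
  have "(\<integral>\<^sup>+s\<in>{0..t}. overlap (f s) (X s) g \<partial>lborel)
    \<le> (\<integral>\<^sup>+s\<in>{0..t}. (c * ((\<integral>\<^sup>+x. X s x \<partial>lborel) * (\<integral>\<^sup>+x. g x \<partial>lborel))) \<partial>lborel)"
    unfolding c_def using assms
    by (intro nn_integral_mono) (auto simp: indicator_def intro!: overlap_le)
  also have "\<dots> = c * ((\<integral>\<^sup>+s\<in>{0..t}. (\<integral>\<^sup>+x. X s x \<partial>lborel) \<partial>lborel) * (\<integral>\<^sup>+x. g x \<partial>lborel))"
    by (subst set_nn_integral_cmult, measurable, subst set_nn_integral_multc, measurable)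
  also have "\<dots> < \<infinity>"
    using X g by (auto simp: c_def ennreal_mult_less_top)
  finally show ?thesis .
qed

text \<open>
  The Duhamel formula for the pair \<open>u \<otimes> v\<close>. Expanding both factors at time \<open>t\<close> gives an integral over the
  square of source times \<open>(s, r)\<close>. In the claimed formula the product \<open>P(s) v(s)\<close> carries the sources of \<open>v\<close> with \<open>r \<le> s\<close>, and
  \<open>u(r) S(r)\<close> those of \<open>u\<close> with \<open>s \<le> r\<close>; the two triangles make up the square, and the kernel index is
  \<open>\<theta> + D (t - s) + E (t - r)\<close> throughout.
\<close>

lemma overlap_product_rule:
  assumes \<theta>: "0 < \<theta>" and t: "0 \<le> t"
  shows "overlap \<theta> (u t) (v t)
      + duhamel (D + E) (\<lambda>s \<theta>. overlap \<theta> (R s) (v s) + overlap \<theta> (u s) (Q s)) \<theta> t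
    = overlap (\<theta> + (D + E) * t) u0 v0
      + duhamel (D + E) (\<lambda>s \<theta>. overlap \<theta> (P s) (v s) + overlap \<theta> (u s) (S s)) \<theta> t"
proof -
  note nonneg = A.D_nonneg B.D_nonneg
  define c where "c X Y = (\<integral>\<^sup>+s\<in>{0..t}. (\<integral>\<^sup>+r\<in>{0..t}. overlap (\<theta> + D * (t - s) + E * (t - r)) (X s) (Y r) \<partial>lborel) \<partial>lborel)"
    for X Y :: "real \<Rightarrow> 'a \<Rightarrow> ennreal"
  define l where "l X Y = (\<integral>\<^sup>+s\<in>{0..t}. (\<integral>\<^sup>+r\<in>{0..s}. overlap (\<theta> + D * (t - s) + E * (t - r)) (X s) (Y r) \<partial>lborel) \<partial>lborel)"
    for X Y :: "real \<Rightarrow> 'a \<Rightarrow> ennreal"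
  define w where "w X Y = (\<integral>\<^sup>+r\<in>{0..t}. (\<integral>\<^sup>+s\<in>{0..r}. overlap (\<theta> + D * (t - s) + E * (t - r)) (X s) (Y r) \<partial>lborel) \<partial>lborel)"
    for X Y :: "real \<Rightarrow> 'a \<Rightarrow> ennreal"
  define p where "p X = (\<integral>\<^sup>+s\<in>{0..t}. overlap (\<theta> + D * (t - s)) (X s) (v t) \<partial>lborel)"
    for X :: "real \<Rightarrow> 'a \<Rightarrow> ennreal"
  define q where "q X = (\<integral>\<^sup>+s\<in>{0..t}. overlap (\<theta> + D * (t - s) + E * t) (X s) v0 \<partial>lborel)"
    for X :: "real \<Rightarrow> 'a \<Rightarrow> ennreal"
  define x where "x X = (\<integral>\<^sup>+s\<in>{0..t}. overlap (\<theta> + (D + E) * (t - s)) (X s) (v s) \<partial>lborel)"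
    for X :: "real \<Rightarrow> 'a \<Rightarrow> ennreal"
  define r where "r Y = (\<integral>\<^sup>+r\<in>{0..t}. overlap (\<theta> + D * t + E * (t - r)) u0 (Y r) \<partial>lborel)"
    for Y :: "real \<Rightarrow> 'a \<Rightarrow> ennreal"
  define y where "y Y = (\<integral>\<^sup>+r\<in>{0..t}. overlap (\<theta> + (D + E) * (t - r)) (u r) (Y r) \<partial>lborel)"
    for Y :: "real \<Rightarrow> 'a \<Rightarrow> ennreal"
  have c_eq: "c X Y = l X Y + w X Y"
    if [measurable]: "case_prod X \<in> borel_measurable (borel \<Otimes>\<^sub>M (borel :: 'a measure))"
      "case_prod Y \<in> borel_measurable (borel \<Otimes>\<^sub>M (borel :: 'a measure))" for X Y
    unfolding c_def l_def w_def by (rule nn_integral_square_eq_triangles) measurable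
  have p_eq: "p X + c X Q = q X + c X S"
    if [measurable]: "case_prod X \<in> borel_measurable (borel \<Otimes>\<^sub>M (borel :: 'a measure))" for X
  proof -
    have "overlap (\<theta> + D * (t - s)) (X s) (v t)
          + (\<integral>\<^sup>+r\<in>{0..t}. overlap (\<theta> + D * (t - s) + E * (t - r)) (X s) (Q r) \<partial>lborel)
        = overlap (\<theta> + D * (t - s) + E * t) (X s) v0
          + (\<integral>\<^sup>+r\<in>{0..t}. overlap (\<theta> + D * (t - s) + E * (t - r)) (X s) (S r) \<partial>lborel)"
      if "s \<in> {0..t}" for s
      using that \<theta> t nonneg B.overlap_mild[of "\<theta> + D * (t - s)" t "X s"]
      by (simp add: duhamel_def add_pos_nonneg)
    then show ?thesis
      unfolding p_def c_def q_def
      by (subst (1 2) nn_integral_add[symmetric])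
         (auto simp: distrib_right[symmetric] indicator_def intro!: nn_integral_cong)
  qed
  have x_eq: "x X + l X Q = q X + l X S"
    if [measurable]: "case_prod X \<in> borel_measurable (borel \<Otimes>\<^sub>M (borel :: 'a measure))" for X
  proof -
    have "overlap (\<theta> + (D + E) * (t - s)) (X s) (v s)
          + (\<integral>\<^sup>+r\<in>{0..s}. overlap (\<theta> + D * (t - s) + E * (t - r)) (X s) (Q r) \<partial>lborel)
        = overlap (\<theta> + D * (t - s) + E * t) (X s) v0
          + (\<integral>\<^sup>+r\<in>{0..s}. overlap (\<theta> + D * (t - s) + E * (t - r)) (X s) (S r) \<partial>lborel)"
      if "s \<in> {0..t}" for s
    proof -
      have "0 < \<theta> + (D + E) * (t - s)"
        using that \<theta> nonneg by (simp add: add_pos_nonneg)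
      from B.overlap_mild[OF this, of s "X s"] that show ?thesis
        by (simp add: duhamel_def algebra_simps)
    qed
    then show ?thesis
      unfolding x_def l_def q_def
      by (subst (1 2) nn_integral_add[symmetric])
         (auto simp: distrib_right[symmetric] indicator_def intro!: nn_integral_cong)
  qed
  have y_eq: "y Y + w R Y = r Y + w P Y"
    if [measurable]: "case_prod Y \<in> borel_measurable (borel \<Otimes>\<^sub>M (borel :: 'a measure))" for Y
  proof -
    have "overlap (\<theta> + (D + E) * (t - r)) (u r) (Y r)
          + (\<integral>\<^sup>+s\<in>{0..r}. overlap (\<theta> + D * (t - s) + E * (t - r)) (R s) (Y r) \<partial>lborel)
        = overlap (\<theta> + D * t + E * (t - r)) u0 (Y r)
          + (\<integral>\<^sup>+s\<in>{0..r}. overlap (\<theta> + D * (t - s) + E * (t - r)) (P s) (Y r) \<partial>lborel)"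
      if "r \<in> {0..t}" for r
    proof -
      have sym: "(\<integral>\<^sup>+s\<in>{0..r}. overlap (\<theta> + D * (t - s) + E * (t - r)) (M s) (Y r) \<partial>lborel)
          = duhamel D (\<lambda>s \<theta>. overlap \<theta> (Y r) (M s)) (\<theta> + (D + E) * (t - r)) r"
        if [measurable]: "case_prod M \<in> borel_measurable (borel \<Otimes>\<^sub>M (borel :: 'a measure))" for M
      proof -
        have "overlap (\<theta> + D * (t - s) + E * (t - r)) (M s) (Y r)
            = overlap (\<theta> + (D + E) * (t - r) + D * (r - s)) (Y r) (M s)" if "s \<in> {0..r}" for s
        proof -
          have "\<theta> + D * (t - s) + E * (t - r) = \<theta> + (D + E) * (t - r) + D * (r - s)"
            by (simp add: algebra_simps)
          moreover have "0 \<le> \<theta> + (D + E) * (t - r) + D * (r - s)"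
            using that \<open>r \<in> {0..t}\<close> \<theta> nonneg by simp
          ultimately show ?thesis by (simp only:) (intro overlap_commute; measurable)
        qed
        then show ?thesis
          unfolding duhamel_def by (intro nn_integral_cong) (auto simp: indicator_def)
      qed
      have e: "\<theta> + (D + E) * (t - r) + D * r = \<theta> + D * t + E * (t - r)"
        by (simp add: algebra_simps)
      have n: "0 < \<theta> + (D + E) * (t - r)" "0 \<le> \<theta> + D * t + E * (t - r)"
        using that \<theta> t nonneg by (simp_all add: add_pos_nonneg)
      then show ?thesis
        using that A.overlap_mild[of "\<theta> + (D + E) * (t - r)" r "Y r"]
        by (simp add: sym e overlap_commute[of _ "Y r"])
    qed
    then show ?thesis
      unfolding y_def w_def r_def
      by (subst (1 2) nn_integral_add[symmetric])
         (auto simp: distrib_right[symmetric] indicator_def intro!: nn_integral_cong)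
  qed
  have a_eq: "overlap \<theta> (u t) (v t) + p R = overlap (\<theta> + D * t) u0 (v t) + p P"
  proof -
    have sym: "p M = duhamel D (\<lambda>s \<theta>. overlap \<theta> (v t) (M s)) \<theta> t"
      if [measurable]: "case_prod M \<in> borel_measurable (borel \<Otimes>\<^sub>M (borel :: 'a measure))" for M
      unfolding p_def duhamel_def using \<theta> t nonneg
      by (intro nn_integral_cong) (auto simp: indicator_def intro!: overlap_commute)
    show ?thesis
      using A.overlap_mild[of \<theta> t "v t"] \<theta> t nonneg by (simp add: sym overlap_commute[of _ "v t"])
  qed
  have b_eq: "overlap (\<theta> + D * t) u0 (v t) + r Q = overlap (\<theta> + (D + E) * t) u0 v0 + r S"
    using B.overlap_mild[of "\<theta> + D * t" t u0] \<theta> t nonneg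
    by (simp add: r_def duhamel_def add_pos_nonneg algebra_simps)
  have "overlap \<theta> (u t) (v t) + x R + y Q = overlap (\<theta> + (D + E) * t) u0 v0 + x P + y S"
  proof (rule product_rule_arithmetic)
    have "overlap (\<theta> + (D + E) * t) u0 v0 \<le> ennreal (heat_kernel \<theta> (0 :: 'a))
           * ((\<integral>\<^sup>+x. u0 x \<partial>lborel) * (\<integral>\<^sup>+x. v0 x \<partial>lborel))"
      using \<theta> t nonneg by (intro overlap_le) auto
    also have "\<dots> < \<infinity>"
      using A.finite_u0 B.finite_u0 by (simp add: ennreal_mult_less_top)
    finally show "overlap (\<theta> + (D + E) * t) u0 v0 < \<infinity>" .
    have rf: "r Y < \<infinity>" if [measurable]: "case_prod Y \<in> borel_measurable (borel \<Otimes>\<^sub>M (borel :: 'a measure))"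
      and fin: "(\<integral>\<^sup>+s\<in>{0..t}. (\<integral>\<^sup>+x. Y s x \<partial>lborel) \<partial>lborel) < \<infinity>" for Y
    proof -
      have "r Y = (\<integral>\<^sup>+r\<in>{0..t}. overlap (\<theta> + D * t + E * (t - r)) (Y r) u0 \<partial>lborel)"
        unfolding r_def using \<theta> t nonneg
        by (intro nn_integral_cong) (auto simp: indicator_def intro!: overlap_commute)
      also have "\<dots> < \<infinity>"
        using \<theta> t nonneg A.finite_u0 fin by (intro line_finite[of \<theta>]) auto
      finally show ?thesis .
    qed
    show "r S < \<infinity>" "r Q < \<infinity>"
      by (rule rf[OF B.measurable_P B.finite_P] rf[OF B.measurable_R B.finite_R])+
    show "q P < \<infinity>" "q R < \<infinity>"
      unfolding q_def using \<theta> t nonneg A.finite_P A.finite_R B.finite_u0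
      by (intro line_finite[of \<theta>]; auto)+
    show "c P S < \<infinity>" "c P Q < \<infinity>" "c R S < \<infinity>" "c R Q < \<infinity>"
      unfolding c_def using \<theta> A.finite_P A.finite_R B.finite_P B.finite_R
      by (intro square_finite; auto)+
  qed (rule a_eq b_eq p_eq x_eq y_eq c_eq; measurable)+
  then show ?thesis
    unfolding x_def y_def duhamel_def
    by (simp add: distrib_right nn_integral_add add.assoc)
qed

text \<open>
  The integrated form of
  \<open>d/dt \<langle>u, \<Phi> * v\<rangle> = (D + E) \<langle>u, (p\<^sub>\<tau> - p\<^sub>e) * v\<rangle> + \<langle>P - R, \<Phi> * v\<rangle> + \<langle>u, \<Phi> * (S - Q)\<rangle>\<close>.
  The overlap at index \<open>e\<close> is the dissipation: it approximates \<open>\<integral> u v\<close>.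
\<close>

lemma energy_balance:
  assumes "0 < e" "e \<le> \<tau>" "0 \<le> t"
  shows "energy e \<tau> (u t) (v t) + ennreal (D + E) * (\<integral>\<^sup>+s\<in>{0..t}. overlap e (u s) (v s) \<partial>lborel)
           + (\<integral>\<^sup>+s\<in>{0..t}. (energy e \<tau> (R s) (v s) + energy e \<tau> (u s) (Q s)) \<partial>lborel)
       = energy e \<tau> u0 v0 + ennreal (D + E) * (\<integral>\<^sup>+s\<in>{0..t}. overlap \<tau> (u s) (v s) \<partial>lborel)
           + (\<integral>\<^sup>+s\<in>{0..t}. (energy e \<tau> (P s) (v s) + energy e \<tau> (u s) (S s)) \<partial>lborel)"
proof -
  note nonneg = A.D_nonneg B.D_nonneg
  define c where "c = ennreal (heat_kernel \<tau> (0 :: 'a))"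
  let ?M = "\<lambda>R Q s \<theta>. overlap \<theta> (R s) (v s) + overlap \<theta> (u s) (Q s)"
  have eq: "energy e \<tau> (R s) (v s) + energy e \<tau> (u s) (Q s) = (\<integral>\<^sup>+\<theta>\<in>{e..\<tau>}. ?M R Q s \<theta> \<partial>lborel)"
    if [measurable]: "case_prod R \<in> borel_measurable (borel \<Otimes>\<^sub>M (borel :: 'a measure))"
      "case_prod Q \<in> borel_measurable (borel \<Otimes>\<^sub>M (borel :: 'a measure))" for R Q s
    by (simp add: energy_eq_integral_overlap distrib_right nn_integral_add)
  have "(\<integral>\<^sup>+r\<in>{0..t}. duhamel (D + E) (?M R Q) \<tau> r \<partial>lborel) < \<infinity>"
  proof (rule nn_integral_duhamel_finite)
    show "?M R Q s r \<le> c * (B.mass_bound t * (\<integral>\<^sup>+y. R s y \<partial>lborel)) + c * (A.mass_bound t * (\<integral>\<^sup>+y. Q s y \<partial>lborel))"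
      if that: "0 \<le> s" "s \<le> t" "\<tau> \<le> r" for s r
    proof (rule add_mono)
      have "overlap r (R s) (v s) \<le> c * ((\<integral>\<^sup>+y. R s y \<partial>lborel) * (\<integral>\<^sup>+y. v s y \<partial>lborel))"
        unfolding c_def using that assms by (intro overlap_le) auto
      also have "\<dots> \<le> c * ((\<integral>\<^sup>+y. R s y \<partial>lborel) * B.mass_bound t)"
        using that by (intro mult_left_mono B.mass_le) auto
      finally show "overlap r (R s) (v s) \<le> c * (B.mass_bound t * (\<integral>\<^sup>+y. R s y \<partial>lborel))"
        by (simp add: mult_ac)
      have "overlap r (u s) (Q s) \<le> c * ((\<integral>\<^sup>+y. u s y \<partial>lborel) * (\<integral>\<^sup>+y. Q s y \<partial>lborel))"
        unfolding c_def using that assms by (intro overlap_le) auto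
      also have "\<dots> \<le> c * (A.mass_bound t * (\<integral>\<^sup>+y. Q s y \<partial>lborel))"
        using that by (intro mult_left_mono mult_right_mono A.mass_le) auto
      finally show "overlap r (u s) (Q s) \<le> c * (A.mass_bound t * (\<integral>\<^sup>+y. Q s y \<partial>lborel))" .
    qed
    show "(\<integral>\<^sup>+s\<in>{0..t}. (c * (B.mass_bound t * (\<integral>\<^sup>+y. R s y \<partial>lborel)) + c * (A.mass_bound t * (\<integral>\<^sup>+y. Q s y \<partial>lborel))) \<partial>lborel) < \<infinity>"
      using A.finite_R[of t] B.finite_R[of t] A.mass_bound_finite[of t] B.mass_bound_finite[of t]
      unfolding c_def
      by (simp add: distrib_right nn_integral_add mult.assoc nn_integral_cmult ennreal_mult_less_top)
  qed (use nonneg in simp)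
  then show ?thesis
    using assms nonneg
    by (simp only: energy_eq_integral_overlap[OF A.measurable_u0 B.measurable_u0] eq A.measurable_P A.measurable_R B.measurable_P B.measurable_R)
       (subst energy_eq_integral_overlap, measurable,
        intro truncated_potential_balance[where G = "\<lambda>\<theta> r. overlap \<theta> (u r) (v r)" and Z = "\<lambda>\<theta>. overlap \<theta> u0 v0"
        and P = "?M P S" and R = "?M R Q"], auto simp: overlap_product_rule)
qed

end

section \<open>Recovering the product from the overlap\<close>

lemma liminf_add_const_ennreal:
  fixes a :: "nat \<Rightarrow> ennreal"
  shows "liminf (\<lambda>k. a k + c) = liminf a + c"
  by (rule Liminf_compose_continuous_mono)
     (auto intro!: monoI add_mono continuous_on_add_ennreal)

lemma liminf_heat_indicator_open:
  fixes x :: "'a::euclidean_space"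
  assumes U: "open U" "x \<in> U"
  shows "1 \<le> liminf (\<lambda>k. heat (1 / real (Suc k)) (indicator U) x)"
proof -
  obtain r where r: "r > 0" "ball x r \<subseteq> U"
    using U openE by blast
  define c where "c k = 2 powr (real DIM('a) / 2) * exp (- r\<^sup>2 / 8) ^ Suc k" for k :: nat
  have [measurable]: "U \<in> sets borel" using U by simp
  have bound: "ennreal (1 - c k) \<le> heat (1 / real (Suc k)) (indicator U) x" for k
  proof -
    define e where "e = 1 / real (Suc k)"
    have e: "e > 0" unfolding e_def by simp
    have "- r\<^sup>2 / (8 * e) = real (Suc k) * (- r\<^sup>2 / 8)"
      unfolding e_def by (simp add: field_simps)
    then have c_eq: "c k = 2 powr (real DIM('a) / 2) * exp (- r\<^sup>2 / (8 * e))"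
      unfolding c_def by (simp only: exp_of_nat_mult)
    have "1 = (\<integral>\<^sup>+y. ennreal (heat_kernel e (x - y)) \<partial>lborel)"
      using e by (simp add: nn_integral_heat_kernel_shift)
    also have "\<dots> \<le> (\<integral>\<^sup>+y. ennreal (heat_kernel e (x - y)) * indicator U y
                      + ennreal (c k) * ennreal (heat_kernel (2 * e) (x - y)) \<partial>lborel)"
    proof (rule nn_integral_mono)
      fix y
      show "ennreal (heat_kernel e (x - y)) \<le> ennreal (heat_kernel e (x - y)) * indicator U y
                      + ennreal (c k) * ennreal (heat_kernel (2 * e) (x - y))"
      proof (cases "y \<in> U")
        case False
        then have "r \<le> norm (x - y)" using r by (auto simp: dist_norm subset_iff not_less[symmetric])
        then have "heat_kernel e (x - y) \<le> c k * heat_kernel (2 * e) (x - y)"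
          using e r unfolding c_eq by (intro heat_kernel_tail) auto
        then show ?thesis
          using False by (simp add: c_def ennreal_mult[symmetric] ennreal_leI)
      qed simp
    qed
    also have "\<dots> = heat e (indicator U) x + ennreal (c k)"
      using e by (simp add: nn_integral_add heat_pos_eq nn_integral_cmult nn_integral_heat_kernel_shift)
    finally have "1 \<le> heat e (indicator U) x + ennreal (c k)" .
    then have "1 - ennreal (c k) \<le> heat e (indicator U) x"
      by (simp add: ennreal_minus_le_iff add.commute)
    then show ?thesis
      unfolding e_def by (simp add: c_def flip: ennreal_1 ennreal_minus)
  qed
  have "c \<longlonglongrightarrow> 2 powr (real DIM('a) / 2) * 0"
    unfolding c_def using r
    by (intro tendsto_mult tendsto_const LIMSEQ_Suc[OF LIMSEQ_power_zero]) simp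
  then have "(\<lambda>k. ennreal (1 - c k)) \<longlonglongrightarrow> ennreal (1 - 0)"
    by (intro tendsto_ennrealI tendsto_diff tendsto_const) simp
  then have "liminf (\<lambda>k. ennreal (1 - c k)) = 1"
    by (simp add: lim_imp_Liminf)
  moreover have "liminf (\<lambda>k. ennreal (1 - c k)) \<le> liminf (\<lambda>k. heat (1 / real (Suc k)) (indicator U) x)"
    using bound by (intro Liminf_mono always_eventually allI)
  ultimately show ?thesis by simp
qed

lemma overlap_le_right:
  assumes "0 \<le> \<theta>" "\<And>x. g x \<le> 1" and [measurable]: "h \<in> borel_measurable borel"
  shows "overlap \<theta> g h \<le> (\<integral>\<^sup>+x. h x \<partial>lborel)"
proof -
  have "overlap \<theta> g h \<le> (\<integral>\<^sup>+x. 1 * heat \<theta> h x \<partial>lborel)"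
    unfolding overlap_def using assms by (intro nn_integral_mono mult_right_mono) auto
  then show ?thesis using assms by (simp add: nn_integral_heat)
qed

lemma overlap_mono:
  assumes "\<And>x. g x \<le> g' x" "\<And>x. h x \<le> h' x"
  shows "overlap \<theta> g h \<le> overlap \<theta> g' h'"
  unfolding overlap_def using assms by (intro nn_integral_mono mult_mono heat_mono) auto

text \<open>
  If \<open>E\<close> were open, \<open>heat \<epsilon> (indicator E) x\<close> would tend to 1 at each point of \<open>E\<close>, and Fatou's lemma would finish
  the proof. In general \<open>E\<close> lies in an open set \<open>U\<close> with \<open>U - E\<close> of measure less than \<open>\<eta>\<close>, and passing from \<open>U\<close>
  to \<open>E\<close> costs at most \<open>\<eta>\<close>, as the semigroup preserves mass.
\<close>

lemma emeasure_le_liminf_overlap: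
  fixes E :: "'a::euclidean_space set"
  assumes [measurable]: "E \<in> sets borel"
  shows "emeasure lborel E \<le> liminf (\<lambda>k. overlap (1 / real (Suc k)) (indicator E) (indicator E))"
proof (rule ennreal_le_epsilon)
  fix \<eta> :: real assume "\<eta> > 0"
  then obtain U where U: "open U" "E \<subseteq> U" "emeasure lborel (U - E) < \<eta>"
    using outer_regular_lborel[of E \<eta>] by auto
  have [measurable]: "U \<in> sets borel" using U by simp
  have "emeasure lborel E = (\<integral>\<^sup>+x. indicator E x * 1 \<partial>lborel)"
    by simp
  also have "\<dots> \<le> (\<integral>\<^sup>+x. liminf (\<lambda>k. indicator E x * heat (1 / real (Suc k)) (indicator U) x) \<partial>lborel)"
  proof (rule nn_integral_mono)
    fix x
    show "indicator E x * 1 \<le> liminf (\<lambda>k. indicator E x * heat (1 / real (Suc k)) (indicator U) x)"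
      using liminf_heat_indicator_open[of U x] U by (cases "x \<in> E") auto
  qed
  also have "\<dots> \<le> liminf (\<lambda>k. overlap (1 / real (Suc k)) (indicator E) (indicator U))"
    unfolding overlap_def by (rule nn_integral_liminf) measurable
  also have "\<dots> \<le> liminf (\<lambda>k. overlap (1 / real (Suc k)) (indicator E) (indicator E) + ennreal \<eta>)"
  proof (intro Liminf_mono always_eventually allI)
    fix k
    define e where "e = 1 / real (Suc k)"
    have "overlap e (indicator E) (indicator U)
        = overlap e (indicator E) (\<lambda>x. indicator E x + indicator (U - E) x)"
      using U(2) by (intro arg_cong[where f = "overlap e (indicator E)"]) (auto simp: indicator_def fun_eq_iff)
    also have "\<dots> = overlap e (indicator E) (indicator E) + overlap e (indicator E) (indicator (U - E))"
      unfolding overlap_def by (simp add: heat_add distrib_left nn_integral_add)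
    also have "overlap e (indicator E) (indicator (U - E)) \<le> (\<integral>\<^sup>+x. indicator (U - E) x \<partial>lborel)"
      by (rule overlap_le_right) (auto simp: e_def indicator_def)
    also have "\<dots> \<le> ennreal \<eta>" using U(3) by simp
    finally show "overlap e (indicator E) (indicator U) \<le> overlap e (indicator E) (indicator E) + ennreal \<eta>"
      by simp
  qed
  also have "\<dots> = liminf (\<lambda>k. overlap (1 / real (Suc k)) (indicator E) (indicator E)) + ennreal \<eta>"
    by (rule liminf_add_const_ennreal)
  finally show "emeasure lborel E \<le> \<dots>" .
qed

definition superlevel :: "('a \<Rightarrow> ennreal) \<Rightarrow> real \<Rightarrow> 'a set" where
  "superlevel u l = {x. 0 < l \<and> ennreal l < u x}"

lemma superlevel_measurable [measurable (raw)]: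
  fixes u :: "'a::euclidean_space \<Rightarrow> ennreal"
  assumes [measurable]: "u \<in> borel_measurable borel" "f \<in> borel_measurable M" "g \<in> borel_measurable M"
  shows "(\<lambda>x. indicator (superlevel u (f x)) (g x) :: ennreal) \<in> borel_measurable M"
  unfolding superlevel_def indicator_def mem_Collect_eq by measurable

lemma layer_cake:
  assumes "u x < \<infinity>"
  shows "u x = (\<integral>\<^sup>+l. indicator (superlevel u l) x \<partial>lborel)"
proof -
  obtain r where r: "u x = ennreal r" "0 \<le> r" using assms by (cases "u x") auto
  have "(\<integral>\<^sup>+l. indicator (superlevel u l) x \<partial>lborel) = (\<integral>\<^sup>+l. indicator {0<..<r} l \<partial>lborel)"
    using r by (intro nn_integral_cong) (auto simp: superlevel_def indicator_def ennreal_less_iff)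
  then show ?thesis using r by simp
qed

lemma overlap_nn_integral_left:
  fixes g :: "real \<Rightarrow> 'a::euclidean_space \<Rightarrow> ennreal"
  assumes [measurable]: "case_prod g \<in> borel_measurable (borel \<Otimes>\<^sub>M borel)" "h \<in> borel_measurable borel"
  shows "overlap \<theta> (\<lambda>x. \<integral>\<^sup>+l. g l x \<partial>lborel) h = (\<integral>\<^sup>+l. overlap \<theta> (g l) h \<partial>lborel)"
proof -
  have "overlap \<theta> (\<lambda>x. \<integral>\<^sup>+l. g l x \<partial>lborel) h = (\<integral>\<^sup>+x. \<integral>\<^sup>+l. g l x * heat \<theta> h x \<partial>lborel \<partial>lborel)"
    unfolding overlap_def by (simp add: nn_integral_multc)
  also have "\<dots> = (\<integral>\<^sup>+l. overlap \<theta> (g l) h \<partial>lborel)"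
    unfolding overlap_def by (rule lborel_pair.Fubini') measurable
  finally show ?thesis .
qed

lemma overlap_nn_integral_right:
  fixes g :: "real \<Rightarrow> 'a::euclidean_space \<Rightarrow> ennreal"
  assumes [measurable]: "case_prod g \<in> borel_measurable (borel \<Otimes>\<^sub>M borel)" "h \<in> borel_measurable borel"
  shows "overlap \<theta> h (\<lambda>x. \<integral>\<^sup>+l. g l x \<partial>lborel) = (\<integral>\<^sup>+l. overlap \<theta> h (g l) \<partial>lborel)"
proof -
  have "heat \<theta> (\<lambda>y. \<integral>\<^sup>+l. g l y \<partial>lborel) x = (\<integral>\<^sup>+l. heat \<theta> (g l) x \<partial>lborel)" for x
    by (rule heat_nn_integral; (rule sigma_finite_lborel)?; measurable)
  then have "overlap \<theta> h (\<lambda>x. \<integral>\<^sup>+l. g l x \<partial>lborel) = (\<integral>\<^sup>+x. h x * (\<integral>\<^sup>+l. heat \<theta> (g l) x \<partial>lborel) \<partial>lborel)"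
    unfolding overlap_def by (simp only:)
  also have "\<dots> = (\<integral>\<^sup>+x. \<integral>\<^sup>+l. h x * heat \<theta> (g l) x \<partial>lborel \<partial>lborel)"
    by (intro nn_integral_cong nn_integral_cmult[symmetric]; measurable)
  also have "\<dots> = (\<integral>\<^sup>+l. overlap \<theta> h (g l) \<partial>lborel)"
    unfolding overlap_def by (rule lborel_pair.Fubini') measurable
  finally show ?thesis .
qed

text \<open>
  By the layer cake formula both sides are superpositions of the corresponding quantities for the indicators of
  superlevel sets \<open>A\<close> and \<open>B\<close>, and \<open>overlap \<theta> A B\<close> is at least the overlap of \<open>A \<inter> B\<close> with itself.
  Fatou's lemma then reduces the claim to a single set.
\<close>

lemma nn_integral_mult_le_liminf_overlap:
  fixes u v :: "'a::euclidean_space \<Rightarrow> ennreal"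
  assumes [measurable]: "u \<in> borel_measurable borel" "v \<in> borel_measurable borel"
    and fin: "\<And>x. u x < \<infinity>" "\<And>x. v x < \<infinity>"
  shows "(\<integral>\<^sup>+x. u x * v x \<partial>lborel) \<le> liminf (\<lambda>k. overlap (1 / real (Suc k)) u v)"
proof -
  let ?A = "\<lambda>l. indicator (superlevel u l) :: 'a \<Rightarrow> ennreal"
  let ?B = "\<lambda>m. indicator (superlevel v m) :: 'a \<Rightarrow> ennreal"
  have u: "u = (\<lambda>x. \<integral>\<^sup>+l. ?A l x \<partial>lborel)" and v: "v = (\<lambda>x. \<integral>\<^sup>+m. ?B m x \<partial>lborel)"
    by (intro ext layer_cake fin)+
  have ov: "overlap \<theta> u v = (\<integral>\<^sup>+l. \<integral>\<^sup>+m. overlap \<theta> (?A l) (?B m) \<partial>lborel \<partial>lborel)" for \<theta>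
  proof -
    have "overlap \<theta> u v = (\<integral>\<^sup>+l. overlap \<theta> (?A l) v \<partial>lborel)"
      by (subst u) (rule overlap_nn_integral_left; measurable)
    also have "\<dots> = (\<integral>\<^sup>+l. \<integral>\<^sup>+m. overlap \<theta> (?A l) (?B m) \<partial>lborel \<partial>lborel)"
      by (subst v) (intro nn_integral_cong overlap_nn_integral_right; measurable)
    finally show ?thesis .
  qed
  have set: "superlevel u l \<in> sets borel" "superlevel v l \<in> sets borel" for l
    unfolding superlevel_def by measurable
  have "(\<integral>\<^sup>+x. u x * v x \<partial>lborel) = overlap 0 u v"
    by (simp add: overlap_def)
  also have "\<dots> = (\<integral>\<^sup>+l. \<integral>\<^sup>+m. overlap 0 (?A l) (?B m) \<partial>lborel \<partial>lborel)"
    by (rule ov)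
  also have "\<dots> \<le> (\<integral>\<^sup>+l. \<integral>\<^sup>+m. liminf (\<lambda>k. overlap (1 / real (Suc k)) (?A l) (?B m)) \<partial>lborel \<partial>lborel)"
  proof (intro nn_integral_mono)
    fix l m
    have "overlap 0 (?A l) (?B m) = emeasure lborel (superlevel u l \<inter> superlevel v m)"
      using set by (simp add: overlap_def indicator_inter_arith[symmetric])
    also have "\<dots> \<le> liminf (\<lambda>k. overlap (1 / real (Suc k)) (indicator (superlevel u l \<inter> superlevel v m))
                                  (indicator (superlevel u l \<inter> superlevel v m)))"
      using set by (intro emeasure_le_liminf_overlap) auto
    also have "\<dots> \<le> liminf (\<lambda>k. overlap (1 / real (Suc k)) (?A l) (?B m))"
      by (intro Liminf_mono always_eventually allI overlap_mono) (auto simp: indicator_def)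
    finally show "overlap 0 (?A l) (?B m) \<le> \<dots>" .
  qed
  also have "\<dots> \<le> (\<integral>\<^sup>+l. liminf (\<lambda>k. \<integral>\<^sup>+m. overlap (1 / real (Suc k)) (?A l) (?B m) \<partial>lborel) \<partial>lborel)"
    by (intro nn_integral_mono nn_integral_liminf) measurable
  also have "\<dots> \<le> liminf (\<lambda>k. \<integral>\<^sup>+l. \<integral>\<^sup>+m. overlap (1 / real (Suc k)) (?A l) (?B m) \<partial>lborel \<partial>lborel)"
    by (rule nn_integral_liminf) measurable
  finally show ?thesis by (simp add: ov)
qed

section \<open>Comparison with the kernel \<open>phi0\<close>\<close>

text \<open>
  A bound uniform in time, sharp at the diffusive time \<open>norm z\<^sup>2\<close> up to a constant; it follows from \<open>exp x \<ge> (x / p) powr p\<close> with \<open>p = d / 2\<close>, which makes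
  the powers of \<open>\<theta>\<close> cancel.
\<close>

lemma heat_kernel_le_norm_powr:
  fixes z :: "'a::euclidean_space"
  assumes "0 < \<theta>" "z \<noteq> 0"
  shows "heat_kernel \<theta> z \<le> (real DIM('a) / (2 * pi)) powr (real DIM('a) / 2) * norm z powr (- real DIM('a))"
proof -
  define p where "p = real DIM('a) / 2"
  have p: "p > 0" by (simp add: p_def)
  define x where "x = (norm z)\<^sup>2 / (4 * \<theta>)"
  have x: "x > 0" using assms by (simp add: x_def)
  have "x / p \<le> exp (x / p)"
    using exp_ge_add_one_self[of "x / p"] by linarith
  then have "(x / p) powr p \<le> exp (x / p) powr p"
    using x p by (intro powr_mono2) auto
  also have "\<dots> = exp x"
    using p by (simp add: powr_def)
  finally have "exp (- x) \<le> 1 / (x / p) powr p"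
    using x p by (simp add: exp_minus divide_simps)
  also have "\<dots> = (p / x) powr p"
    using x p by (simp add: powr_divide)
  finally have "heat_kernel \<theta> z \<le> (4 * pi * \<theta>) powr (- p) * (p / x) powr p"
    unfolding heat_kernel_def by (intro mult_mono) (auto simp: p_def x_def)
  also have "\<dots> = (p / x / (4 * pi * \<theta>)) powr p"
    using assms x p by (simp add: powr_minus_divide powr_divide powr_mult mult_ac)
  also have "p / x / (4 * pi * \<theta>) = p / pi * (norm z) powr (- 2)"
    using assms by (simp add: x_def powr_minus_divide field_simps)
  also have "\<dots> powr p = (p / pi) powr p * norm z powr (- 2 * p)"
    using p by (subst powr_mult) (simp_all add: powr_powr)
  finally show ?thesis by (simp add: p_def)
qed

lemma nn_integral_powr_interval:
  fixes a b q :: real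
  assumes "0 < a" "a \<le> b" "q \<noteq> -1"
  shows "(\<integral>\<^sup>+x\<in>{a..b}. ennreal (x powr q) \<partial>lborel) = ennreal ((b powr (q + 1) - a powr (q + 1)) / (q + 1))"
proof -
  have "(\<integral>\<^sup>+x\<in>{a..b}. ennreal (x powr q) \<partial>lborel) = ennreal (b powr (q + 1) / (q + 1) - a powr (q + 1) / (q + 1))"
  proof (rule nn_integral_FTC_Icc)
    show "((\<lambda>x. x powr (q + 1) / (q + 1)) has_real_derivative x powr q) (at x)"
      if "x \<in> {a..b}" for x
    proof -
      have "((\<lambda>x. x powr (q + 1)) has_real_derivative (q + 1) * x powr (q + 1 - 1)) (at x)"
        using that assms by (intro has_real_derivative_powr) auto
      from DERIV_cdivide[OF this, of "q + 1"] show ?thesis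
        using assms by simp
    qed
  qed (use assms in auto)
  then show ?thesis by (simp add: diff_divide_distrib)
qed

lemma heat_kernel_le_powr_time:
  fixes z :: "'a::euclidean_space"
  assumes "0 < \<theta>"
  shows "heat_kernel \<theta> z \<le> (4 * pi) powr (- real DIM('a) / 2) * \<theta> powr (- real DIM('a) / 2)"
  using heat_kernel_le[OF assms order_refl, of z] assms by (simp add: heat_kernel_def powr_mult)

text \<open>
  Up to the diffusive time \<open>norm z\<^sup>2\<close> the kernel is bounded by its value at the diffusive scale, and afterwards by
  its maximum over space.
\<close>

lemma nn_integral_heat_kernel_split:
  fixes z :: "'a::euclidean_space"
  assumes "0 < e" "z \<noteq> 0"
  shows "(\<integral>\<^sup>+\<theta>\<in>{e..\<tau>}. ennreal (heat_kernel \<theta> z) \<partial>lborel)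
     \<le> ennreal ((real DIM('a) / (2 * pi)) powr (real DIM('a) / 2) * norm z powr (2 - real DIM('a)))
       + ennreal ((4 * pi) powr (- real DIM('a) / 2)) *
           (\<integral>\<^sup>+\<theta>\<in>{(norm z)\<^sup>2..\<tau>}. ennreal (\<theta> powr (- real DIM('a) / 2)) \<partial>lborel)"
proof -
  define r where "r = norm z"
  have r: "r > 0" using assms by (simp add: r_def)
  define K where "K = (real DIM('a) / (2 * pi)) powr (real DIM('a) / 2)"
  define k where "k = (4 * pi) powr (- real DIM('a) / 2)"
  have "(\<integral>\<^sup>+\<theta>\<in>{e..\<tau>}. ennreal (heat_kernel \<theta> z) \<partial>lborel)
     \<le> (\<integral>\<^sup>+\<theta>. ennreal (K * r powr (- real DIM('a))) * indicator {0..r\<^sup>2} \<theta>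
          + ennreal k * (ennreal (\<theta> powr (- real DIM('a) / 2)) * indicator {r\<^sup>2..\<tau>} \<theta>) \<partial>lborel)"
  proof (rule nn_integral_mono)
    fix \<theta> :: real
    show "ennreal (heat_kernel \<theta> z) * indicator {e..\<tau>} \<theta>
        \<le> ennreal (K * r powr (- real DIM('a))) * indicator {0..r\<^sup>2} \<theta>
          + ennreal k * (ennreal (\<theta> powr (- real DIM('a) / 2)) * indicator {r\<^sup>2..\<tau>} \<theta>)"
    proof (cases "\<theta> \<in> {e..\<tau>}")
      case True
      then have "\<theta> > 0" using assms by auto
      show ?thesis
      proof (cases "\<theta> \<le> r\<^sup>2")
        case le: True
        have "ennreal (heat_kernel \<theta> z) \<le> ennreal (K * r powr (- real DIM('a)))"
          using heat_kernel_le_norm_powr[OF \<open>\<theta> > 0\<close> assms(2)] unfolding K_def r_def by (intro ennreal_leI)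
        moreover have "indicator {e..\<tau>} \<theta> = (1 :: ennreal)" "indicator {0..r\<^sup>2} \<theta> = (1 :: ennreal)"
          using True le \<open>\<theta> > 0\<close> by auto
        ultimately show ?thesis
          by (simp add: add_increasing2)
      next
        case False
        have "ennreal (heat_kernel \<theta> z) \<le> ennreal k * ennreal (\<theta> powr (- real DIM('a) / 2))"
          using heat_kernel_le_powr_time[OF \<open>\<theta> > 0\<close>, of z] unfolding k_def
          by (simp add: ennreal_mult[symmetric] ennreal_leI)
        with True False show ?thesis by simp
      qed
    qed simp
  qed
  also have "\<dots> = ennreal (K * r powr (- real DIM('a))) * ennreal (r\<^sup>2)
       + ennreal k * (\<integral>\<^sup>+\<theta>\<in>{r\<^sup>2..\<tau>}. ennreal (\<theta> powr (- real DIM('a) / 2)) \<partial>lborel)"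
    by (simp add: nn_integral_add nn_integral_cmult)
  also have "ennreal (K * r powr (- real DIM('a))) * ennreal (r\<^sup>2) = ennreal (K * r powr (2 - real DIM('a)))"
  proof -
    have "r powr (- real DIM('a)) * r\<^sup>2 = r powr (2 - real DIM('a))"
      using r by (simp add: powr_diff powr_minus_divide)
    then show ?thesis by (simp add: K_def ennreal_mult[symmetric] mult.assoc)
  qed
  finally show ?thesis by (simp add: K_def k_def r_def)
qed

text \<open>
  The kernel of \<open>\<Phi>\<^sub>e\<^sub>,\<^sub>\<tau>\<close> against \<open>phi0\<close>. From dimension 3 on the time integral converges at infinity, which makes
  the bound uniform in \<open>\<tau>\<close>. In dimension 2 the integral of \<open>1 / \<theta>\<close> from \<open>norm z\<^sup>2\<close> to 1 produces the logarithm,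
  and in dimension 1 the kernel is integrable in time down to 0. The summand 1 covers the region where \<open>phi0\<close>
  vanishes; it costs only the mass of the initial data.
\<close>

lemma truncated_green_le_phi0:
  obtains c :: real where "c > 0"
    "\<And>(e :: real) \<tau> (z :: 'a::euclidean_space). 0 < e \<Longrightarrow> z \<noteq> 0 \<Longrightarrow> (DIM('a) \<le> 2 \<Longrightarrow> \<tau> \<le> 1) \<Longrightarrow>
       (\<integral>\<^sup>+\<theta>\<in>{e..\<tau>}. ennreal (heat_kernel \<theta> z) \<partial>lborel)
         \<le> ennreal c * (ennreal (phi0 z) + 1)"
proof -
  define K where "K = (real DIM('a) / (2 * pi)) powr (real DIM('a) / 2)"
  define k where "k = (4 * pi) powr (- real DIM('a) / 2)"
  have K: "K > 0" and k: "k > 0" by (simp_all add: K_def k_def)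
  consider "DIM('a) = 1" | "DIM('a) = 2" | "DIM('a) \<ge> 3"
    using DIM_positive[where 'a = 'a] by linarith
  then show thesis
  proof cases
    case 1
    show thesis
    proof (rule that[of "2 * k"])
      fix e \<tau> :: real and z :: 'a
      assume e: "0 < e" and "DIM('a) \<le> 2 \<Longrightarrow> \<tau> \<le> 1"
      then have \<tau>: "\<tau> \<le> 1" using 1 by simp
      have "(\<integral>\<^sup>+\<theta>\<in>{e..\<tau>}. ennreal (heat_kernel \<theta> z) \<partial>lborel) \<le> ennreal (2 * k)"
      proof (cases "e \<le> \<tau>")
        case True
        have "(\<integral>\<^sup>+\<theta>\<in>{e..\<tau>}. ennreal (heat_kernel \<theta> z) \<partial>lborel)
            \<le> (\<integral>\<^sup>+\<theta>. ennreal k * (ennreal (\<theta> powr (- 1 / 2)) * indicator {e..\<tau>} \<theta>) \<partial>lborel)"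
        proof (rule nn_integral_mono)
          fix \<theta> :: real
          have "ennreal (heat_kernel \<theta> z) \<le> ennreal k * ennreal (\<theta> powr (- 1 / 2))" if "0 < \<theta>"
            using heat_kernel_le_powr_time[OF that, of z] 1 unfolding k_def
            by (simp add: ennreal_mult[symmetric] ennreal_leI)
          then show "ennreal (heat_kernel \<theta> z) * indicator {e..\<tau>} \<theta>
              \<le> ennreal k * (ennreal (\<theta> powr (- 1 / 2)) * indicator {e..\<tau>} \<theta>)"
            using e by (auto simp: indicator_def)
        qed
        also have "\<dots> = ennreal k * ennreal ((\<tau> powr (1 / 2) - e powr (1 / 2)) / (1 / 2))"
          using nn_integral_powr_interval[of e \<tau> "- 1 / 2"] e True by (simp add: nn_integral_cmult)
        also have "\<dots> \<le> ennreal k * ennreal 2"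
        proof -
          have half: "(x - y) / (1 / 2) \<le> 2" if "x \<le> 1" "0 \<le> y" for x y :: real
            using that by simp
          have "\<tau> powr (1 / 2) \<le> 1"
            using e True \<tau> by (intro powr_le1) auto
          then have "(\<tau> powr (1 / 2) - e powr (1 / 2)) / (1 / 2) \<le> 2"
            by (intro half) auto
          then show ?thesis by (intro mult_left_mono ennreal_leI) auto
        qed
        finally show ?thesis using k by (simp add: ennreal_mult mult.commute)
      qed simp
      also have "\<dots> \<le> ennreal (2 * k) * (ennreal (phi0 z) + 1)"
        using 1 by (simp add: distrib_left)
      finally show "(\<integral>\<^sup>+\<theta>\<in>{e..\<tau>}. ennreal (heat_kernel \<theta> z) \<partial>lborel) \<le> \<dots>" .
    qed (use k in simp)
  next
    case 2
    show thesis
    proof (rule that[of "K + 1"])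
      fix e \<tau> :: real and z :: 'a
      assume e: "0 < e" and z: "z \<noteq> 0" and "DIM('a) \<le> 2 \<Longrightarrow> \<tau> \<le> 1"
      then have \<tau>: "\<tau> \<le> 1" using 2 by simp
      define r where "r = norm z"
      have r: "r > 0" using z by (simp add: r_def)
      have "(\<integral>\<^sup>+\<theta>\<in>{e..\<tau>}. ennreal (heat_kernel \<theta> z) \<partial>lborel) \<le> ennreal K + ennreal (phi0 z)"
      proof (cases "r \<le> 1")
        case True
        have "(\<integral>\<^sup>+\<theta>\<in>{r\<^sup>2..\<tau>}. ennreal (\<theta> powr (- 1)) \<partial>lborel) \<le> ennreal (- 2 * ln r)"
        proof -
          have "(\<integral>\<^sup>+\<theta>\<in>{r\<^sup>2..\<tau>}. ennreal (\<theta> powr (- 1)) \<partial>lborel)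
              \<le> (\<integral>\<^sup>+\<theta>\<in>{r\<^sup>2..1}. ennreal (\<theta> powr (- 1)) \<partial>lborel)"
            using \<tau> by (intro nn_integral_mono) (auto simp: indicator_def)
          also have "\<dots> = ennreal (ln 1 - ln (r\<^sup>2))"
          proof (rule nn_integral_FTC_Icc)
            show "(ln has_real_derivative \<theta> powr - 1) (at \<theta>)" if "\<theta> \<in> {r\<^sup>2..1}" for \<theta>
            proof -
              have "0 < r\<^sup>2" using r by simp
              then have "0 < \<theta>" using that unfolding atLeastAtMost_iff by linarith
              then show ?thesis
                using DERIV_ln_divide[of \<theta>] by (simp add: powr_minus_divide)
            qed
            show "r\<^sup>2 \<le> 1" using True r by (simp add: power_le_one)
          qed auto
          also have "ln 1 - ln (r\<^sup>2) = - 2 * ln r"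
            using r by (simp add: ln_realpow)
          finally show ?thesis .
        qed
        then have "ennreal k * (\<integral>\<^sup>+\<theta>\<in>{r\<^sup>2..\<tau>}. ennreal (\<theta> powr (- 1)) \<partial>lborel)
            \<le> ennreal k * ennreal (- 2 * ln r)"
          by (intro mult_left_mono) auto
        also have "\<dots> = ennreal (phi0 z)"
          using 2 True r k
          by (subst ennreal_mult[symmetric])
            (auto simp: phi0_def k_def r_def powr_minus_divide ln_le_zero_iff divide_simps intro!: arg_cong[where f = ennreal])
        finally show ?thesis
          using nn_integral_heat_kernel_split[OF e z, of \<tau>] 2 r
          by (auto simp: K_def k_def r_def intro: order_trans add_left_mono)
      next
        case False
        have "(\<integral>\<^sup>+\<theta>\<in>{e..\<tau>}. ennreal (heat_kernel \<theta> z) \<partial>lborel)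
            \<le> (\<integral>\<^sup>+\<theta>. ennreal K * indicator {0..1::real} \<theta> \<partial>lborel)"
        proof (rule nn_integral_mono)
          fix \<theta> :: real
          have "heat_kernel \<theta> z \<le> K" if "0 < \<theta>"
          proof -
            have "heat_kernel \<theta> z \<le> K * r powr (- 2)"
              using heat_kernel_le_norm_powr[OF that z] 2 by (simp add: K_def r_def)
            also have "\<dots> \<le> K * 1"
              using False K by (intro mult_left_mono) (auto simp: powr_minus_divide)
            finally show ?thesis by simp
          qed
          then show "ennreal (heat_kernel \<theta> z) * indicator {e..\<tau>} \<theta> \<le> ennreal K * indicator {0..1} \<theta>"
            using e \<tau> by (auto simp: indicator_def intro!: ennreal_leI)
        qed
        also have "\<dots> = ennreal K"
          by (simp add: nn_integral_cmult)
        finally show ?thesis by (rule order_trans) simp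
      qed
      also have "\<dots> \<le> ennreal (K + 1) * (ennreal (phi0 z) + 1)"
        using 2 K by (simp add: distrib_left distrib_right add_increasing add_increasing2 add_mono)
      finally show "(\<integral>\<^sup>+\<theta>\<in>{e..\<tau>}. ennreal (heat_kernel \<theta> z) \<partial>lborel) \<le> \<dots>" .
    qed (use K in simp)
  next
    case 3
    define q where "q = 1 - real DIM('a) / 2"
    have q: "q < 0" using 3 by (simp add: q_def)
    show thesis
    proof (rule that[of "K + k / (- q)"])
      fix e \<tau> :: real and z :: 'a
      assume e: "0 < e" and z: "z \<noteq> 0"
      define r where "r = norm z"
      have r: "r > 0" using z by (simp add: r_def)
      have phi: "phi0 z = r powr (2 - real DIM('a))"
        using 3 by (simp add: phi0_def r_def)
      have "(\<integral>\<^sup>+\<theta>\<in>{r\<^sup>2..\<tau>}. ennreal (\<theta> powr (- real DIM('a) / 2)) \<partial>lborel) \<le> ennreal (phi0 z / (- q))"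
      proof (cases "r\<^sup>2 \<le> \<tau>")
        case True
        have "(\<integral>\<^sup>+\<theta>\<in>{r\<^sup>2..\<tau>}. ennreal (\<theta> powr (- real DIM('a) / 2)) \<partial>lborel)
            = ennreal ((\<tau> powr q - (r\<^sup>2) powr q) / q)"
          using nn_integral_powr_interval[of "r\<^sup>2" \<tau> "- real DIM('a) / 2"] True r 3
          by (simp add: q_def add.commute)
        also have "(\<tau> powr q - (r\<^sup>2) powr q) / q \<le> (r\<^sup>2) powr q / (- q)"
          using q by (simp add: divide_simps)
        also have "(r\<^sup>2) powr q = phi0 z"
        proof -
          have "(r\<^sup>2) powr q = (r powr 2) powr q" using r by simp
          also have "\<dots> = phi0 z" unfolding powr_powr phi by (simp add: q_def algebra_simps)
          finally show ?thesis .
        qed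
        finally show ?thesis by (simp add: ennreal_leI)
      qed simp
      then have "ennreal k * (\<integral>\<^sup>+\<theta>\<in>{r\<^sup>2..\<tau>}. ennreal (\<theta> powr (- real DIM('a) / 2)) \<partial>lborel)
          \<le> ennreal (k * (phi0 z / (- q)))"
        using k q by (subst ennreal_mult) (auto simp: phi intro!: mult_left_mono divide_nonneg_neg)
      then have "(\<integral>\<^sup>+\<theta>\<in>{e..\<tau>}. ennreal (heat_kernel \<theta> z) \<partial>lborel)
          \<le> ennreal (K * phi0 z) + ennreal (k * (phi0 z / (- q)))"
        using nn_integral_heat_kernel_split[OF e z, of \<tau>]
        unfolding K_def k_def phi r_def by (auto intro: order_trans add_left_mono)
      also have "\<dots> = ennreal (K + k / (- q)) * ennreal (phi0 z)"
      proof -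
        have distr: "ennreal (v * y) + ennreal (w * y) = ennreal (v + w) * ennreal y"
          if "0 \<le> v" "0 \<le> w" "0 \<le> y" for v w y
          using that by (simp add: ennreal_mult distrib_right)
        have "k * (phi0 z / (- q)) = k / (- q) * phi0 z" by simp
        then show ?thesis
          using phi K k q by (simp only:) (rule distr; auto simp: divide_nonneg_neg)
      qed
      also have "\<dots> \<le> ennreal (K + k / (- q)) * (ennreal (phi0 z) + 1)"
        by (intro mult_left_mono) auto
      finally show "(\<integral>\<^sup>+\<theta>\<in>{e..\<tau>}. ennreal (heat_kernel \<theta> z) \<partial>lborel) \<le> \<dots>" .
    next
      show "0 < K + k / (- q)" using K k q by (intro add_pos_pos divide_pos_pos) auto
    qed
  qed
qed

lemma borel_measurable_phi0 [measurable]: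
  "(phi0 :: 'a::euclidean_space \<Rightarrow> real) \<in> borel_measurable borel"
  unfolding phi0_def by measurable

lemma potential_eq_kernel:
  fixes x :: "'a::euclidean_space"
  assumes "0 < e" and [measurable]: "g \<in> borel_measurable borel"
  shows "potential e \<tau> g x = (\<integral>\<^sup>+y. (\<integral>\<^sup>+\<theta>\<in>{e..\<tau>}. ennreal (heat_kernel \<theta> (x - y)) \<partial>lborel) * g y \<partial>lborel)"
proof -
  have "potential e \<tau> g x = (\<integral>\<^sup>+\<theta>. \<integral>\<^sup>+y. ennreal (heat_kernel \<theta> (x - y)) * indicator {e..\<tau>} \<theta> * g y \<partial>lborel \<partial>lborel)"
    unfolding potential_def using assms
    by (intro nn_integral_cong) (auto simp: indicator_def heat_pos_eq)
  also have "\<dots> = (\<integral>\<^sup>+y. \<integral>\<^sup>+\<theta>. ennreal (heat_kernel \<theta> (x - y)) * indicator {e..\<tau>} \<theta> * g y \<partial>lborel \<partial>lborel)"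
    by (subst lborel_pair.Fubini') auto
  finally show ?thesis by (simp add: nn_integral_multc)
qed

lemma potential_le_phi0:
  obtains c :: real where "c > 0"
    "\<And>e \<tau> (g :: 'a::euclidean_space \<Rightarrow> ennreal) x. 0 < e \<Longrightarrow> (DIM('a) \<le> 2 \<Longrightarrow> \<tau> \<le> 1) \<Longrightarrow> g \<in> borel_measurable borel \<Longrightarrow>
       potential e \<tau> g x \<le> ennreal c * ((\<integral>\<^sup>+y. g y * ennreal (phi0 (x - y)) \<partial>lborel)
           + (\<integral>\<^sup>+y. g y \<partial>lborel))"
proof -
  obtain c :: real where c: "c > 0" "\<And>(e :: real) \<tau> (z :: 'a). 0 < e \<Longrightarrow> z \<noteq> 0 \<Longrightarrow> (DIM('a) \<le> 2 \<Longrightarrow> \<tau> \<le> 1) \<Longrightarrow>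
       (\<integral>\<^sup>+\<theta>\<in>{e..\<tau>}. ennreal (heat_kernel \<theta> z) \<partial>lborel)
         \<le> ennreal c * (ennreal (phi0 z) + 1)"
    by (rule truncated_green_le_phi0) blast
  show thesis
  proof (rule that[OF c(1)])
    fix e \<tau> :: real and g :: "'a \<Rightarrow> ennreal" and x :: 'a
    assume e: "0 < e" and \<tau>: "DIM('a) \<le> 2 \<Longrightarrow> \<tau> \<le> 1" and [measurable]: "g \<in> borel_measurable borel"
    have "potential e \<tau> g x \<le> (\<integral>\<^sup>+y. ennreal c * (g y * ennreal (phi0 (x - y)) + g y) \<partial>lborel)"
      unfolding potential_eq_kernel[OF e \<open>g \<in> _\<close>]
    proof (rule nn_integral_mono_AE)
      show "AE y in lborel. (\<integral>\<^sup>+\<theta>\<in>{e..\<tau>}. ennreal (heat_kernel \<theta> (x - y)) \<partial>lborel) * g y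
          \<le> ennreal c * (g y * ennreal (phi0 (x - y)) + g y)"
        using AE_lborel_singleton[of x]
      proof eventually_elim
        case (elim y)
        then have "(\<integral>\<^sup>+\<theta>\<in>{e..\<tau>}. ennreal (heat_kernel \<theta> (x - y)) \<partial>lborel) * g y
            \<le> (ennreal c * (ennreal (phi0 (x - y)) + 1)) * g y"
          using e \<tau> by (intro mult_right_mono c(2)) auto
        then show ?case by (simp add: algebra_simps)
      qed
    qed
    also have "\<dots> = ennreal c * ((\<integral>\<^sup>+y. g y * ennreal (phi0 (x - y)) \<partial>lborel)
           + (\<integral>\<^sup>+y. g y \<partial>lborel))"
      by (simp add: nn_integral_cmult nn_integral_add)
    finally show "potential e \<tau> g x \<le> \<dots>" .
  qed
qed

section \<open>Borel versions of weak solutions\<close>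

definition gain :: "(nat \<Rightarrow> nat \<Rightarrow> real) \<Rightarrow> nat \<Rightarrow> (nat \<Rightarrow> ennreal) \<Rightarrow> ennreal" where
  "gain \<alpha> n c = (\<Sum>m = 1..n - 1. ennreal (\<alpha> m (n - m)) * c m * c (n - m))"

definition loss :: "(nat \<Rightarrow> nat \<Rightarrow> real) \<Rightarrow> nat \<Rightarrow> (nat \<Rightarrow> ennreal) \<Rightarrow> ennreal" where
  "loss \<alpha> n c = 2 * c n * (\<Sum>i. ennreal (\<alpha> n (Suc i)) * c (Suc i))"

lemma borel_measurable_gain [measurable (raw)]:
  assumes [measurable]: "\<And>k. (\<lambda>w. c w k) \<in> borel_measurable M"
  shows "(\<lambda>w. gain \<alpha> n (c w)) \<in> borel_measurable M"
  unfolding gain_def by measurable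

lemma borel_measurable_loss [measurable (raw)]:
  assumes [measurable]: "\<And>k. (\<lambda>w. c w k) \<in> borel_measurable M"
  shows "(\<lambda>w. loss \<alpha> n (c w)) \<in> borel_measurable M"
  unfolding loss_def by measurable

lemma gain_cong: "(\<And>k. 1 \<le> k \<Longrightarrow> c k = c' k) \<Longrightarrow> gain \<alpha> n c = gain \<alpha> n c'"
  unfolding gain_def by (intro sum.cong) auto

lemma loss_cong: "1 \<le> n \<Longrightarrow> (\<And>k. 1 \<le> k \<Longrightarrow> c k = c' k) \<Longrightarrow> loss \<alpha> n c = loss \<alpha> n c'"
  unfolding loss_def by simp

lemma ennreal_coag_gain:
  assumes "\<And>n m. n \<ge> 1 \<Longrightarrow> m \<ge> 1 \<Longrightarrow> 0 \<le> \<alpha> n m" "\<And>k. 1 \<le> k \<Longrightarrow> 0 \<le> c k"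
  shows "ennreal (coag_gain \<alpha> n c) = gain \<alpha> n (\<lambda>k. ennreal (c k))"
    and "0 \<le> coag_gain \<alpha> n c"
proof -
  have nn: "0 \<le> \<alpha> m (n - m) * c m * c (n - m)" if "m \<in> {1..n - 1}" for m
    using that assms by auto
  show "0 \<le> coag_gain \<alpha> n c"
    unfolding coag_gain_def by (intro sum_nonneg nn)
  show "ennreal (coag_gain \<alpha> n c) = gain \<alpha> n (\<lambda>k. ennreal (c k))"
    unfolding coag_gain_def gain_def using assms nn
    by (subst sum_ennreal[symmetric]) (auto intro!: sum.cong simp: ennreal_mult)
qed

lemma coag_loss_eq:
  assumes "1 \<le> n" "\<And>n m. n \<ge> 1 \<Longrightarrow> m \<ge> 1 \<Longrightarrow> 0 \<le> \<alpha> n m" "\<And>k. 1 \<le> k \<Longrightarrow> 0 \<le> c k"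
  shows "coag_loss \<alpha> n c = loss \<alpha> n (\<lambda>k. ennreal (c k))"
  unfolding coag_loss_def loss_def using assms by (simp add: ennreal_mult)

lemma coag_eq:
  assumes "1 \<le> n" "\<And>n m. n \<ge> 1 \<Longrightarrow> m \<ge> 1 \<Longrightarrow> 0 \<le> \<alpha> n m" "\<And>k. 1 \<le> k \<Longrightarrow> 0 \<le> c k"
  shows "coag \<alpha> n c = enn2real (gain \<alpha> n (\<lambda>k. ennreal (c k))) - enn2real (loss \<alpha> n (\<lambda>k. ennreal (c k)))"
  unfolding coag_def using assms
  by (simp add: coag_loss_eq ennreal_coag_gain(1)[symmetric] ennreal_coag_gain(2))

lemma lebesgue_measurable_AE_cong:
  fixes f g :: "'a::euclidean_space \<Rightarrow> real"
  assumes "g \<in> borel_measurable lborel" "AE x in lborel. f x = g x"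
  shows "f \<in> borel_measurable lebesgue"
proof (rule measurableI)
  fix A :: "real set" assume A: "A \<in> sets borel"
  have "g \<in> borel_measurable lebesgue"
    using assms(1) by (rule measurable_completion)
  then have g: "g -` A \<in> sets lebesgue"
    using measurable_sets[OF _ A, of g lebesgue] by simp
  have "AE x in lebesgue. x \<in> g -` A \<longleftrightarrow> x \<in> f -` A"
    using AE_completion[OF assms(2)] by eventually_elim simp
  from completion.in_sets_AE[OF this g] show "f -` A \<inter> space lebesgue \<in> sets lebesgue"
    by simp
qed simp

text \<open>
  Turns the signed Lebesgue integrals in the definition of a weak solution into differences of integrals of
  nonnegative functions. The integrand need only agree almost everywhere with a difference of Borel functions;
  its measurability is then a consequence of completeness.
\<close>

lemma lebesgue_integral_eq_enn2real_diff:
  fixes \<phi> :: "'a::euclidean_space \<Rightarrow> real"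
  assumes [measurable]: "p \<in> borel_measurable borel" "q \<in> borel_measurable borel"
    and ae: "AE z in lborel. \<phi> z = enn2real (p z) - enn2real (q z)"
    and fin: "(\<integral>\<^sup>+z. p z \<partial>lborel) < \<infinity>" "(\<integral>\<^sup>+z. q z \<partial>lborel) < \<infinity>"
  shows "integral\<^sup>L lebesgue \<phi> = enn2real (\<integral>\<^sup>+z. p z \<partial>lborel) - enn2real (\<integral>\<^sup>+z. q z \<partial>lborel)"
proof -
  have I: "integrable lborel (\<lambda>z. enn2real (h z)) \<and> (LINT z|lborel. enn2real (h z)) = enn2real (\<integral>\<^sup>+z. h z \<partial>lborel)"
    if [measurable]: "h \<in> borel_measurable borel" and h: "(\<integral>\<^sup>+z. h z \<partial>lborel) < \<infinity>" for h :: "'a \<Rightarrow> ennreal"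
  proof -
    have "AE z in lborel. h z \<noteq> \<infinity>"
      using h by (intro nn_integral_PInf_AE) auto
    then have eq: "(\<integral>\<^sup>+z. ennreal (enn2real (h z)) \<partial>lborel) = (\<integral>\<^sup>+z. h z \<partial>lborel)"
      by (intro nn_integral_cong_AE) (auto elim!: eventually_mono simp: less_top)
    show ?thesis
      using h eq by (auto intro!: integrableI_nonneg simp: integral_eq_nn_integral)
  qed
  have "integral\<^sup>L lebesgue \<phi> = integral\<^sup>L lebesgue (\<lambda>z. enn2real (p z) - enn2real (q z))"
  proof (rule integral_cong_AE)
    show "\<phi> \<in> borel_measurable lebesgue"
      by (rule lebesgue_measurable_AE_cong[OF _ ae]) measurable
    show "AE z in lebesgue. \<phi> z = enn2real (p z) - enn2real (q z)"
      using ae by (rule AE_completion)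
    show "(\<lambda>z. enn2real (p z) - enn2real (q z)) \<in> borel_measurable lebesgue"
      by (rule measurable_completion) measurable
  qed
  also have "\<dots> = (LINT z|lborel. enn2real (p z) - enn2real (q z))"
    by (rule integral_completion) measurable
  also have "\<dots> = enn2real (\<integral>\<^sup>+z. p z \<partial>lborel) - enn2real (\<integral>\<^sup>+z. q z \<partial>lborel)"
    using I[of p] I[of q] fin by simp
  finally show ?thesis .
qed

lemma heat_semigroup_eq_enn2real_diff:
  fixes \<phi> :: "'a::euclidean_space \<Rightarrow> real"
  assumes [measurable]: "p \<in> borel_measurable borel" "q \<in> borel_measurable borel"
    and ae: "AE z in lborel. \<phi> z = enn2real (p z) - enn2real (q z)"
    and x: "\<phi> x = enn2real (p x) - enn2real (q x)"
    and fin: "heat (D * t) p x < \<infinity>" "heat (D * t) q x < \<infinity>" and "0 \<le> D" "0 \<le> t"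
  shows "heat_semigroup D t \<phi> x = enn2real (heat (D * t) p x) - enn2real (heat (D * t) q x)"
proof (cases "D * t = 0")
  case True
  then show ?thesis unfolding heat_semigroup_def True using x by simp
next
  case False
  then have pos: "0 < D * t" using assms by (simp add: less_le)
  have "heat_semigroup D t \<phi> x = (LINT y|lebesgue. heat_kernel (D * t) (x - y) * \<phi> y)"
    using False by (simp add: heat_semigroup_def heat_kernel_def mult.assoc)
  also have "\<dots> = enn2real (heat (D * t) p x) - enn2real (heat (D * t) q x)"
    unfolding heat_pos_eq[OF pos]
  proof (rule lebesgue_integral_eq_enn2real_diff)
    show "AE y in lborel. heat_kernel (D * t) (x - y) * \<phi> y
        = enn2real (ennreal (heat_kernel (D * t) (x - y)) * p y) - enn2real (ennreal (heat_kernel (D * t) (x - y)) * q y)"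
      using ae by eventually_elim (simp add: enn2real_mult right_diff_distrib)
  qed (use fin in \<open>simp_all add: heat_pos_eq[OF pos]\<close>)
  finally show ?thesis .
qed

text \<open>
  Measurability for the Lebesgue measure on space-time says nothing about individual time slices, so a Borel
  function that agrees almost everywhere is chosen first.
\<close>

lemma ex_borel_version:
  fixes f :: "'a::euclidean_space \<Rightarrow> real \<Rightarrow> real"
  assumes f: "(\<lambda>(x, t). f x t) \<in> borel_measurable (lebesgue_on (UNIV \<times> {0..}))"
    and nonneg: "\<And>x t. 0 \<le> t \<Longrightarrow> 0 \<le> f x t"
  obtains g where "g \<in> borel_measurable (lborel \<Otimes>\<^sub>M lborel)"
    "AE z in lborel \<Otimes>\<^sub>M lborel. 0 \<le> snd z \<longrightarrow> ennreal (f (fst z) (snd z)) = g z"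
proof -
  have S: "UNIV \<times> {0..} \<inter> space lebesgue \<in> sets (lebesgue :: ('a \<times> real) measure)"
    by (auto intro!: sets_completionI_sets borel_closed closed_Times)
  have "(\<lambda>z. indicator (UNIV \<times> {0..}) z *\<^sub>R (\<lambda>(x, t). f x t) z) \<in> borel_measurable lebesgue"
    using f by (subst (asm) borel_measurable_restrict_space_iff[OF S]) simp
  from completion_ex_borel_measurable_real[OF this]
  obtain g :: "'a \<times> real \<Rightarrow> real" where g: "g \<in> borel_measurable lborel"
    "AE z in lborel. indicator (UNIV \<times> {0..}) z *\<^sub>R (\<lambda>(x, t). f x t) z = g z" by auto
  show thesis
  proof (rule that[of "\<lambda>z. ennreal (g z)"])
    show "(\<lambda>z. ennreal (g z)) \<in> borel_measurable (lborel \<Otimes>\<^sub>M lborel)"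
      using g(1) by (simp add: lborel_prod)
    show "AE z in lborel \<Otimes>\<^sub>M lborel. 0 \<le> snd z \<longrightarrow> ennreal (f (fst z) (snd z)) = ennreal (g z)"
      unfolding lborel_prod using g(2) by eventually_elim (auto simp: split_beta mem_Times_iff)
  qed
qed

lemma nn_integral_lebesgue_strip:
  fixes h :: "'a::euclidean_space \<times> real \<Rightarrow> ennreal"
  assumes [measurable]: "g \<in> borel_measurable (lborel \<Otimes>\<^sub>M lborel)"
    and ae: "AE z in lborel \<Otimes>\<^sub>M lborel. 0 \<le> snd z \<longrightarrow> h z = g z"
  shows "(\<integral>\<^sup>+z. h z \<partial>lebesgue_on (UNIV \<times> {0..T})) = (\<integral>\<^sup>+s\<in>{0..T}. (\<integral>\<^sup>+x. g (x, s) \<partial>lborel) \<partial>lborel)"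
proof -
  have S: "UNIV \<times> {0..T} \<inter> space lebesgue \<in> sets (lebesgue :: ('a \<times> real) measure)"
    by (auto intro!: sets_completionI_sets borel_closed closed_Times)
  have "(\<integral>\<^sup>+z. h z \<partial>lebesgue_on (UNIV \<times> {0..T})) = (\<integral>\<^sup>+z. h z * indicator (UNIV \<times> {0..T}) z \<partial>(lborel \<Otimes>\<^sub>M lborel))"
    by (simp add: nn_integral_restrict_space[OF S] nn_integral_completion lborel_prod)
  also have "\<dots> = (\<integral>\<^sup>+z. g z * indicator {0..T} (snd z) \<partial>(lborel \<Otimes>\<^sub>M lborel))"
    using ae by (intro nn_integral_cong_AE) (auto elim!: eventually_mono simp: indicator_def mem_Times_iff)
  also have "\<dots> = (\<integral>\<^sup>+s. (\<integral>\<^sup>+x. g (x, s) * indicator {0..T} s \<partial>lborel) \<partial>lborel)"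
    by (subst lborel_pair.nn_integral_snd[symmetric]) auto
  also have "\<dots> = (\<integral>\<^sup>+s\<in>{0..T}. (\<integral>\<^sup>+x. g (x, s) \<partial>lborel) \<partial>lborel)"
    by (simp add: nn_integral_multc)
  finally show ?thesis .
qed

text \<open>
  The good points may form a non-measurable set, for which the order of the coordinates cannot be exchanged
  directly; the exchange is made for a measurable null set that contains all bad points.
\<close>

lemma AE_lborel_pair_sections:
  assumes "AE z in (lborel :: 'a::euclidean_space measure) \<Otimes>\<^sub>M (lborel :: real measure). Q z"
  shows "AE x in lborel. AE s in lborel. Q (x, s)" "AE s in lborel. AE x in lborel. Q (x, s)"
proof -
  show "AE x in lborel. AE s in lborel. Q (x, s)"
    using assms by (rule lborel_pair.AE_pair)
  obtain N where N: "N \<in> null_sets ((lborel :: 'a measure) \<Otimes>\<^sub>M (lborel :: real measure))"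
    "{z \<in> space (lborel \<Otimes>\<^sub>M lborel). \<not> Q z} \<subseteq> N"
    using assms unfolding eventually_ae_filter by auto
  have meas: "{z \<in> space ((lborel :: 'a measure) \<Otimes>\<^sub>M (lborel :: real measure)). (fst z, snd z) \<notin> N} \<in> sets (lborel \<Otimes>\<^sub>M lborel)"
  proof -
    have "{z \<in> space ((lborel :: 'a measure) \<Otimes>\<^sub>M (lborel :: real measure)). (fst z, snd z) \<notin> N}
        = space (lborel \<Otimes>\<^sub>M lborel) - N" by auto
    then show ?thesis using N(1) by (simp only:) (intro sets.compl_sets null_setsD2)
  qed
  have "AE z in (lborel :: 'a measure) \<Otimes>\<^sub>M (lborel :: real measure). z \<notin> N"
    using N(1) by (rule AE_not_in)
  then have "AE x in (lborel :: 'a measure). AE s in (lborel :: real measure). (x, s) \<notin> N"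
    by (rule lborel_pair.AE_pair)
  then have "AE s in (lborel :: real measure). AE x in (lborel :: 'a measure). (x, s) \<notin> N"
    using lborel_pair.AE_commute[of "\<lambda>x s. (x, s) \<notin> N"] meas by simp
  then show "AE s in lborel. AE x in lborel. Q (x, s)"
  proof eventually_elim
    case (elim s)
    then show ?case
      using N(2) by (elim eventually_mono) (auto simp: space_pair_measure)
  qed
qed

lemma AE_commute_section_cong:
  fixes M M' :: "real \<Rightarrow> 'a::euclidean_space \<Rightarrow> ennreal"
  assumes [measurable]: "case_prod M \<in> borel_measurable (borel \<Otimes>\<^sub>M borel)"
    "case_prod M' \<in> borel_measurable (borel \<Otimes>\<^sub>M borel)"
    and ae: "AE s in lborel. AE x in lborel. M s x = M' s x"
  shows "AE x in lborel. AE s in lborel. M s x = M' s x"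
proof -
  have "{z \<in> space (lborel \<Otimes>\<^sub>M lborel). M (fst z) (snd z) = M' (fst z) (snd z)} \<in> sets (lborel \<Otimes>\<^sub>M (lborel :: 'a measure))"
    by measurable
  from lborel_pair.AE_commute[OF this] ae show ?thesis by simp
qed

lemma time_heat_cong_AE:
  fixes M M' :: "real \<Rightarrow> 'a::euclidean_space \<Rightarrow> ennreal"
  assumes [measurable]: "case_prod M \<in> borel_measurable (borel \<Otimes>\<^sub>M borel)"
    "case_prod M' \<in> borel_measurable (borel \<Otimes>\<^sub>M borel)"
    and "0 \<le> D"
    and ae: "AE s in lborel. 0 \<le> s \<longrightarrow> (AE x in lborel. M s x = M' s x)"
  shows "AE x in lborel. (\<integral>\<^sup>+s\<in>{0..t}. heat (D * (t - s)) (M s) x \<partial>lborel)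
                      = (\<integral>\<^sup>+s\<in>{0..t}. heat (D * (t - s)) (M' s) x \<partial>lborel)"
proof -
  have "AE s in lborel. AE x in lborel. heat (D * (t - s)) (M s) x * indicator {0..t} s
                                      = heat (D * (t - s)) (M' s) x * indicator {0..t} s"
    using ae
  proof eventually_elim
    case (elim s)
    show ?case
    proof (cases "s \<in> {0..t}")
      case True
      then have "AE x in lborel. M s x = M' s x" and "0 \<le> D * (t - s)"
        using elim \<open>0 \<le> D\<close> by auto
      then show ?thesis
      proof (cases "D * (t - s) = 0")
        case False
        then have "0 < D * (t - s)" using \<open>0 \<le> D * (t - s)\<close> by linarith
        from heat_cong_AE[OF \<open>AE x in lborel. M s x = M' s x\<close> this] show ?thesis by simp
      next
        case zero: True
        show ?thesis using \<open>AE x in lborel. M s x = M' s x\<close> unfolding zero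
          by (auto elim!: eventually_mono)
      qed
    qed simp
  qed
  then have "AE x in lborel. AE s in lborel. heat (D * (t - s)) (M s) x * indicator {0..t} s
                                      = heat (D * (t - s)) (M' s) x * indicator {0..t} s"
    by (rule AE_commute_section_cong[rotated 2]) measurable
  then show ?thesis
    by eventually_elim (rule nn_integral_cong_AE)
qed

text \<open>
  Let \<open>g\<close> be a Borel version of \<open>f\<close>. The Duhamel formula sees \<open>f\<close> only through its values at almost all times, so
  its right-hand side may be computed from \<open>g\<close>. As a function of time and space, this right-hand side is jointly
  Borel measurable, and it equals \<open>f\<close> almost everywhere at every time: it is the version \<open>F\<close> that is sought.
  Finally \<open>F\<close> agrees with \<open>g\<close> at almost all times, so \<open>F\<close> solves the equation with its own gain and loss terms.
\<close>

lemma weak_solution_imp_mild: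
  fixes f :: "nat \<Rightarrow> 'a::euclidean_space \<Rightarrow> real \<Rightarrow> real"
  assumes ws: "weak_solution d \<alpha> f0 f"
    and d: "\<And>n. n \<ge> 1 \<Longrightarrow> 0 \<le> d n"
    and \<alpha>: "\<And>n m. n \<ge> 1 \<Longrightarrow> m \<ge> 1 \<Longrightarrow> 0 \<le> \<alpha> n m"
    and f0_fin: "\<And>n. n \<ge> 1 \<Longrightarrow> (\<integral>\<^sup>+x. ennreal (f0 n x) \<partial>lebesgue) < \<infinity>"
  obtains F0 :: "nat \<Rightarrow> 'a \<Rightarrow> ennreal" and F :: "nat \<Rightarrow> real \<Rightarrow> 'a \<Rightarrow> ennreal" where
    "\<And>n. F0 n \<in> borel_measurable borel"
    "\<And>n. case_prod (F n) \<in> borel_measurable (borel \<Otimes>\<^sub>M borel)"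
    "\<And>n. 1 \<le> n \<Longrightarrow> mild_solution (d n) (F0 n) (F n)
        (\<lambda>t x. gain \<alpha> n (\<lambda>k. F k t x)) (\<lambda>t x. loss \<alpha> n (\<lambda>k. F k t x))"
    "\<And>n. 1 \<le> n \<Longrightarrow> AE x in lborel. ennreal (f0 n x) = F0 n x"
    "\<And>n t. 1 \<le> n \<Longrightarrow> 0 \<le> t \<Longrightarrow> AE x in lborel. ennreal (f n x t) = F n t x"
    "\<And>n t x. F n t x < \<infinity>"
proof -
  have f0: "f0 n \<in> borel_measurable lebesgue" "0 \<le> f0 n x" if "1 \<le> n" for n x
    using ws that unfolding weak_solution_def by auto
  have f: "(\<lambda>(x, t). f n x t) \<in> borel_measurable (lebesgue_on (UNIV \<times> {0..}))" if "1 \<le> n" for n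
    using ws that unfolding weak_solution_def by auto
  have f_nonneg: "0 \<le> f n x t" if "1 \<le> n" "0 \<le> t" for n x t
    using ws that unfolding weak_solution_def by auto
  have int_gain: "integrable (lebesgue_on (UNIV \<times> {0..T})) (\<lambda>(x, t). coag_gain \<alpha> n (\<lambda>k. f k x t))"
    and int_loss: "(\<integral>\<^sup>+(x, t). coag_loss \<alpha> n (\<lambda>k. f k x t) \<partial>lebesgue_on (UNIV \<times> {0..T})) < \<infinity>"
    if "1 \<le> n" "0 \<le> T" for n T
    using ws that unfolding weak_solution_def by auto
  have duhamel_f: "AE x in lborel. f n x t = heat_semigroup (d n) t (f0 n) x +
      (LINT s:{0..t}|lebesgue. heat_semigroup (d n) (t - s) (\<lambda>y. coag \<alpha> n (\<lambda>k. f k y s)) x)"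
    if "1 \<le> n" "0 \<le> t" for n t
    using ws that unfolding weak_solution_def AE_completion_iff by blast

  have ex_g: "\<exists>g::_ \<Rightarrow> ennreal. g \<in> borel_measurable (borel \<Otimes>\<^sub>M borel) \<and>
      (1 \<le> n \<longrightarrow> (AE z in lborel \<Otimes>\<^sub>M lborel. 0 \<le> snd z \<longrightarrow> ennreal (f n (fst z) (snd z)) = g z))" for n
  proof (cases "1 \<le> n")
    case True
    obtain g where "g \<in> borel_measurable (lborel \<Otimes>\<^sub>M lborel)"
      "AE z in lborel \<Otimes>\<^sub>M lborel. 0 \<le> snd z \<longrightarrow> ennreal (f n (fst z) (snd z)) = g z"
      using ex_borel_version[OF f[OF True] f_nonneg[OF True]] by blast
    then show ?thesis by (intro exI[of _ g]) simp
  next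
    case False
    then show ?thesis by (intro exI[of _ "\<lambda>_. 0"]) auto
  qed
  from choice[OF allI, OF ex_g] obtain g where
    g: "\<forall>n. g n \<in> borel_measurable (borel \<Otimes>\<^sub>M borel) \<and>
      (1 \<le> n \<longrightarrow> (AE z in lborel \<Otimes>\<^sub>M lborel. 0 \<le> snd z \<longrightarrow> ennreal (f n (fst z) (snd z)) = g n z))"
    by (rule exE)
  have g_meas [measurable]: "g n \<in> borel_measurable (borel \<Otimes>\<^sub>M borel)" for n
    using g by (elim allE conjE)
  have g_AE: "AE z in lborel \<Otimes>\<^sub>M lborel. 0 \<le> snd z \<longrightarrow> ennreal (f n (fst z) (snd z)) = g n z" if "1 \<le> n" for n
    using spec[OF g, of n] that by simp
  have ex_h: "\<exists>h. h \<in> borel_measurable borel \<and> (1 \<le> n \<longrightarrow> (AE x in lborel. f0 n x = h x))" for n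
  proof (cases "1 \<le> n")
    case True
    from completion_ex_borel_measurable_real[OF f0(1)[OF True]] show ?thesis by auto
  next
    case False
    then show ?thesis by (intro exI[of _ "\<lambda>_. 0"]) auto
  qed
  from choice[OF allI, OF ex_h] obtain h where
    h: "\<forall>n. h n \<in> borel_measurable borel \<and> (1 \<le> n \<longrightarrow> (AE x in lborel. f0 n x = h n x))"
    by (rule exE)
  have h_meas [measurable]: "h n \<in> borel_measurable borel" for n
    using spec[OF h, of n] by simp
  have h_AE: "AE x in lborel. f0 n x = h n x" if "1 \<le> n" for n
    using spec[OF h, of n] that by simp
  define F0 where "F0 n x = ennreal (h n x)" for n x
  have [measurable]: "F0 n \<in> borel_measurable borel" for n
    unfolding F0_def by measurable
  have F0_AE: "AE x in lborel. ennreal (f0 n x) = F0 n x" if "1 \<le> n" for n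
    using h_AE[OF that] unfolding F0_def by eventually_elim simp
  have F0_fin: "(\<integral>\<^sup>+x. F0 n x \<partial>lborel) < \<infinity>" if "1 \<le> n" for n
    using f0_fin[OF that] nn_integral_cong_AE[OF F0_AE[OF that]] by (simp add: nn_integral_completion)

  define agree where "agree z \<longleftrightarrow> (0 \<le> snd z \<longrightarrow> (\<forall>k\<ge>1. ennreal (f k (fst z) (snd z)) = g k z))" for z
  have agree: "AE z in lborel \<Otimes>\<^sub>M lborel. agree z"
  proof -
    have "AE z in lborel \<Otimes>\<^sub>M lborel. \<forall>k. 1 \<le> k \<longrightarrow> (0 \<le> snd z \<longrightarrow> ennreal (f k (fst z) (snd z)) = g k z)"
      unfolding AE_all_countable using g_AE by (auto intro: AE_impI)
    then show ?thesis unfolding agree_def by eventually_elim auto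
  qed
  note agree_x = AE_lborel_pair_sections(1)[OF agree] and agree_s = AE_lborel_pair_sections(2)[OF agree]

  define G where "G n s x = gain \<alpha> n (\<lambda>k. g k (x, s))" for n s x
  define L where "L n s x = loss \<alpha> n (\<lambda>k. g k (x, s))" for n s x
  have [measurable]: "case_prod (G n) \<in> borel_measurable (borel \<Otimes>\<^sub>M borel)"
    "case_prod (L n) \<in> borel_measurable (borel \<Otimes>\<^sub>M borel)" for n
    unfolding G_def L_def by measurable
  have gain_agree: "ennreal (coag_gain \<alpha> n (\<lambda>k. f k x s)) = G n s x"
    and loss_agree: "coag_loss \<alpha> n (\<lambda>k. f k x s) = L n s x"
    and coag_agree: "coag \<alpha> n (\<lambda>k. f k x s) = enn2real (G n s x) - enn2real (L n s x)"
    if n: "1 \<le> n" and "0 \<le> s" "agree (x, s)" for n s x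
  proof -
    have eq: "ennreal (f k x s) = g k (x, s)" if "1 \<le> k" for k
      using \<open>agree (x, s)\<close> \<open>0 \<le> s\<close> that unfolding agree_def by auto
    have nn: "\<And>k. 1 \<le> k \<Longrightarrow> 0 \<le> f k x s" using f_nonneg \<open>0 \<le> s\<close> by auto
    show "ennreal (coag_gain \<alpha> n (\<lambda>k. f k x s)) = G n s x"
      unfolding G_def using ennreal_coag_gain(1)[of \<alpha> "\<lambda>k. f k x s" n, OF \<alpha> nn] gain_cong[OF eq] by simp
    show "coag_loss \<alpha> n (\<lambda>k. f k x s) = L n s x"
      unfolding L_def using coag_loss_eq[of n \<alpha> "\<lambda>k. f k x s", OF n \<alpha> nn] loss_cong[OF n eq] by simp
    show "coag \<alpha> n (\<lambda>k. f k x s) = enn2real (G n s x) - enn2real (L n s x)"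
      unfolding G_def L_def
      using coag_eq[of n \<alpha> "\<lambda>k. f k x s", OF n \<alpha> nn] gain_cong[OF eq] loss_cong[OF n eq] by simp
  qed
  have G_fin: "(\<integral>\<^sup>+s\<in>{0..T}. (\<integral>\<^sup>+x. G n s x \<partial>lborel) \<partial>lborel) < \<infinity>" if n: "1 \<le> n" for n T
  proof (cases "0 \<le> T")
    case True
    have "(\<integral>\<^sup>+s\<in>{0..T}. (\<integral>\<^sup>+x. G n s x \<partial>lborel) \<partial>lborel)
        = (\<integral>\<^sup>+z. ennreal (norm ((\<lambda>(x, t). coag_gain \<alpha> n (\<lambda>k. f k x t)) z)) \<partial>lebesgue_on (UNIV \<times> {0..T}))"
    proof -
      have "AE z in lborel \<Otimes>\<^sub>M lborel. 0 \<le> snd z \<longrightarrow>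
          ennreal (norm ((\<lambda>(x, t). coag_gain \<alpha> n (\<lambda>k. f k x t)) z)) = (\<lambda>(x, s). G n s x) z"
        using agree
      proof eventually_elim
        case (elim z)
        obtain x s where z: "z = (x, s)" by (cases z)
        show ?case
        proof
          assume "0 \<le> snd z"
          then have s: "0 \<le> s" using z by simp
          have "0 \<le> coag_gain \<alpha> n (\<lambda>k. f k x s)"
            using s f_nonneg \<alpha> by (intro ennreal_coag_gain(2)) auto
          then show "ennreal (norm ((\<lambda>(x, t). coag_gain \<alpha> n (\<lambda>k. f k x t)) z)) = (\<lambda>(x, s). G n s x) z"
            using gain_agree[OF n s] elim z by simp
        qed
      qed
      then have "(\<integral>\<^sup>+z. ennreal (norm ((\<lambda>(x, t). coag_gain \<alpha> n (\<lambda>k. f k x t)) z)) \<partial>lebesgue_on (UNIV \<times> {0..T}))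
          = (\<integral>\<^sup>+s\<in>{0..T}. (\<integral>\<^sup>+x. (\<lambda>(x, s). G n s x) (x, s) \<partial>lborel) \<partial>lborel)"
        by (intro nn_integral_lebesgue_strip) measurable
      then show ?thesis by simp
    qed
    also have "\<dots> < \<infinity>"
      using int_gain[OF n True] unfolding integrable_iff_bounded by simp
    finally show ?thesis .
  qed simp
  have L_fin: "(\<integral>\<^sup>+s\<in>{0..T}. (\<integral>\<^sup>+x. L n s x \<partial>lborel) \<partial>lborel) < \<infinity>" if n: "1 \<le> n" for n T
  proof (cases "0 \<le> T")
    case True
    have "AE z in lborel \<Otimes>\<^sub>M lborel. 0 \<le> snd z \<longrightarrow>
        (\<lambda>(x, t). coag_loss \<alpha> n (\<lambda>k. f k x t)) z = (\<lambda>(x, s). L n s x) z"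
      using agree by eventually_elim (auto simp: split_beta loss_agree[OF n])
    then have "(\<integral>\<^sup>+z. (\<lambda>(x, t). coag_loss \<alpha> n (\<lambda>k. f k x t)) z \<partial>lebesgue_on (UNIV \<times> {0..T}))
        = (\<integral>\<^sup>+s\<in>{0..T}. (\<integral>\<^sup>+x. (\<lambda>(x, s). L n s x) (x, s) \<partial>lborel) \<partial>lborel)"
      by (intro nn_integral_lebesgue_strip) measurable
    then show ?thesis using int_loss[OF n True] by simp
  qed simp

  define H where "H n t x = heat (d n * t) (F0 n) x" for n t x
  define AG where "AG n t x = (\<integral>\<^sup>+s\<in>{0..t}. heat (d n * (t - s)) (G n s) x \<partial>lborel)" for n t x
  define AL where "AL n t x = (\<integral>\<^sup>+s\<in>{0..t}. heat (d n * (t - s)) (L n s) x \<partial>lborel)" for n t x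
  have [measurable]: "case_prod (H n) \<in> borel_measurable (borel \<Otimes>\<^sub>M borel)"
    "case_prod (AG n) \<in> borel_measurable (borel \<Otimes>\<^sub>M borel)"
    "case_prod (AL n) \<in> borel_measurable (borel \<Otimes>\<^sub>M borel)" for n
    unfolding H_def AG_def AL_def by measurable
  have fin: "AE x in lborel. H n t x < \<infinity> \<and> AG n t x < \<infinity> \<and> AL n t x < \<infinity>" if "1 \<le> n" "0 \<le> t" for n t
  proof -
    have "AE x in lborel. H n t x \<noteq> \<infinity>"
      using F0_fin[OF that(1)] d[OF that(1)] that(2)
      by (intro nn_integral_PInf_AE) (auto simp: H_def nn_integral_heat)
    moreover have "AE x in lborel. AG n t x \<noteq> \<infinity>"
      using G_fin[OF that(1), of t] nn_integral_time_heat[of "G n" "d n" t] d[OF that(1)]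
      by (intro nn_integral_PInf_AE) (auto simp: AG_def)
    moreover have "AE x in lborel. AL n t x \<noteq> \<infinity>"
      using L_fin[OF that(1), of t] nn_integral_time_heat[of "L n" "d n" t] d[OF that(1)]
      by (intro nn_integral_PInf_AE) (auto simp: AL_def)
    ultimately show ?thesis by eventually_elim (simp add: less_top)
  qed
  have duhamel_eq: "AE x in lborel.
      (LINT s:{0..t}|lebesgue. heat_semigroup (d n) (t - s) (\<lambda>y. coag \<alpha> n (\<lambda>k. f k y s)) x)
        = enn2real (AG n t x) - enn2real (AL n t x)" if n: "1 \<le> n" and t: "0 \<le> t" for n t
    using fin[OF n t] agree_x
  proof eventually_elim
    case (elim x)
    then have finite: "AG n t x < \<infinity>" "AL n t x < \<infinity>" by auto
    have ae: "AE s in lborel. heat (d n * (t - s)) (M s) x * indicator {0..t} s \<noteq> \<infinity>"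
      if [measurable]: "case_prod M \<in> borel_measurable (borel \<Otimes>\<^sub>M (borel :: 'a measure))"
        and "(\<integral>\<^sup>+s\<in>{0..t}. heat (d n * (t - s)) (M s) x \<partial>lborel) < \<infinity>" for M
      using that by (intro nn_integral_PInf_AE) auto
    have "AE s in lborel. heat (d n * (t - s)) (G n s) x * indicator {0..t} s \<noteq> \<infinity>"
      by (rule ae[OF _ finite(1)[unfolded AG_def]]) measurable
    moreover have "AE s in lborel. heat (d n * (t - s)) (L n s) x * indicator {0..t} s \<noteq> \<infinity>"
      by (rule ae[OF _ finite(2)[unfolded AL_def]]) measurable
    ultimately have "AE s in lborel. indicator {0..t} s *\<^sub>R heat_semigroup (d n) (t - s) (\<lambda>y. coag \<alpha> n (\<lambda>k. f k y s)) x
        = enn2real (heat (d n * (t - s)) (G n s) x * indicator {0..t} s)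
          - enn2real (heat (d n * (t - s)) (L n s) x * indicator {0..t} s)"
      using elim(2) agree_s
    proof eventually_elim
      case (elim s)
      show ?case
      proof (cases "s \<in> {0..t}")
        case True
        then have s: "0 \<le> s" "s \<le> t" by auto
        have "heat_semigroup (d n) (t - s) (\<lambda>y. coag \<alpha> n (\<lambda>k. f k y s)) x
            = enn2real (heat (d n * (t - s)) (G n s) x) - enn2real (heat (d n * (t - s)) (L n s) x)"
        proof (rule heat_semigroup_eq_enn2real_diff)
          show "AE y in lborel. coag \<alpha> n (\<lambda>k. f k y s) = enn2real (G n s y) - enn2real (L n s y)"
            using elim(4) by eventually_elim (rule coag_agree[OF n s(1)])
          show "coag \<alpha> n (\<lambda>k. f k x s) = enn2real (G n s x) - enn2real (L n s x)"
            using elim(3) by (rule coag_agree[OF n s(1)])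
        qed (use elim True s d[OF n] in \<open>simp_all add: less_top\<close>)
        then show ?thesis using True by simp
      qed simp
    qed
    then have "(LINT s:{0..t}|lebesgue. heat_semigroup (d n) (t - s) (\<lambda>y. coag \<alpha> n (\<lambda>k. f k y s)) x)
      = enn2real (\<integral>\<^sup>+s\<in>{0..t}. heat (d n * (t - s)) (G n s) x \<partial>lborel)
        - enn2real (\<integral>\<^sup>+s\<in>{0..t}. heat (d n * (t - s)) (L n s) x \<partial>lborel)"
      unfolding set_lebesgue_integral_def using finite
      by (intro lebesgue_integral_eq_enn2real_diff) (auto simp: AG_def AL_def)
    then show ?case by (simp add: AG_def AL_def)
  qed
  have initial_eq: "AE x in lborel. heat_semigroup (d n) t (f0 n) x = enn2real (H n t x)"
    if n: "1 \<le> n" and t: "0 \<le> t" for n t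
    using fin[OF n t] h_AE[OF n]
  proof eventually_elim
    case (elim x)
    have eq: "f0 n y = enn2real (F0 n y) - enn2real ((\<lambda>_. 0) y)" if "f0 n y = h n y" for y
      using f0(2)[OF n, of y] that by (simp add: F0_def)
    have "heat_semigroup (d n) t (f0 n) x = enn2real (heat (d n * t) (F0 n) x) - enn2real (heat (d n * t) (\<lambda>_. 0) x)"
    proof (rule heat_semigroup_eq_enn2real_diff)
      show "AE y in lborel. f0 n y = enn2real (F0 n y) - enn2real 0"
        using h_AE[OF n] by eventually_elim (rule eq)
      show "f0 n x = enn2real (F0 n x) - enn2real 0"
        using elim(2) by (rule eq)
      show "heat (d n * t) (\<lambda>_. 0) x < \<infinity>" by (simp add: heat_def)
    qed (use elim d[OF n] t in \<open>simp_all add: H_def\<close>)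
    then show ?case by (simp add: H_def heat_def)
  qed

  \<comment> \<open>The right-hand side of the Duhamel formula for \<open>g\<close>; the truncation at 0 by \<open>ennreal\<close> affects only null sets.\<close>
  define F where "F n t x = ennreal (enn2real (H n t x) + enn2real (AG n t x) - enn2real (AL n t x))" for n t x
  have F_meas [measurable]: "case_prod (F n) \<in> borel_measurable (borel \<Otimes>\<^sub>M borel)" for n
    unfolding F_def by measurable
  have F_AE: "AE x in lborel. ennreal (f n x t) = F n t x \<and> F n t x + AL n t x = H n t x + AG n t x"
    if n: "1 \<le> n" and t: "0 \<le> t" for n t
    using duhamel_f[OF n t] initial_eq[OF n t] duhamel_eq[OF n t] fin[OF n t]
  proof eventually_elim
    case (elim x)
    then have f: "f n x t = enn2real (H n t x) + enn2real (AG n t x) - enn2real (AL n t x)" by simp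
    have "F n t x + AL n t x = ennreal (f n x t) + ennreal (enn2real (AL n t x))"
      using elim unfolding F_def f by (simp add: less_top)
    also have "\<dots> = ennreal (enn2real (H n t x) + enn2real (AG n t x))"
      using f_nonneg[OF n t, of x] f by (simp flip: ennreal_plus)
    also have "\<dots> = H n t x + AG n t x"
      using elim by (simp add: less_top)
    finally show ?case unfolding F_def f by simp
  qed
  have F_eq_g: "AE s in lborel. 0 \<le> s \<longrightarrow> (AE x in lborel. \<forall>k\<ge>1. F k s x = g k (x, s))"
    using agree_s
  proof eventually_elim
    case (elim s)
    show ?case
    proof
      assume s: "0 \<le> s"
      have "AE x in lborel. \<forall>k. 1 \<le> k \<longrightarrow> ennreal (f k x s) = F k s x"
        unfolding AE_all_countable using F_AE[OF _ s] by (auto intro!: AE_impI elim!: eventually_mono)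
      with elim show "AE x in lborel. \<forall>k\<ge>1. F k s x = g k (x, s)"
        by eventually_elim (use s in \<open>auto simp: agree_def\<close>)
    qed
  qed
  have gain_F: "AE s in lborel. 0 \<le> s \<longrightarrow> (AE x in lborel. gain \<alpha> n (\<lambda>k. F k s x) = G n s x)" for n
    using F_eq_g by eventually_elim (auto elim!: eventually_mono simp: G_def intro!: gain_cong)
  have loss_F: "AE s in lborel. 0 \<le> s \<longrightarrow> (AE x in lborel. loss \<alpha> n (\<lambda>k. F k s x) = L n s x)" if "1 \<le> n" for n
    using F_eq_g by eventually_elim (auto elim!: eventually_mono simp: L_def intro!: loss_cong that)
  have int_cong: "(\<integral>\<^sup>+s\<in>{0..t}. (\<integral>\<^sup>+x. M s x \<partial>lborel) \<partial>lborel) = (\<integral>\<^sup>+s\<in>{0..t}. (\<integral>\<^sup>+x. M' s x \<partial>lborel) \<partial>lborel)"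
    if "AE s in lborel. 0 \<le> s \<longrightarrow> (AE x in (lborel :: 'a measure). M s x = M' s x)" for M M' :: "real \<Rightarrow> 'a \<Rightarrow> ennreal" and t
    using that by (intro nn_integral_cong_AE)
      (auto elim!: eventually_mono simp: indicator_def intro!: nn_integral_cong_AE)
  show thesis
  proof (rule that)
    fix n :: nat assume n: "1 \<le> n"
    show "mild_solution (d n) (F0 n) (F n) (\<lambda>t x. gain \<alpha> n (\<lambda>k. F k t x)) (\<lambda>t x. loss \<alpha> n (\<lambda>k. F k t x))"
    proof
      show "0 \<le> d n" by (rule d[OF n])
      show "AE x in lborel. F n t x + (\<integral>\<^sup>+s\<in>{0..t}. heat (d n * (t - s)) (\<lambda>x. loss \<alpha> n (\<lambda>k. F k s x)) x \<partial>lborel)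
          = heat (d n * t) (F0 n) x + (\<integral>\<^sup>+s\<in>{0..t}. heat (d n * (t - s)) (\<lambda>x. gain \<alpha> n (\<lambda>k. F k s x)) x \<partial>lborel)"
        if t: "0 \<le> t" for t
      proof -
        have "AE x in lborel. (\<integral>\<^sup>+s\<in>{0..t}. heat (d n * (t - s)) (\<lambda>x. loss \<alpha> n (\<lambda>k. F k s x)) x \<partial>lborel) = AL n t x"
          unfolding AL_def by (rule time_heat_cong_AE[OF _ _ d[OF n] loss_F[OF n]]) measurable
        moreover have "AE x in lborel. (\<integral>\<^sup>+s\<in>{0..t}. heat (d n * (t - s)) (\<lambda>x. gain \<alpha> n (\<lambda>k. F k s x)) x \<partial>lborel) = AG n t x"
          unfolding AG_def by (rule time_heat_cong_AE[OF _ _ d[OF n] gain_F]) measurable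
        ultimately show ?thesis
          using F_AE[OF n t] by eventually_elim (simp add: H_def)
      qed
      show "(\<integral>\<^sup>+x. F0 n x \<partial>lborel) < \<infinity>" by (rule F0_fin[OF n])
      show "(\<integral>\<^sup>+s\<in>{0..t}. (\<integral>\<^sup>+x. gain \<alpha> n (\<lambda>k. F k s x) \<partial>lborel) \<partial>lborel) < \<infinity>" for t
        unfolding int_cong[OF gain_F] by (rule G_fin[OF n])
      show "(\<integral>\<^sup>+s\<in>{0..t}. (\<integral>\<^sup>+x. loss \<alpha> n (\<lambda>k. F k s x) \<partial>lborel) \<partial>lborel) < \<infinity>" for t
        unfolding int_cong[OF loss_F[OF n]] by (rule L_fin[OF n])
    qed measurable
  next
    fix n :: nat and t :: real assume "1 \<le> n" "0 \<le> t"
    from F_AE[OF this] show "AE x in lborel. ennreal (f n x t) = F n t x"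
      by eventually_elim simp
  qed (use F0_AE in \<open>auto simp: F_def\<close>)
qed

section \<open>Moments that are cut off at mass \<open>N\<close>\<close>

definition wsum :: "(nat \<Rightarrow> real) \<Rightarrow> nat \<Rightarrow> (nat \<Rightarrow> ennreal) \<Rightarrow> ennreal" where
  "wsum w N c = (\<Sum>n = 1..N. ennreal (w n) * c n)"

definition pairs :: "nat \<Rightarrow> (nat \<times> nat) set" where
  "pairs N = (SIGMA j:{1..N}. {1..N - j})"

text \<open>
  Only collisions whose product has mass at most \<open>N\<close> contribute: these are the ones whose gain is seen below
  the cut-off.
\<close>

definition collisions :: "(nat \<Rightarrow> nat \<Rightarrow> real) \<Rightarrow> (nat \<Rightarrow> nat \<Rightarrow> real) \<Rightarrow> nat \<Rightarrow> (nat \<Rightarrow> ennreal) \<Rightarrow> ennreal" where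
  "collisions \<alpha> r N c = (\<Sum>(j, k)\<in>pairs N. ennreal (r j k) * (ennreal (\<alpha> j k) * c j * c k))"

lemma finite_pairs [simp]: "finite (pairs N)"
  unfolding pairs_def by simp

lemma mem_pairs_iff: "(j, k) \<in> pairs N \<longleftrightarrow> 1 \<le> j \<and> 1 \<le> k \<and> j + k \<le> N"
  unfolding pairs_def by auto

lemma borel_measurable_wsum [measurable (raw)]:
  assumes [measurable]: "\<And>k. (\<lambda>v. c v k) \<in> borel_measurable M"
  shows "(\<lambda>v. wsum w N (c v)) \<in> borel_measurable M"
  unfolding wsum_def by measurable

lemma borel_measurable_collisions [measurable (raw)]:
  assumes [measurable]: "\<And>k. (\<lambda>v. c v k) \<in> borel_measurable M"
  shows "(\<lambda>v. collisions \<alpha> r N (c v)) \<in> borel_measurable M"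
  unfolding collisions_def split_beta by measurable

lemma collisions_mono:
  "(\<And>j k. (j, k) \<in> pairs N \<Longrightarrow> r j k \<le> r' j k) \<Longrightarrow> collisions \<alpha> r N c \<le> collisions \<alpha> r' N c"
  unfolding collisions_def by (intro sum_mono) (auto intro!: mult_right_mono ennreal_leI)

lemma collisions_add:
  assumes "\<And>j k. 1 \<le> j \<Longrightarrow> 1 \<le> k \<Longrightarrow> 0 \<le> r j k \<and> 0 \<le> r' j k"
  shows "collisions \<alpha> (\<lambda>j k. r j k + r' j k) N c = collisions \<alpha> r N c + collisions \<alpha> r' N c"
  unfolding collisions_def sum.distrib[symmetric] using assms
  by (intro sum.cong) (auto simp: mem_pairs_iff distrib_right)

lemma collisions_cmult:
  assumes "0 \<le> b"
  shows "collisions \<alpha> (\<lambda>j k. b * r j k) N c = ennreal b * collisions \<alpha> r N c"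
  unfolding collisions_def sum_distrib_left using assms
  by (intro sum.cong) (auto simp: ennreal_mult' mult.assoc)

text \<open>
  Reindexing the gains by the colliding pair \<open>(j, k)\<close> in place of the mass \<open>j + k\<close> that it produces.
\<close>

lemma wsum_gain: "wsum w N (\<lambda>n. gain \<alpha> n c) = collisions \<alpha> (\<lambda>j k. w (j + k)) N c"
proof -
  have "wsum w N (\<lambda>n. gain \<alpha> n c)
      = (\<Sum>(n, m)\<in>(SIGMA n:{1..N}. {1..n - 1}). ennreal (w n) * (ennreal (\<alpha> m (n - m)) * c m * c (n - m)))"
    unfolding wsum_def gain_def sum_distrib_left by (subst sum.Sigma) auto
  also have "\<dots> = collisions \<alpha> (\<lambda>j k. w (j + k)) N c"
    unfolding collisions_def
    by (rule sum.reindex_bij_witness[where i = "\<lambda>(j, k). (j + k, j)" and j = "\<lambda>(n, m). (m, n - m)"])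
       (auto simp: pairs_def)
  finally show ?thesis .
qed

lemma collisions_swap:
  assumes "\<And>n m. n \<ge> 1 \<Longrightarrow> m \<ge> 1 \<Longrightarrow> \<alpha> n m = \<alpha> m n"
  shows "collisions \<alpha> r N c = collisions \<alpha> (\<lambda>j k. r k j) N c"
  unfolding collisions_def using assms
  by (intro sum.reindex_bij_witness[where i = "\<lambda>(j, k). (k, j)" and j = "\<lambda>(j, k). (k, j)"])
     (auto simp: mem_pairs_iff mult_ac)

text \<open>
  A collision of \<open>j\<close> and \<open>k\<close> removes the weights of both particles. The factor 2 in the loss term and the
  symmetry of \<open>\<alpha>\<close> allow the weight of \<open>j\<close> to be replaced by that sum. Collisions whose product is heavier than
  \<open>N\<close> are dropped; they have no gain term to pay for.
\<close>

lemma collisions_le_wsum_loss: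
  assumes sym: "\<And>n m. n \<ge> 1 \<Longrightarrow> m \<ge> 1 \<Longrightarrow> \<alpha> n m = \<alpha> m n" and w: "\<And>n. n \<ge> 1 \<Longrightarrow> 0 \<le> w n"
  shows "collisions \<alpha> (\<lambda>j k. w j + w k) N c \<le> wsum w N (\<lambda>n. loss \<alpha> n c)"
proof -
  have "collisions \<alpha> (\<lambda>j k. w j + w k) N c = collisions \<alpha> (\<lambda>j k. w j) N c + collisions \<alpha> (\<lambda>j k. w k) N c"
    using w by (intro collisions_add) auto
  also have "collisions \<alpha> (\<lambda>j k. w k) N c = collisions \<alpha> (\<lambda>j k. w j) N c"
    using collisions_swap[OF sym] .
  also have "collisions \<alpha> (\<lambda>j k. w j) N c + collisions \<alpha> (\<lambda>j k. w j) N c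
      = (\<Sum>j = 1..N. ennreal (w j) * (2 * c j * (\<Sum>k = 1..N - j. ennreal (\<alpha> j k) * c k)))"
    unfolding mult_2[symmetric] collisions_def pairs_def sum_distrib_left
    by (subst sum.Sigma) (auto intro!: sum.cong simp: mult_ac)
  also have "\<dots> \<le> wsum w N (\<lambda>n. loss \<alpha> n c)"
    unfolding wsum_def
  proof (intro sum_mono mult_left_mono)
    fix j
    have "(\<Sum>k = 1..N - j. ennreal (\<alpha> j k) * c k) = (\<Sum>i<N - j. ennreal (\<alpha> j (Suc i)) * c (Suc i))"
      using sum.atLeast1_atMost_eq[of "\<lambda>k. ennreal (\<alpha> j k) * c k" "N - j"] by simp
    also have "\<dots> \<le> (\<Sum>i. ennreal (\<alpha> j (Suc i)) * c (Suc i))"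
      by (intro sum_le_suminf) auto
    finally show "2 * c j * (\<Sum>k = 1..N - j. ennreal (\<alpha> j k) * c k) \<le> loss \<alpha> j c"
      unfolding loss_def by (intro mult_left_mono) auto
  qed auto
  finally show ?thesis .
qed

lemma nn_integral_wsum:
  assumes [measurable]: "\<And>n. g n \<in> borel_measurable M"
  shows "(\<integral>\<^sup>+x. wsum w N (\<lambda>n. g n x) \<partial>M) = wsum w N (\<lambda>n. \<integral>\<^sup>+x. g n x \<partial>M)"
  unfolding wsum_def by (simp add: nn_integral_sum nn_integral_cmult)

lemma wsum_distrib_right: "wsum w N c * b = wsum w N (\<lambda>n. c n * b)"
  unfolding wsum_def by (simp add: sum_distrib_right mult.assoc)

lemma wsum_add: "wsum w N (\<lambda>n. c n + c' n) = wsum w N c + wsum w N c'"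
  unfolding wsum_def by (simp add: distrib_left sum.distrib)

lemma wsum_cong: "(\<And>n. 1 \<le> n \<Longrightarrow> c n = c' n) \<Longrightarrow> wsum w N c = wsum w N c'"
  unfolding wsum_def by (intro sum.cong) auto

lemma wsum_less_top: "(\<And>n. 1 \<le> n \<Longrightarrow> c n < \<infinity>) \<Longrightarrow> wsum w N c < \<infinity>"
  unfolding wsum_def by (auto simp: ennreal_mult_less_top)

lemma set_nn_integral_wsum:
  fixes g :: "nat \<Rightarrow> real \<Rightarrow> ennreal"
  assumes [measurable]: "\<And>n. g n \<in> borel_measurable borel"
  shows "(\<integral>\<^sup>+s\<in>{0..t}. wsum w N (\<lambda>n. g n s) \<partial>lborel) = wsum w N (\<lambda>n. \<integral>\<^sup>+s\<in>{0..t}. g n s \<partial>lborel)"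
  unfolding wsum_distrib_right by (rule nn_integral_wsum) measurable

lemma heat_wsum:
  assumes [measurable]: "\<And>n. g n \<in> borel_measurable borel"
  shows "heat \<theta> (\<lambda>y. wsum w N (\<lambda>n. g n y)) x = wsum w N (\<lambda>n. heat \<theta> (g n) x)"
  unfolding wsum_def by (simp add: heat_sum heat_cmult)

lemma potential_wsum:
  assumes [measurable]: "\<And>n. g n \<in> borel_measurable borel"
  shows "potential e \<tau> (\<lambda>y. wsum w N (\<lambda>n. g n y)) x = wsum w N (\<lambda>n. potential e \<tau> (g n) x)"
  unfolding potential_def heat_wsum[OF assms] wsum_distrib_right by (rule nn_integral_wsum) measurable

lemma energy_wsum_left:
  assumes [measurable]: "\<And>n. g n \<in> borel_measurable borel" "h \<in> borel_measurable borel"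
  shows "energy e \<tau> (\<lambda>y. wsum w N (\<lambda>n. g n y)) h = wsum w N (\<lambda>n. energy e \<tau> (g n) h)"
  unfolding energy_def wsum_distrib_right by (rule nn_integral_wsum) measurable

lemma wsum_distrib_left: "b * wsum w N c = wsum w N (\<lambda>n. b * c n)"
  unfolding wsum_def by (simp add: sum_distrib_left mult_ac)

lemma energy_wsum_right:
  assumes [measurable]: "\<And>n. g n \<in> borel_measurable borel" "h \<in> borel_measurable borel"
  shows "energy e \<tau> h (\<lambda>y. wsum w N (\<lambda>n. g n y)) = wsum w N (\<lambda>n. energy e \<tau> h (g n))"
  unfolding energy_def potential_wsum[OF assms(1)] wsum_distrib_left by (rule nn_integral_wsum) measurable

lemma overlap_wsum_left:
  assumes [measurable]: "\<And>n. g n \<in> borel_measurable borel" "h \<in> borel_measurable borel"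
  shows "overlap \<theta> (\<lambda>y. wsum w N (\<lambda>n. g n y)) h = wsum w N (\<lambda>n. overlap \<theta> (g n) h)"
  unfolding overlap_def wsum_distrib_right by (rule nn_integral_wsum) measurable

lemma overlap_wsum_right:
  assumes [measurable]: "\<And>n. g n \<in> borel_measurable borel" "h \<in> borel_measurable borel"
  shows "overlap \<theta> h (\<lambda>y. wsum w N (\<lambda>n. g n y)) = wsum w N (\<lambda>n. overlap \<theta> h (g n))"
  unfolding overlap_def heat_wsum[OF assms(1)] wsum_distrib_left by (rule nn_integral_wsum) measurable

lemma potential_mono: "(\<And>y. g y \<le> h y) \<Longrightarrow> potential e \<tau> g x \<le> potential e \<tau> h x"
  unfolding potential_def by (intro nn_integral_mono mult_right_mono heat_mono) auto

lemma potential_le: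
  fixes x :: "'a::euclidean_space"
  assumes "0 < e" "e \<le> \<tau>" and [measurable]: "g \<in> borel_measurable borel"
  shows "potential e \<tau> g x \<le> ennreal ((\<tau> - e) * heat_kernel e (0 :: 'a)) * (\<integral>\<^sup>+y. g y \<partial>lborel)"
proof -
  define c where "c = ennreal (heat_kernel e (0 :: 'a)) * (\<integral>\<^sup>+y. g y \<partial>lborel)"
  have "potential e \<tau> g x \<le> (\<integral>\<^sup>+\<theta>. c * indicator {e..\<tau>} \<theta> \<partial>lborel)"
    unfolding potential_def c_def using assms
    by (intro nn_integral_mono) (auto simp: indicator_def intro!: heat_le)
  also have "\<dots> = c * ennreal (\<tau> - e)"
    using assms by (simp add: nn_integral_cmult)
  finally show ?thesis
    using assms by (simp add: c_def ennreal_mult mult_ac)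
qed

lemma energy_le:
  fixes g h :: "'a::euclidean_space \<Rightarrow> ennreal"
  assumes "0 < e" "e \<le> \<tau>" and [measurable]: "g \<in> borel_measurable borel" "h \<in> borel_measurable borel"
  shows "energy e \<tau> g h \<le> ennreal ((\<tau> - e) * heat_kernel e (0 :: 'a)) * ((\<integral>\<^sup>+x. g x \<partial>lborel) * (\<integral>\<^sup>+x. h x \<partial>lborel))"
proof -
  have "energy e \<tau> g h \<le> (\<integral>\<^sup>+x. g x * (ennreal ((\<tau> - e) * heat_kernel e (0 :: 'a)) * (\<integral>\<^sup>+y. h y \<partial>lborel)) \<partial>lborel)"
    unfolding energy_def using assms by (intro nn_integral_mono mult_left_mono potential_le) auto
  then show ?thesis by (simp add: nn_integral_multc mult_ac)
qed

lemma energy_mono: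
  "(\<And>x. g x \<le> g' x) \<Longrightarrow> (\<And>x. h x \<le> h' x) \<Longrightarrow> energy e \<tau> g h \<le> energy e \<tau> g' h'"
  unfolding energy_def by (intro nn_integral_mono mult_mono potential_mono) auto

locale coagulation_diffusion =
  fixes d :: "nat \<Rightarrow> real" and \<alpha> :: "nat \<Rightarrow> nat \<Rightarrow> real" and F0 :: "nat \<Rightarrow> 'a::euclidean_space \<Rightarrow> ennreal"
    and F :: "nat \<Rightarrow> real \<Rightarrow> 'a \<Rightarrow> ennreal" and B :: real
  assumes d_le: "n \<ge> 1 \<Longrightarrow> d n \<le> B"
    and \<alpha>_nonneg: "n \<ge> 1 \<Longrightarrow> m \<ge> 1 \<Longrightarrow> 0 \<le> \<alpha> n m"
    and \<alpha>_sym: "n \<ge> 1 \<Longrightarrow> m \<ge> 1 \<Longrightarrow> \<alpha> n m = \<alpha> m n"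
    and F0_meas [measurable]: "F0 n \<in> borel_measurable borel"
    and F_meas [measurable]: "case_prod (F n) \<in> borel_measurable (borel \<Otimes>\<^sub>M borel)"
    and mild: "n \<ge> 1 \<Longrightarrow> mild_solution (d n) (F0 n) (F n)
        (\<lambda>t x. gain \<alpha> n (\<lambda>k. F k t x)) (\<lambda>t x. loss \<alpha> n (\<lambda>k. F k t x))"
    and F_finite: "F n t x < \<infinity>"
begin

abbreviation "G n s x \<equiv> gain \<alpha> n (\<lambda>k. F k s x)"
abbreviation "L n s x \<equiv> loss \<alpha> n (\<lambda>k. F k s x)"
abbreviation "X w N s x \<equiv> wsum w N (\<lambda>n. F n s x)"
abbreviation "X0 w N x \<equiv> wsum w N (\<lambda>n. F0 n x)"

lemma d_nonneg: "n \<ge> 1 \<Longrightarrow> 0 \<le> d n"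
  using mild_solution.D_nonneg[OF mild] .

lemma weighted_mass_balance:
  assumes t: "0 \<le> t"
  shows "(\<integral>\<^sup>+x. X w N t x \<partial>lborel) + (\<integral>\<^sup>+s\<in>{0..t}. (\<integral>\<^sup>+x. wsum w N (\<lambda>n. L n s x) \<partial>lborel) \<partial>lborel)
       = (\<integral>\<^sup>+x. X0 w N x \<partial>lborel) + (\<integral>\<^sup>+s\<in>{0..t}. (\<integral>\<^sup>+x. wsum w N (\<lambda>n. G n s x) \<partial>lborel) \<partial>lborel)"
    and weighted_loss_finite: "(\<integral>\<^sup>+s\<in>{0..t}. (\<integral>\<^sup>+x. wsum w N (\<lambda>n. L n s x) \<partial>lborel) \<partial>lborel) < \<infinity>"
proof -
  have I: "(\<integral>\<^sup>+s\<in>{0..t}. (\<integral>\<^sup>+x. wsum w N (\<lambda>n. M n s x) \<partial>lborel) \<partial>lborel)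
      = wsum w N (\<lambda>n. \<integral>\<^sup>+s\<in>{0..t}. (\<integral>\<^sup>+x. M n s x \<partial>lborel) \<partial>lborel)"
    if [measurable]: "\<And>n. case_prod (M n) \<in> borel_measurable (borel \<Otimes>\<^sub>M (borel :: 'a measure))" for M
  proof -
    have "(\<integral>\<^sup>+x. wsum w N (\<lambda>n. M n s x) \<partial>lborel) = wsum w N (\<lambda>n. \<integral>\<^sup>+x. M n s x \<partial>lborel)" for s
      by (rule nn_integral_wsum) measurable
    then show ?thesis
      by (simp only:) (rule set_nn_integral_wsum, measurable)
  qed
  have X: "(\<integral>\<^sup>+x. X w N t x \<partial>lborel) = wsum w N (\<lambda>n. \<integral>\<^sup>+x. F n t x \<partial>lborel)"
    "(\<integral>\<^sup>+x. X0 w N x \<partial>lborel) = wsum w N (\<lambda>n. \<integral>\<^sup>+x. F0 n x \<partial>lborel)"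
    by (rule nn_integral_wsum; measurable)+
  have IL: "(\<integral>\<^sup>+s\<in>{0..t}. (\<integral>\<^sup>+x. wsum w N (\<lambda>n. L n s x) \<partial>lborel) \<partial>lborel)
      = wsum w N (\<lambda>n. \<integral>\<^sup>+s\<in>{0..t}. (\<integral>\<^sup>+x. L n s x \<partial>lborel) \<partial>lborel)"
    by (rule I) measurable
  have IG: "(\<integral>\<^sup>+s\<in>{0..t}. (\<integral>\<^sup>+x. wsum w N (\<lambda>n. G n s x) \<partial>lborel) \<partial>lborel)
      = wsum w N (\<lambda>n. \<integral>\<^sup>+s\<in>{0..t}. (\<integral>\<^sup>+x. G n s x \<partial>lborel) \<partial>lborel)"
    by (rule I) measurable
  show "(\<integral>\<^sup>+x. X w N t x \<partial>lborel) + (\<integral>\<^sup>+s\<in>{0..t}. (\<integral>\<^sup>+x. wsum w N (\<lambda>n. L n s x) \<partial>lborel) \<partial>lborel)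
       = (\<integral>\<^sup>+x. X0 w N x \<partial>lborel) + (\<integral>\<^sup>+s\<in>{0..t}. (\<integral>\<^sup>+x. wsum w N (\<lambda>n. G n s x) \<partial>lborel) \<partial>lborel)"
    unfolding IL IG X wsum_add[symmetric]
    by (rule wsum_cong) (rule mild_solution.mass_balance[OF mild t])
  show "(\<integral>\<^sup>+s\<in>{0..t}. (\<integral>\<^sup>+x. wsum w N (\<lambda>n. L n s x) \<partial>lborel) \<partial>lborel) < \<infinity>"
    unfolding IL by (rule wsum_less_top) (rule mild_solution.finite_R[OF mild])
qed

text \<open>
  A bound of gain by loss at each point turns into a bound on the mass. The loss is integrable and cancels.
\<close>

lemma weighted_mass_le:
  assumes t: "0 \<le> t" and [measurable]: "case_prod h \<in> borel_measurable (borel \<Otimes>\<^sub>M (borel :: 'a measure))"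
      "case_prod q \<in> borel_measurable (borel \<Otimes>\<^sub>M borel)"
    and le: "\<And>s x. wsum w N (\<lambda>n. G n s x) + q s x \<le> wsum w N (\<lambda>n. L n s x) + h s x"
  shows "(\<integral>\<^sup>+x. X w N t x \<partial>lborel) + (\<integral>\<^sup>+s\<in>{0..t}. (\<integral>\<^sup>+x. q s x \<partial>lborel) \<partial>lborel)
      \<le> (\<integral>\<^sup>+x. X0 w N x \<partial>lborel) + (\<integral>\<^sup>+s\<in>{0..t}. (\<integral>\<^sup>+x. h s x \<partial>lborel) \<partial>lborel)"
proof -
  define IL where "IL = (\<integral>\<^sup>+s\<in>{0..t}. (\<integral>\<^sup>+x. wsum w N (\<lambda>n. L n s x) \<partial>lborel) \<partial>lborel)"
  define IG where "IG = (\<integral>\<^sup>+s\<in>{0..t}. (\<integral>\<^sup>+x. wsum w N (\<lambda>n. G n s x) \<partial>lborel) \<partial>lborel)"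
  define Iq where "Iq = (\<integral>\<^sup>+s\<in>{0..t}. (\<integral>\<^sup>+x. q s x \<partial>lborel) \<partial>lborel)"
  define Ih where "Ih = (\<integral>\<^sup>+s\<in>{0..t}. (\<integral>\<^sup>+x. h s x \<partial>lborel) \<partial>lborel)"
  have "IG + Iq = (\<integral>\<^sup>+s\<in>{0..t}. (\<integral>\<^sup>+x. wsum w N (\<lambda>n. G n s x) + q s x \<partial>lborel) \<partial>lborel)"
    unfolding IG_def Iq_def by (simp add: nn_integral_add distrib_right)
  also have "\<dots> \<le> (\<integral>\<^sup>+s\<in>{0..t}. (\<integral>\<^sup>+x. wsum w N (\<lambda>n. L n s x) + h s x \<partial>lborel) \<partial>lborel)"
    by (intro nn_integral_mono mult_right_mono le) auto
  also have "\<dots> = IL + Ih"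
    unfolding IL_def Ih_def by (simp add: nn_integral_add distrib_right)
  finally have 1: "IG + Iq \<le> IL + Ih" .
  have 2: "(\<integral>\<^sup>+x. X w N t x \<partial>lborel) + IL = (\<integral>\<^sup>+x. X0 w N x \<partial>lborel) + IG"
    unfolding IL_def IG_def by (rule weighted_mass_balance[OF t])
  have "IL + ((\<integral>\<^sup>+x. X w N t x \<partial>lborel) + Iq) = (\<integral>\<^sup>+x. X0 w N x \<partial>lborel) + (IG + Iq)"
    using 2 by (simp add: add_ac)
  also have "\<dots> \<le> IL + ((\<integral>\<^sup>+x. X0 w N x \<partial>lborel) + Ih)"
    using add_left_mono[OF 1] by (simp add: add_ac)
  finally show ?thesis
    using weighted_loss_finite[OF t, of w N]
    unfolding Iq_def Ih_def IL_def by (auto simp: ennreal_add_left_cancel_le)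
qed

text \<open>
  The cut-off of the conserved total mass \<open>\<Sum> n f\<^sub>n\<close>: a collision either conserves it or moves mass beyond \<open>N\<close>.
\<close>

lemma wsum_gain_le_loss: "wsum real N (\<lambda>n. G n s x) \<le> wsum real N (\<lambda>n. L n s x)"
  using collisions_le_wsum_loss[OF \<alpha>_sym, where w = real and N = N and c = "\<lambda>k. F k s x"] by (simp add: wsum_gain)

lemma mass_nonincreasing:
  assumes "0 \<le> t"
  shows "(\<integral>\<^sup>+x. X real N t x \<partial>lborel) \<le> (\<integral>\<^sup>+x. X0 real N x \<partial>lborel)"
  using weighted_mass_le[OF assms, of "\<lambda>_ _. 0" "\<lambda>_ _. 0" real N] by (simp add: wsum_gain_le_loss)

text \<open>
  Every collision reduces the number of particles by one.
\<close>

lemma collision_number_le: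
  assumes "0 \<le> t"
  shows "(\<integral>\<^sup>+s\<in>{0..t}. (\<integral>\<^sup>+x. collisions \<alpha> (\<lambda>_ _. 1) N (\<lambda>k. F k s x) \<partial>lborel) \<partial>lborel)
       \<le> (\<integral>\<^sup>+x. X0 (\<lambda>_. 1) N x \<partial>lborel)"
proof -
  have "(\<integral>\<^sup>+s\<in>{0..t}. (\<integral>\<^sup>+x. collisions \<alpha> (\<lambda>_ _. 1) N (\<lambda>k. F k s x) \<partial>lborel) \<partial>lborel)
    \<le> (\<integral>\<^sup>+x. X (\<lambda>_. 1) N t x \<partial>lborel)
      + (\<integral>\<^sup>+s\<in>{0..t}. (\<integral>\<^sup>+x. collisions \<alpha> (\<lambda>_ _. 1) N (\<lambda>k. F k s x) \<partial>lborel) \<partial>lborel)"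
    by (simp add: add_increasing)
  also have "(\<integral>\<^sup>+x. X (\<lambda>_. 1) N t x \<partial>lborel)
      + (\<integral>\<^sup>+s\<in>{0..t}. (\<integral>\<^sup>+x. collisions \<alpha> (\<lambda>_ _. 1) N (\<lambda>k. F k s x) \<partial>lborel) \<partial>lborel)
    \<le> (\<integral>\<^sup>+x. X0 (\<lambda>_. 1) N x \<partial>lborel) + (\<integral>\<^sup>+s\<in>{0..t}. (\<integral>\<^sup>+x. 0 \<partial>(lborel :: 'a measure)) \<partial>lborel)"
  proof (rule weighted_mass_le[OF assms])
    fix s x
    show "wsum (\<lambda>_. 1) N (\<lambda>n. G n s x) + collisions \<alpha> (\<lambda>_ _. 1) N (\<lambda>k. F k s x)
        \<le> wsum (\<lambda>_. 1) N (\<lambda>n. L n s x) + 0"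
      using collisions_le_wsum_loss[OF \<alpha>_sym, where w = "\<lambda>_. 1" and N = N and c = "\<lambda>k. F k s x"]
      by (simp add: wsum_gain collisions_add[symmetric])
  qed measurable
  finally show ?thesis by simp
qed

text \<open>
  The potential of the cut-off mass decreases, up to the error that \<open>p\<^sub>\<tau>\<close> in \<open>-\<Delta>\<Phi>\<^sub>e\<^sub>,\<^sub>\<tau>\<close> introduces.
\<close>

lemma potential_growth:
  assumes e: "0 < e" "e \<le> \<tau>" and t: "0 \<le> t"
  shows "potential e \<tau> (X real N t) x \<le> potential e \<tau> (X0 real N) x
      + ennreal B * (\<integral>\<^sup>+s\<in>{0..t}. heat \<tau> (X real N s) x \<partial>lborel)"
proof -
  define PL where "PL = wsum real N (\<lambda>n. \<integral>\<^sup>+s\<in>{0..t}. potential e \<tau> (L n s) x \<partial>lborel)"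
  define PG where "PG = wsum real N (\<lambda>n. \<integral>\<^sup>+s\<in>{0..t}. potential e \<tau> (G n s) x \<partial>lborel)"
  define D where "D = wsum real N (\<lambda>n. ennreal (d n) * (\<integral>\<^sup>+s\<in>{0..t}. heat \<tau> (F n s) x \<partial>lborel))"
  have bal: "wsum real N (\<lambda>n. potential e \<tau> (F n t) x)
      + wsum real N (\<lambda>n. ennreal (d n) * (\<integral>\<^sup>+s\<in>{0..t}. heat e (F n s) x \<partial>lborel)) + PL
    = wsum real N (\<lambda>n. potential e \<tau> (F0 n) x) + D + PG"
    unfolding PL_def PG_def D_def wsum_add[symmetric]
    by (rule wsum_cong) (rule mild_solution.potential_balance[OF mild e t])
  have int: "wsum real N (\<lambda>n. \<integral>\<^sup>+s\<in>{0..t}. potential e \<tau> (M n s) x \<partial>lborel)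
      = (\<integral>\<^sup>+s\<in>{0..t}. potential e \<tau> (\<lambda>y. wsum real N (\<lambda>n. M n s y)) x \<partial>lborel)"
    if [measurable]: "\<And>n. case_prod (M n) \<in> borel_measurable (borel \<Otimes>\<^sub>M (borel :: 'a measure))" for M
  proof -
    have "potential e \<tau> (\<lambda>y. wsum real N (\<lambda>n. M n s y)) x = wsum real N (\<lambda>n. potential e \<tau> (M n s) x)" for s
      by (rule potential_wsum) measurable
    then show ?thesis
      by (simp only:) (rule set_nn_integral_wsum[symmetric], measurable)
  qed
  have PG: "PG = (\<integral>\<^sup>+s\<in>{0..t}. potential e \<tau> (\<lambda>y. wsum real N (\<lambda>n. G n s y)) x \<partial>lborel)"
    unfolding PG_def by (rule int) measurable
  have PL: "PL = (\<integral>\<^sup>+s\<in>{0..t}. potential e \<tau> (\<lambda>y. wsum real N (\<lambda>n. L n s y)) x \<partial>lborel)"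
    unfolding PL_def by (rule int) measurable
  have "PG \<le> PL"
    unfolding PG PL by (intro nn_integral_mono mult_right_mono potential_mono wsum_gain_le_loss) auto
  have "PL < \<infinity>"
  proof -
    define c where "c = ennreal ((\<tau> - e) * heat_kernel e (0 :: 'a))"
    have "PL \<le> (\<integral>\<^sup>+s\<in>{0..t}. (c * (\<integral>\<^sup>+y. wsum real N (\<lambda>n. L n s y) \<partial>lborel)) \<partial>lborel)"
      unfolding PL c_def using e by (intro nn_integral_mono mult_right_mono potential_le) auto
    also have "\<dots> < \<infinity>"
      using weighted_loss_finite[OF t, of real N]
      by (simp add: set_nn_integral_cmult c_def ennreal_mult_less_top)
    finally show ?thesis .
  qed
  have "PL + wsum real N (\<lambda>n. potential e \<tau> (F n t) x)
      \<le> wsum real N (\<lambda>n. potential e \<tau> (F n t) x)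
      + wsum real N (\<lambda>n. ennreal (d n) * (\<integral>\<^sup>+s\<in>{0..t}. heat e (F n s) x \<partial>lborel)) + PL"
    by (simp add: add_ac)
  also have "\<dots> \<le> PL + (wsum real N (\<lambda>n. potential e \<tau> (F0 n) x) + D)"
    unfolding bal using \<open>PG \<le> PL\<close> by (simp add: add_ac add_left_mono)
  finally have growth: "wsum real N (\<lambda>n. potential e \<tau> (F n t) x) \<le> wsum real N (\<lambda>n. potential e \<tau> (F0 n) x) + D"
    using \<open>PL < \<infinity>\<close> by (auto simp: ennreal_add_left_cancel_le)
  have D_le: "D \<le> ennreal B * (\<integral>\<^sup>+s\<in>{0..t}. heat \<tau> (X real N s) x \<partial>lborel)"
  proof -
    have "D \<le> wsum real N (\<lambda>n. ennreal B * (\<integral>\<^sup>+s\<in>{0..t}. heat \<tau> (F n s) x \<partial>lborel))"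
      unfolding D_def wsum_def using d_le
      by (intro sum_mono mult_left_mono mult_right_mono ennreal_leI) auto
    also have "\<dots> = ennreal B * wsum real N (\<lambda>n. \<integral>\<^sup>+s\<in>{0..t}. heat \<tau> (F n s) x \<partial>lborel)"
      by (simp add: wsum_distrib_left)
    also have "wsum real N (\<lambda>n. \<integral>\<^sup>+s\<in>{0..t}. heat \<tau> (F n s) x \<partial>lborel)
        = (\<integral>\<^sup>+s\<in>{0..t}. wsum real N (\<lambda>n. heat \<tau> (F n s) x) \<partial>lborel)"
      by (rule set_nn_integral_wsum[symmetric]) measurable
    also have "(\<lambda>s. wsum real N (\<lambda>n. heat \<tau> (F n s) x)) = (\<lambda>s. heat \<tau> (X real N s) x)"
      by (intro ext heat_wsum[symmetric]) measurable
    finally show ?thesis .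
  qed
  have "potential e \<tau> (X real N t) x = wsum real N (\<lambda>n. potential e \<tau> (F n t) x)"
    "potential e \<tau> (X0 real N) x = wsum real N (\<lambda>n. potential e \<tau> (F0 n) x)"
    by (rule potential_wsum; measurable)+
  then show ?thesis
    by (simp only:) (rule order_trans[OF growth add_left_mono[OF D_le]])
qed

text \<open>
  The balance law for pairs, summed with weights \<open>w n\<close> and \<open>m\<close>. The sources enter without the semigroup, so the
  gains of all components combine and are compared with the losses before the finite losses cancel. The term
  \<open>h\<close> is the excess of gain over loss for the weight \<open>w\<close>; for the weight \<open>m\<close> there is none.
\<close>

lemma energy_growth:
  assumes e: "0 < e" "e \<le> \<tau>" and t: "0 \<le> t"
    and w: "\<And>s x. wsum w N (\<lambda>n. G n s x) \<le> wsum w N (\<lambda>n. L n s x) + h s x"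
    and [measurable]: "case_prod h \<in> borel_measurable (borel \<Otimes>\<^sub>M borel)"
  shows "wsum w N (\<lambda>n. wsum real N (\<lambda>m. ennreal (d n + d m) * (\<integral>\<^sup>+s\<in>{0..t}. overlap e (F n s) (F m s) \<partial>lborel)))
     \<le> energy e \<tau> (X0 w N) (X0 real N)
      + ennreal (2 * B) * (\<integral>\<^sup>+s\<in>{0..t}. overlap \<tau> (X w N s) (X real N s) \<partial>lborel)
      + (\<integral>\<^sup>+s\<in>{0..t}. energy e \<tau> (h s) (X real N s) \<partial>lborel)"
proof -
  let ?W = "\<lambda>c. wsum w N (\<lambda>n. wsum real N (\<lambda>m. c n m))"
  define E where "E = ?W (\<lambda>n m. ennreal (d n + d m) * (\<integral>\<^sup>+s\<in>{0..t}. overlap e (F n s) (F m s) \<partial>lborel))"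
  define D where "D = ?W (\<lambda>n m. ennreal (d n + d m) * (\<integral>\<^sup>+s\<in>{0..t}. overlap \<tau> (F n s) (F m s) \<partial>lborel))"
  define PL where "PL = ?W (\<lambda>n m. \<integral>\<^sup>+s\<in>{0..t}. (energy e \<tau> (L n s) (F m s) + energy e \<tau> (F n s) (L m s)) \<partial>lborel)"
  define PG where "PG = ?W (\<lambda>n m. \<integral>\<^sup>+s\<in>{0..t}. (energy e \<tau> (G n s) (F m s) + energy e \<tau> (F n s) (G m s)) \<partial>lborel)"
  have bal: "?W (\<lambda>n m. energy e \<tau> (F n t) (F m t)) + E + PL = ?W (\<lambda>n m. energy e \<tau> (F0 n) (F0 m)) + D + PG"
    unfolding PL_def PG_def D_def E_def wsum_add[symmetric]
  proof (intro wsum_cong)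
    fix n m :: nat assume nm: "1 \<le> n" "1 \<le> m"
    interpret N: mild_solution "d n" "F0 n" "F n" "G n" "L n" using mild[OF nm(1)] .
    interpret M: mild_solution "d m" "F0 m" "F m" "G m" "L m" using mild[OF nm(2)] .
    interpret mild_pair "d n" "F0 n" "F n" "G n" "L n" "d m" "F0 m" "F m" "G m" "L m" ..
    show "energy e \<tau> (F n t) (F m t)
        + ennreal (d n + d m) * (\<integral>\<^sup>+s\<in>{0..t}. overlap e (F n s) (F m s) \<partial>lborel)
        + (\<integral>\<^sup>+s\<in>{0..t}. (energy e \<tau> (L n s) (F m s) + energy e \<tau> (F n s) (L m s)) \<partial>lborel)
      = energy e \<tau> (F0 n) (F0 m)
        + ennreal (d n + d m) * (\<integral>\<^sup>+s\<in>{0..t}. overlap \<tau> (F n s) (F m s) \<partial>lborel)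
        + (\<integral>\<^sup>+s\<in>{0..t}. (energy e \<tau> (G n s) (F m s) + energy e \<tau> (F n s) (G m s)) \<partial>lborel)"
      by (rule energy_balance[OF e t])
  qed
  have dbl: "?W (\<lambda>n m. energy e \<tau> (g n) (k m)) = energy e \<tau> (\<lambda>y. wsum w N (\<lambda>n. g n y)) (\<lambda>y. wsum real N (\<lambda>n. k n y))"
    if [measurable]: "\<And>n. g n \<in> borel_measurable borel" "\<And>n. k n \<in> borel_measurable (borel :: 'a measure)" for g k
    by (simp add: energy_wsum_left energy_wsum_right)
  have int: "?W (\<lambda>n m. \<integral>\<^sup>+s\<in>{0..t}. q n m s \<partial>lborel) = (\<integral>\<^sup>+s\<in>{0..t}. ?W (\<lambda>n m. q n m s) \<partial>lborel)"
    if [measurable]: "\<And>n m. q n m \<in> borel_measurable borel" for q :: "nat \<Rightarrow> nat \<Rightarrow> real \<Rightarrow> ennreal"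
  proof -
    have "wsum real N (\<lambda>m. \<integral>\<^sup>+s\<in>{0..t}. q n m s \<partial>lborel) = (\<integral>\<^sup>+s\<in>{0..t}. wsum real N (\<lambda>m. q n m s) \<partial>lborel)" for n
      by (rule set_nn_integral_wsum[symmetric]) measurable
    then show ?thesis
      by (simp only:) (rule set_nn_integral_wsum[symmetric], measurable)
  qed
  have split: "?W (\<lambda>n m. \<integral>\<^sup>+s\<in>{0..t}. (energy e \<tau> (M n s) (F m s) + energy e \<tau> (F n s) (M m s)) \<partial>lborel)
      = (\<integral>\<^sup>+s\<in>{0..t}. (energy e \<tau> (\<lambda>y. wsum w N (\<lambda>n. M n s y)) (X real N s)
            + energy e \<tau> (X w N s) (\<lambda>y. wsum real N (\<lambda>n. M n s y))) \<partial>lborel)"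
    if [measurable]: "\<And>n. case_prod (M n) \<in> borel_measurable (borel \<Otimes>\<^sub>M (borel :: 'a measure))" for M
  proof -
    have "?W (\<lambda>n m. \<integral>\<^sup>+s\<in>{0..t}. (energy e \<tau> (M n s) (F m s) + energy e \<tau> (F n s) (M m s)) \<partial>lborel)
      = (\<integral>\<^sup>+s\<in>{0..t}. ?W (\<lambda>n m. energy e \<tau> (M n s) (F m s) + energy e \<tau> (F n s) (M m s)) \<partial>lborel)"
      by (rule int) measurable
    also have "\<dots> = (\<integral>\<^sup>+s\<in>{0..t}. (?W (\<lambda>n m. energy e \<tau> (M n s) (F m s)) + ?W (\<lambda>n m. energy e \<tau> (F n s) (M m s))) \<partial>lborel)"
      by (simp only: wsum_add)
    also have "\<dots> = (\<integral>\<^sup>+s\<in>{0..t}. (energy e \<tau> (\<lambda>y. wsum w N (\<lambda>n. M n s y)) (X real N s)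
            + energy e \<tau> (X w N s) (\<lambda>y. wsum real N (\<lambda>n. M n s y))) \<partial>lborel)"
      by (subst (1 2) dbl) measurable
    finally show ?thesis .
  qed
  have PG: "PG = (\<integral>\<^sup>+s\<in>{0..t}. (energy e \<tau> (\<lambda>y. wsum w N (\<lambda>n. G n s y)) (X real N s)
            + energy e \<tau> (X w N s) (\<lambda>y. wsum real N (\<lambda>n. G n s y))) \<partial>lborel)"
    unfolding PG_def by (rule split) measurable
  have PL: "PL = (\<integral>\<^sup>+s\<in>{0..t}. (energy e \<tau> (\<lambda>y. wsum w N (\<lambda>n. L n s y)) (X real N s)
            + energy e \<tau> (X w N s) (\<lambda>y. wsum real N (\<lambda>n. L n s y))) \<partial>lborel)"
    unfolding PL_def by (rule split) measurable
  define Eh where "Eh = (\<integral>\<^sup>+s\<in>{0..t}. energy e \<tau> (h s) (X real N s) \<partial>lborel)"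
  have "PG \<le> (\<integral>\<^sup>+s\<in>{0..t}. ((energy e \<tau> (\<lambda>y. wsum w N (\<lambda>n. L n s y)) (X real N s)
            + energy e \<tau> (X w N s) (\<lambda>y. wsum real N (\<lambda>n. L n s y))) + energy e \<tau> (h s) (X real N s)) \<partial>lborel)"
    unfolding PG
  proof (intro nn_integral_mono mult_right_mono)
    fix s
    have "energy e \<tau> (\<lambda>y. wsum w N (\<lambda>n. G n s y)) (X real N s)
        \<le> energy e \<tau> (\<lambda>y. wsum w N (\<lambda>n. L n s y) + h s y) (X real N s)"
      by (intro energy_mono w) auto
    also have "\<dots> = energy e \<tau> (\<lambda>y. wsum w N (\<lambda>n. L n s y)) (X real N s) + energy e \<tau> (h s) (X real N s)"
      unfolding energy_def by (simp add: distrib_right nn_integral_add)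
    finally have 1: "energy e \<tau> (\<lambda>y. wsum w N (\<lambda>n. G n s y)) (X real N s)
        \<le> energy e \<tau> (\<lambda>y. wsum w N (\<lambda>n. L n s y)) (X real N s) + energy e \<tau> (h s) (X real N s)" .
    have 2: "energy e \<tau> (X w N s) (\<lambda>y. wsum real N (\<lambda>n. G n s y))
        \<le> energy e \<tau> (X w N s) (\<lambda>y. wsum real N (\<lambda>n. L n s y))"
      by (intro energy_mono wsum_gain_le_loss) auto
    show "energy e \<tau> (\<lambda>y. wsum w N (\<lambda>n. G n s y)) (X real N s)
            + energy e \<tau> (X w N s) (\<lambda>y. wsum real N (\<lambda>n. G n s y))
        \<le> (energy e \<tau> (\<lambda>y. wsum w N (\<lambda>n. L n s y)) (X real N s)
            + energy e \<tau> (X w N s) (\<lambda>y. wsum real N (\<lambda>n. L n s y))) + energy e \<tau> (h s) (X real N s)"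
      using add_mono[OF 1 2] by (simp add: add_ac)
  qed simp
  also have "\<dots> = PL + Eh"
    unfolding PL Eh_def by (simp add: distrib_right nn_integral_add)
  finally have "PG \<le> PL + Eh" .
  have "PL < \<infinity>"
    unfolding PL_def
  proof (intro wsum_less_top)
    fix n m :: nat assume nm: "1 \<le> n" "1 \<le> m"
    interpret N: mild_solution "d n" "F0 n" "F n" "G n" "L n" using mild[OF nm(1)] .
    interpret M: mild_solution "d m" "F0 m" "F m" "G m" "L m" using mild[OF nm(2)] .
    define c where "c = ennreal ((\<tau> - e) * heat_kernel e (0 :: 'a))"
    have "(\<integral>\<^sup>+s\<in>{0..t}. (energy e \<tau> (L n s) (F m s) + energy e \<tau> (F n s) (L m s)) \<partial>lborel)
      \<le> (\<integral>\<^sup>+s\<in>{0..t}. (c * (M.mass_bound t * (\<integral>\<^sup>+x. L n s x \<partial>lborel))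
                     + c * (N.mass_bound t * (\<integral>\<^sup>+x. L m s x \<partial>lborel))) \<partial>lborel)"
    proof (rule nn_integral_mono)
      fix s :: real
      show "(energy e \<tau> (L n s) (F m s) + energy e \<tau> (F n s) (L m s)) * indicator {0..t} s
        \<le> (c * (M.mass_bound t * (\<integral>\<^sup>+x. L n s x \<partial>lborel))
                     + c * (N.mass_bound t * (\<integral>\<^sup>+x. L m s x \<partial>lborel))) * indicator {0..t} s"
      proof (cases "s \<in> {0..t}")
        case True
        then have s: "0 \<le> s" "s \<le> t" by auto
        have "energy e \<tau> (L n s) (F m s) \<le> c * ((\<integral>\<^sup>+x. L n s x \<partial>lborel) * (\<integral>\<^sup>+x. F m s x \<partial>lborel))"
          unfolding c_def using e by (intro energy_le) auto
        also have "\<dots> \<le> c * ((\<integral>\<^sup>+x. L n s x \<partial>lborel) * M.mass_bound t)"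
          by (intro mult_left_mono M.mass_le s) auto
        finally have 1: "energy e \<tau> (L n s) (F m s) \<le> c * (M.mass_bound t * (\<integral>\<^sup>+x. L n s x \<partial>lborel))"
          by (simp add: mult_ac)
        have "energy e \<tau> (F n s) (L m s) \<le> c * ((\<integral>\<^sup>+x. F n s x \<partial>lborel) * (\<integral>\<^sup>+x. L m s x \<partial>lborel))"
          unfolding c_def using e by (intro energy_le) auto
        also have "\<dots> \<le> c * (N.mass_bound t * (\<integral>\<^sup>+x. L m s x \<partial>lborel))"
          by (intro mult_left_mono mult_right_mono N.mass_le s) auto
        finally show ?thesis
          using add_mono[OF 1] True by simp
      qed simp
    qed
    also have "\<dots> < \<infinity>"
      using N.finite_R[of t] M.finite_R[of t] N.mass_bound_finite[of t] M.mass_bound_finite[of t]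
      unfolding c_def
      by (simp add: distrib_right nn_integral_add mult.assoc nn_integral_cmult ennreal_mult_less_top)
    finally show "(\<integral>\<^sup>+s\<in>{0..t}. (energy e \<tau> (L n s) (F m s) + energy e \<tau> (F n s) (L m s)) \<partial>lborel) < \<infinity>" .
  qed
  have "PL + E \<le> ?W (\<lambda>n m. energy e \<tau> (F n t) (F m t)) + E + PL"
    by (simp add: add_ac add_increasing)
  also have "\<dots> \<le> PL + (?W (\<lambda>n m. energy e \<tau> (F0 n) (F0 m)) + D + Eh)"
    unfolding bal using add_left_mono[OF \<open>PG \<le> PL + Eh\<close>, of "?W (\<lambda>n m. energy e \<tau> (F0 n) (F0 m)) + D"]
    by (simp add: add_ac)
  finally have "E \<le> ?W (\<lambda>n m. energy e \<tau> (F0 n) (F0 m)) + D + Eh"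
    using \<open>PL < \<infinity>\<close> by (auto simp: ennreal_add_left_cancel_le)
  also have "?W (\<lambda>n m. energy e \<tau> (F0 n) (F0 m)) = energy e \<tau> (X0 w N) (X0 real N)"
    by (rule dbl) measurable
  also have "D \<le> ennreal (2 * B) * (\<integral>\<^sup>+s\<in>{0..t}. overlap \<tau> (X w N s) (X real N s) \<partial>lborel)"
  proof -
    have "D \<le> ?W (\<lambda>n m. ennreal (2 * B) * (\<integral>\<^sup>+s\<in>{0..t}. overlap \<tau> (F n s) (F m s) \<partial>lborel))"
      unfolding D_def wsum_def
    proof (intro sum_mono mult_left_mono mult_right_mono ennreal_leI)
      fix n m assume "n \<in> {1..N}" "m \<in> {1..N}"
      then show "d n + d m \<le> 2 * B" using d_le[of n] d_le[of m] by simp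
    qed auto
    also have "\<dots> = ennreal (2 * B) * ?W (\<lambda>n m. \<integral>\<^sup>+s\<in>{0..t}. overlap \<tau> (F n s) (F m s) \<partial>lborel)"
      by (simp add: wsum_distrib_left)
    also have "?W (\<lambda>n m. \<integral>\<^sup>+s\<in>{0..t}. overlap \<tau> (F n s) (F m s) \<partial>lborel)
        = (\<integral>\<^sup>+s\<in>{0..t}. ?W (\<lambda>n m. overlap \<tau> (F n s) (F m s)) \<partial>lborel)"
      by (rule int) measurable
    also have "(\<lambda>s. ?W (\<lambda>n m. overlap \<tau> (F n s) (F m s))) = (\<lambda>s. overlap \<tau> (X w N s) (X real N s))"
      by (intro ext) (simp add: overlap_wsum_left overlap_wsum_right)
    finally show ?thesis .
  qed
  finally show ?thesis
    unfolding E_def Eh_def by (simp add: add_right_mono add_left_mono)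
qed

end

section \<open>Coagulation against dissipation\<close>

text \<open>
  For the larger of the two numbers, say \<open>x\<close>, the mean value theorem bounds \<open>(x + y) powr a - x powr a\<close> by
  \<open>y a (2 x) powr (a - 1)\<close>.
\<close>

lemma powr_add_le:
  fixes x y a :: real
  assumes "0 < x" "0 < y" "1 \<le> a"
  shows "(x + y) powr a \<le> x powr a + y powr a
      + a * 2 powr (a - 1) * (x powr (a - 1) * y + y powr (a - 1) * x)"
proof -
  have one_sided: "(u + v) powr a \<le> u powr a + a * 2 powr (a - 1) * (u powr (a - 1) * v)"
    if uv: "0 < v" "v \<le> u" for u v :: real
  proof -
    have deriv: "((\<lambda>z. z powr a) has_real_derivative a * z powr (a - 1)) (at z)" if "u \<le> z" for z
      using that uv by (intro has_real_derivative_powr) auto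
    obtain z where z: "u < z" "z < u + v"
      "(u + v) powr a - u powr a = (u + v - u) * (a * z powr (a - 1))"
      using MVT2[of u "u + v" "\<lambda>z. z powr a" "\<lambda>z. a * z powr (a - 1)", OF _ deriv] uv
      by auto
    have "z powr (a - 1) \<le> (2 * u) powr (a - 1)"
      using z uv assms by (intro powr_mono2) auto
    also have "\<dots> = 2 powr (a - 1) * u powr (a - 1)"
      using uv by (simp add: powr_mult)
    finally have "v * (a * z powr (a - 1)) \<le> v * (a * (2 powr (a - 1) * u powr (a - 1)))"
      using uv assms by (intro mult_left_mono) auto
    then show ?thesis using z(3) by (simp add: mult_ac)
  qed
  show ?thesis
  proof (cases "y \<le> x")
    case True
    have "0 \<le> y powr a" "0 \<le> a * 2 powr (a - 1) * (y powr (a - 1) * x)"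
      using assms by auto
    with one_sided[OF assms(2) True] show ?thesis
      unfolding distrib_left by linarith
  next
    case False
    then have "x \<le> y" by simp
    have "0 \<le> x powr a" "0 \<le> a * 2 powr (a - 1) * (x powr (a - 1) * y)"
      using assms by auto
    with one_sided[OF assms(1) \<open>x \<le> y\<close>] show ?thesis
      unfolding distrib_left add.commute[of x y] by linarith
  qed
qed

text \<open>
  After expansion this is \<open>0 \<le> x y (x powr (a - 2) - y powr (a - 2)) (x - y)\<close>, and both factors have the same sign
  because \<open>a \<ge> 2\<close>.
\<close>

lemma powr_cross_le:
  fixes x y a :: real
  assumes "0 < x" "0 < y" "2 \<le> a"
  shows "(x powr (a - 1) * y + y powr (a - 1) * x) * (x + y) \<le> 2 * (x powr a * y + y powr a * x)"
proof -
  have p: "x powr a = x powr (a - 2) * x * x" "x powr (a - 1) = x powr (a - 2) * x"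
    "y powr a = y powr (a - 2) * y * y" "y powr (a - 1) = y powr (a - 2) * y"
    using assms powr_add[of x "a - 2" 2] powr_add[of x "a - 2" 1] powr_add[of y "a - 2" 2] powr_add[of y "a - 2" 1]
    by (simp_all add: power2_eq_square)
  have "0 \<le> (x powr (a - 2) - y powr (a - 2)) * (x - y)"
  proof (cases "y \<le> x")
    case True
    then show ?thesis using assms by (intro mult_nonneg_nonneg) (auto intro: powr_mono2)
  next
    case False
    then show ?thesis using assms by (intro mult_nonpos_nonpos) (auto intro: powr_mono2)
  qed
  then have "0 \<le> x * y * ((x powr (a - 2) - y powr (a - 2)) * (x - y))"
    using assms by (intro mult_nonneg_nonneg[of "x * y"]) simp_all
  then show ?thesis unfolding p by (simp add: algebra_simps)
qed

lemma sum_liminf_le: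
  fixes b :: "'i \<Rightarrow> nat \<Rightarrow> ennreal"
  assumes "finite I"
  shows "(\<Sum>i\<in>I. liminf (b i)) \<le> liminf (\<lambda>k. \<Sum>i\<in>I. b i k)"
  using nn_integral_liminf[of "\<lambda>k i. b i k" "count_space I"] assms
  by (simp add: nn_integral_count_space_finite)

lemma liminf_cmult_ennreal:
  fixes u :: "nat \<Rightarrow> ennreal"
  assumes "c < \<infinity>"
  shows "liminf (\<lambda>k. c * u k) = c * liminf u"
  using assms by (intro Liminf_compose_continuous_mono)
    (auto intro!: monoI mult_left_mono ennreal_continuous_on_cmult)

lemma wsum_liminf_le: "wsum w N (\<lambda>n. liminf (b n)) \<le> liminf (\<lambda>k. wsum w N (\<lambda>n. b n k))"
proof -
  have "wsum w N (\<lambda>n. liminf (b n)) \<le> (\<Sum>n = 1..N. liminf (\<lambda>k. ennreal (w n) * b n k))"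
    unfolding wsum_def by (intro sum_mono) (simp add: liminf_cmult_ennreal)
  also have "\<dots> \<le> liminf (\<lambda>k. wsum w N (\<lambda>n. b n k))"
    unfolding wsum_def by (rule sum_liminf_le) simp
  finally show ?thesis .
qed

lemma wsum_mono: "(\<And>n. 1 \<le> n \<Longrightarrow> c n \<le> c' n) \<Longrightarrow> wsum w N c \<le> wsum w N c'"
  unfolding wsum_def by (intro sum_mono mult_left_mono) auto

lemma wsum_mono_weight: "(\<And>n. 1 \<le> n \<Longrightarrow> w n \<le> w' n) \<Longrightarrow> wsum w N c \<le> wsum w' N c"
  unfolding wsum_def by (intro sum_mono mult_right_mono ennreal_leI) auto

locale moment_estimate = coagulation_diffusion d \<alpha> F0 F B
  for d \<alpha> and F0 :: "nat \<Rightarrow> 'a::euclidean_space \<Rightarrow> ennreal" and F B +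
  fixes a :: real
  assumes a: "2 \<le> a"
begin

text \<open>
  The weight of \<open>X\<^sub>a\<close>, the weight of \<open>Yhat\<^sub>a\<^sub>-\<^sub>1\<close> per collision rate, and the constant of \<open>powr_add_le\<close>. With
  them, \<open>Yd\<close> is half of the cut-off \<open>Y\<^sub>a\<^sub>-\<^sub>1\<close>: by symmetry the weight \<open>n\<^sup>a m + n m\<^sup>a\<close> may be replaced by \<open>2 n\<^sup>a m\<close>.
\<close>

definition "w n = real n powr a" for n :: nat
definition "r j k = real j powr (a - 1) * real k + real k powr (a - 1) * real j" for j k :: nat
definition "Ca = a * 2 powr (a - 1)"
abbreviation "Yh N s x \<equiv> collisions \<alpha> r N (\<lambda>k. F k s x)"
abbreviation "Yd N s x \<equiv> wsum w N (\<lambda>n. wsum real N (\<lambda>m. ennreal (d n + d m) * (F n s x * F m s x)))"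

lemma Ca_pos: "0 < Ca"
  using a by (simp add: Ca_def)

lemma r_nonneg: "0 \<le> r j k"
  by (simp add: r_def)

lemma wsum_gain_le_loss_moment:
  "wsum w N (\<lambda>n. G n s x) \<le> wsum w N (\<lambda>n. L n s x) + ennreal Ca * Yh N s x"
proof -
  have "wsum w N (\<lambda>n. G n s x) \<le> collisions \<alpha> (\<lambda>j k. (w j + w k) + Ca * r j k) N (\<lambda>k. F k s x)"
    unfolding wsum_gain
  proof (rule collisions_mono)
    fix j k assume "(j, k) \<in> pairs N"
    then show "w (j + k) \<le> (w j + w k) + Ca * r j k"
      using powr_add_le[of "real j" "real k" a] a
      by (auto simp: mem_pairs_iff w_def r_def Ca_def)
  qed
  also have "\<dots> = collisions \<alpha> (\<lambda>j k. w j + w k) N (\<lambda>k. F k s x) + ennreal Ca * Yh N s x"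
    using Ca_pos r_nonneg by (subst collisions_add) (auto simp: w_def collisions_cmult)
  also have "\<dots> \<le> wsum w N (\<lambda>n. L n s x) + ennreal Ca * Yh N s x"
    by (intro add_right_mono collisions_le_wsum_loss \<alpha>_sym) (auto simp: w_def)
  finally show ?thesis .
qed

lemma moment_growth:
  assumes "0 \<le> t"
  shows "(\<integral>\<^sup>+x. X w N t x \<partial>lborel) \<le> (\<integral>\<^sup>+x. X0 w N x \<partial>lborel)
      + ennreal Ca * (\<integral>\<^sup>+s\<in>{0..t}. (\<integral>\<^sup>+x. Yh N s x \<partial>lborel) \<partial>lborel)"
proof -
  have "(\<integral>\<^sup>+x. X w N t x \<partial>lborel) + (\<integral>\<^sup>+s\<in>{0..t}. (\<integral>\<^sup>+x. 0 \<partial>(lborel :: 'a measure)) \<partial>lborel)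
      \<le> (\<integral>\<^sup>+x. X0 w N x \<partial>lborel) + (\<integral>\<^sup>+s\<in>{0..t}. (\<integral>\<^sup>+x. ennreal Ca * Yh N s x \<partial>lborel) \<partial>lborel)"
    using wsum_gain_le_loss_moment by (intro weighted_mass_le[OF assms]) auto
  then show ?thesis by (simp add: nn_integral_cmult set_nn_integral_cmult)
qed

lemma Yd_symmetric:
  "(\<Sum>j = 1..N. \<Sum>k = 1..N. ennreal (w j * real k + w k * real j) * (ennreal (d j + d k) * (F j s x * F k s x)))
     = Yd N s x + Yd N s x"
proof -
  define D where "D j k = ennreal (d j + d k) * (F j s x * F k s x)" for j k
  have "(\<Sum>j = 1..N. \<Sum>k = 1..N. ennreal (w j * real k + w k * real j) * D j k)
      = (\<Sum>j = 1..N. \<Sum>k = 1..N. ennreal (w j) * ennreal (real k) * D j k)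
      + (\<Sum>j = 1..N. \<Sum>k = 1..N. ennreal (w k) * ennreal (real j) * D j k)"
    by (simp add: sum.distrib[symmetric] distrib_right[symmetric]
      ennreal_mult[symmetric] w_def flip: ennreal_plus)
  also have "(\<Sum>j = 1..N. \<Sum>k = 1..N. ennreal (w k) * ennreal (real j) * D j k)
      = (\<Sum>j = 1..N. \<Sum>k = 1..N. ennreal (w j) * ennreal (real k) * D j k)"
    by (subst sum.swap) (simp add: D_def mult_ac add_ac)
  also have "(\<Sum>j = 1..N. \<Sum>k = 1..N. ennreal (w j) * ennreal (real k) * D j k) = Yd N s x"
    unfolding wsum_def D_def by (simp add: sum_distrib_left mult.assoc)
  finally show ?thesis unfolding D_def .
qed

text \<open>
  Heavy pairs are subject to the hypothesis on \<open>\<alpha>\<close>, which trades \<open>\<alpha>\<close> for a small multiple of the dissipation. For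
  light pairs the weight \<open>r\<close> is bounded, so they are controlled by the number of collisions.
\<close>

lemma collisions_split:
  assumes \<delta>: "0 \<le> \<delta>" and k0: "0 \<le> k0"
    and \<alpha>_le: "\<And>n m. n \<ge> 1 \<Longrightarrow> m \<ge> 1 \<Longrightarrow> k0 < real (n + m) \<Longrightarrow> \<alpha> n m \<le> \<delta> * real (n + m) * (d n + d m)"
  shows "Yh N s x \<le> ennreal (4 * \<delta>) * Yd N s x
      + ennreal (2 * k0 powr a) * collisions \<alpha> (\<lambda>_ _. 1) N (\<lambda>k. F k s x)"
proof -
  define D where "D j k = ennreal (d j + d k) * (F j s x * F k s x)" for j k
  have term_le: "ennreal (r j k) * (ennreal (\<alpha> j k) * F j s x * F k s x)
      \<le> ennreal (2 * \<delta>) * (ennreal (w j * real k + w k * real j) * D j k)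
        + ennreal (2 * k0 powr a) * (ennreal (\<alpha> j k) * F j s x * F k s x)"
    if jk: "1 \<le> j" "1 \<le> k" for j k
  proof (cases "k0 < real (j + k)")
    case True
    have d: "0 \<le> d j + d k" using d_nonneg jk by simp
    have "r j k * \<alpha> j k \<le> r j k * (\<delta> * real (j + k) * (d j + d k))"
      by (intro mult_left_mono \<alpha>_le jk True r_nonneg)
    also have "\<dots> = \<delta> * (d j + d k) * (r j k * real (j + k))"
      by simp
    also have "\<dots> \<le> \<delta> * (d j + d k) * (2 * (w j * real k + w k * real j))"
      using powr_cross_le[of "real j" "real k" a] jk a \<delta> d
      by (intro mult_left_mono mult_nonneg_nonneg) (auto simp: r_def w_def)
    finally have "ennreal (r j k * \<alpha> j k) \<le> ennreal (2 * \<delta> * ((w j * real k + w k * real j) * (d j + d k)))"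
      by (intro ennreal_leI) (simp add: mult_ac)
    then have "ennreal (r j k * \<alpha> j k) * (F j s x * F k s x)
        \<le> ennreal (2 * \<delta> * ((w j * real k + w k * real j) * (d j + d k))) * (F j s x * F k s x)"
      by (intro mult_right_mono) auto
    moreover have "ennreal (2 * \<delta> * ((w j * real k + w k * real j) * (d j + d k))) * (F j s x * F k s x)
        = ennreal (2 * \<delta>) * (ennreal (w j * real k + w k * real j) * D j k)"
      using \<delta> d by (simp add: D_def ennreal_mult mult.assoc w_def)
    moreover have "ennreal (r j k * \<alpha> j k) * (F j s x * F k s x)
        = ennreal (r j k) * (ennreal (\<alpha> j k) * F j s x * F k s x)"
      using \<alpha>_nonneg[OF jk] r_nonneg[of j k] by (simp add: ennreal_mult mult.assoc)
    ultimately show ?thesis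
      by (simp add: add_increasing2)
  next
    case False
    have "r j k \<le> 2 * k0 powr a"
    proof -
      have le: "real j \<le> k0" "real k \<le> k0" using False by auto
      then have "0 < k0" using jk by simp
      \<comment> \<open>Both masses are at most \<open>k0\<close>, and \<open>r\<close> is homogeneous of degree \<open>a\<close>.\<close>
      have "u powr (a - 1) * v \<le> k0 powr a" if "0 \<le> u" "u \<le> k0" "0 \<le> v" "v \<le> k0" for u v
      proof -
        have "u powr (a - 1) * v \<le> k0 powr (a - 1) * k0 powr 1"
          using that a \<open>0 < k0\<close> by (intro mult_mono powr_mono2) auto
        also have "\<dots> = k0 powr a" by (subst powr_add[symmetric]) simp
        finally show ?thesis .
      qed
      from this[of "real j" "real k"] this[of "real k" "real j"] le show ?thesis
        unfolding r_def by simp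
    qed
    then have "ennreal (r j k) * (ennreal (\<alpha> j k) * F j s x * F k s x)
      \<le> ennreal (2 * k0 powr a) * (ennreal (\<alpha> j k) * F j s x * F k s x)"
      by (simp add: mult_right_mono ennreal_leI)
    then show ?thesis by (rule order_trans) simp
  qed
  have "Yh N s x \<le> (\<Sum>(j, k)\<in>pairs N. ennreal (2 * \<delta>) * (ennreal (w j * real k + w k * real j) * D j k)
        + ennreal (2 * k0 powr a) * (ennreal (\<alpha> j k) * F j s x * F k s x))"
    unfolding collisions_def by (intro sum_mono) (auto simp: mem_pairs_iff intro!: term_le)
  also have "\<dots> = ennreal (2 * \<delta>) * (\<Sum>(j, k)\<in>pairs N. ennreal (w j * real k + w k * real j) * D j k)
      + ennreal (2 * k0 powr a) * collisions \<alpha> (\<lambda>_ _. 1) N (\<lambda>k. F k s x)"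
    by (simp add: sum.distrib sum_distrib_left collisions_def split_beta)
  also have "(\<Sum>(j, k)\<in>pairs N. ennreal (w j * real k + w k * real j) * D j k)
      \<le> (\<Sum>(j, k)\<in>{1..N} \<times> {1..N}. ennreal (w j * real k + w k * real j) * D j k)"
    by (intro sum_mono2) (auto simp: mem_pairs_iff)
  also have "\<dots> = Yd N s x + Yd N s x"
    unfolding Yd_symmetric[symmetric] D_def by (simp add: sum.cartesian_product)
  finally have "Yh N s x \<le> ennreal (2 * \<delta>) * (Yd N s x + Yd N s x)
      + ennreal (2 * k0 powr a) * collisions \<alpha> (\<lambda>_ _. 1) N (\<lambda>k. F k s x)"
    by (simp add: mult_left_mono add_right_mono)
  moreover have "ennreal (2 * \<delta>) * (Yd N s x + Yd N s x) = ennreal (4 * \<delta>) * Yd N s x"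
  proof -
    have "ennreal (4 * \<delta>) = ennreal (2 * \<delta>) + ennreal (2 * \<delta>)"
      using \<delta> by (simp flip: ennreal_plus)
    then show ?thesis by (simp add: distrib_left distrib_right)
  qed
  ultimately show ?thesis by simp
qed

text \<open>
  This bound depends on \<open>N\<close>; it only serves to show that the quantities to be absorbed are finite.
\<close>

lemma collisions_crude: "Yh N s x \<le> ennreal (2 * real N powr a) * collisions \<alpha> (\<lambda>_ _. 1) N (\<lambda>k. F k s x)"
proof -
  have "collisions \<alpha> r N (\<lambda>k. F k s x) \<le> collisions \<alpha> (\<lambda>_ _. 2 * real N powr a * 1) N (\<lambda>k. F k s x)"
  proof (rule collisions_mono)
    fix j k assume jk: "(j, k) \<in> pairs N"
    have "u powr (a - 1) * v \<le> real N powr a" if "0 \<le> u" "u \<le> real N" "0 \<le> v" "v \<le> real N" "0 < real N" for u v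
    proof -
      have "u powr (a - 1) * v \<le> real N powr (a - 1) * real N powr 1"
        using that a by (intro mult_mono powr_mono2) auto
      also have "\<dots> = real N powr a" by (subst powr_add[symmetric]) simp
      finally show ?thesis .
    qed
    from this[of "real j" "real k"] this[of "real k" "real j"] jk
    show "r j k \<le> 2 * real N powr a * 1" by (simp add: r_def mem_pairs_iff)
  qed
  also have "\<dots> = ennreal (2 * real N powr a) * collisions \<alpha> (\<lambda>_ _. 1) N (\<lambda>k. F k s x)"
    by (rule collisions_cmult) simp
  finally show ?thesis .
qed

end

section \<open>Bounds uniform in the cut-off\<close>

context moment_estimate begin

text \<open>
  With \<open>y\<close> and \<open>h\<close> for the space-time integrals of the cut-off \<open>Y\<close> (halved) and \<open>Yhat\<close>, the growth of the energy
  gives \<open>y \<le> K1 + K2 h\<close>, and the hypothesis on \<open>\<alpha>\<close> with \<open>\<delta> = 1 / (8 K2)\<close> gives \<open>h \<le> y / (2 K2) + M A\<close>. As both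
  are finite, \<open>y \<le> 2 (K1 + K2 M A)\<close>. The constants involve the time span only through \<open>\<kappa>\<close>.
\<close>

lemma truncated_moment_bounds:
  fixes A T \<tau> \<kappa> c k0 :: real
  assumes A: "0 < A" and B: "0 \<le> B" and \<kappa>: "0 \<le> \<kappa>" and c: "0 < c" and T: "0 \<le> T" and \<tau>: "1 \<le> \<tau>" and k0: "0 \<le> k0"
    and kernel: "T * heat_kernel \<tau> (0 :: 'a) \<le> \<kappa>"
    and pot: "\<And>e (g :: 'a \<Rightarrow> ennreal) x. 0 < e \<Longrightarrow> g \<in> borel_measurable borel \<Longrightarrow>
        potential e \<tau> g x \<le> ennreal c * ((\<integral>\<^sup>+y. g y * ennreal (phi0 (x - y)) \<partial>lborel) + (\<integral>\<^sup>+y. g y \<partial>lborel))"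
    and I1: "(\<integral>\<^sup>+x. X0 w N x * (\<integral>\<^sup>+y. X0 real N y * ennreal (phi0 (x - y)) \<partial>lborel) \<partial>lborel) \<le> ennreal A"
    and I2: "AE x in lborel. (\<integral>\<^sup>+y. X0 real N y * ennreal (phi0 (x - y)) \<partial>lborel) \<le> ennreal A"
    and I3: "(\<integral>\<^sup>+x. X0 w N x \<partial>lborel) \<le> ennreal A"
    and \<Psi>: "\<Psi> = 2 * c * A + B * \<kappa> * A"
    and K1: "K1 = c * (A + A * A) + 2 * B * \<kappa> * A * A"
    and K2: "K2 = Ca * \<Psi> + 2 * B * \<kappa> * A * Ca + 1"
    and M: "M = 2 * k0 powr a"
    and Cy: "Cy = 2 * (K1 + K2 * M * A)"
    and \<alpha>_le: "\<And>n m. n \<ge> 1 \<Longrightarrow> m \<ge> 1 \<Longrightarrow> k0 < real (n + m) \<Longrightarrow>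
        \<alpha> n m \<le> 1 / (8 * K2) * real (n + m) * (d n + d m)"
  shows "(\<integral>\<^sup>+s\<in>{0..T}. (\<integral>\<^sup>+x. Yd N s x \<partial>lborel) \<partial>lborel) \<le> ennreal Cy"
    and "(\<integral>\<^sup>+s\<in>{0..T}. (\<integral>\<^sup>+x. Yh N s x \<partial>lborel) \<partial>lborel) \<le> ennreal (Cy + M * A)"
    and "0 \<le> t \<Longrightarrow> t \<le> T \<Longrightarrow> (\<integral>\<^sup>+x. X w N t x \<partial>lborel) \<le> ennreal (A + Ca * (Cy + M * A))"
proof -
  have \<Psi>_nonneg: "0 \<le> \<Psi>" using A B \<kappa> c by (simp add: \<Psi>)
  have K1_nonneg: "0 \<le> K1" using A B \<kappa> c by (simp add: K1)
  have K2_ge: "1 \<le> K2" using A B \<kappa> \<Psi>_nonneg Ca_pos by (simp add: K2)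
  have M_nonneg: "0 \<le> M" by (simp add: M)
  define yh where "yh = (\<integral>\<^sup>+s\<in>{0..T}. (\<integral>\<^sup>+x. Yh N s x \<partial>lborel) \<partial>lborel)"
  define y where "y = (\<integral>\<^sup>+s\<in>{0..T}. (\<integral>\<^sup>+x. Yd N s x \<partial>lborel) \<partial>lborel)"
  define q where "q = (\<integral>\<^sup>+s\<in>{0..T}. (\<integral>\<^sup>+x. collisions \<alpha> (\<lambda>_ _. 1) N (\<lambda>k. F k s x) \<partial>lborel) \<partial>lborel)"
  have weights: "real n \<le> w n" "1 \<le> w n" if "1 \<le> n" for n
  proof -
    have "real n powr 1 \<le> real n powr a" using that a by (intro powr_mono) auto
    then show "real n \<le> w n" using that by (simp add: w_def)
    then show "1 \<le> w n" using that by linarith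
  qed
  have V0: "(\<integral>\<^sup>+x. X0 real N x \<partial>lborel) \<le> ennreal A"
    by (rule order_trans[OF nn_integral_mono I3]) (rule wsum_mono_weight[OF weights(1)])
  have V: "(\<integral>\<^sup>+x. X real N s x \<partial>lborel) \<le> ennreal A" if "0 \<le> s" for s
    using mass_nonincreasing[OF that, of N] V0 by (rule order_trans)
  have q: "q \<le> ennreal A"
    unfolding q_def
    by (rule order_trans[OF collision_number_le[OF T] order_trans[OF nn_integral_mono I3]])
      (rule wsum_mono_weight[OF weights(2)])

  \<comment> \<open>Finiteness, with a bound that depends on \<open>N\<close>; it makes the absorption at the end possible.\<close>
  have "yh \<le> (\<integral>\<^sup>+s\<in>{0..T}. (\<integral>\<^sup>+x. ennreal (2 * real N powr a) * collisions \<alpha> (\<lambda>_ _. 1) N (\<lambda>k. F k s x) \<partial>lborel) \<partial>lborel)"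
    unfolding yh_def by (intro nn_integral_mono mult_right_mono collisions_crude) auto
  also have "\<dots> = ennreal (2 * real N powr a) * q"
    unfolding q_def by (simp add: nn_integral_cmult set_nn_integral_cmult)
  also have "\<dots> < \<infinity>"
    using q by (simp add: ennreal_mult_less_top order_le_less_trans)
  finally obtain h where h: "yh = ennreal h" "0 \<le> h"
    by (cases yh) auto

  have X: "(\<integral>\<^sup>+x. X w N s x \<partial>lborel) \<le> ennreal (A + Ca * h)" if s: "0 \<le> s" "s \<le> T" for s
  proof -
    have "(\<integral>\<^sup>+x. X w N s x \<partial>lborel) \<le> (\<integral>\<^sup>+x. X0 w N x \<partial>lborel)
        + ennreal Ca * (\<integral>\<^sup>+s\<in>{0..s}. (\<integral>\<^sup>+x. Yh N s x \<partial>lborel) \<partial>lborel)"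
      by (rule moment_growth[OF s(1)])
    also have "(\<integral>\<^sup>+s\<in>{0..s}. (\<integral>\<^sup>+x. Yh N s x \<partial>lborel) \<partial>lborel) \<le> yh"
      unfolding yh_def using s by (intro nn_integral_mono) (auto simp: indicator_def)
    finally have "(\<integral>\<^sup>+x. X w N s x \<partial>lborel) \<le> (\<integral>\<^sup>+x. X0 w N x \<partial>lborel) + ennreal Ca * yh"
      by (simp add: mult_left_mono add_left_mono)
    also have "\<dots> \<le> ennreal A + ennreal Ca * ennreal h"
      using I3 by (simp add: h add_right_mono)
    finally show ?thesis
      using A Ca_pos h by (simp add: ennreal_mult)
  qed

  \<comment> \<open>Almost every \<open>x\<close> is good for all times at once, because the exceptional set comes from the initial data.\<close>
  have pot_V: "AE x in lborel. potential e \<tau> (X real N s) x \<le> ennreal \<Psi>"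
    if e: "0 < e" "e \<le> \<tau>" and s: "0 \<le> s" "s \<le> T" for e s
    using I2
  proof eventually_elim
    case (elim x)
    have "potential e \<tau> (X0 real N) x \<le> ennreal c * ((\<integral>\<^sup>+y. X0 real N y * ennreal (phi0 (x - y)) \<partial>lborel) + (\<integral>\<^sup>+y. X0 real N y \<partial>lborel))"
      using e by (intro pot) auto
    also have "\<dots> \<le> ennreal c * (ennreal A + ennreal A)"
      using elim V0 by (intro mult_left_mono add_mono) auto
    also have "\<dots> = ennreal (2 * c * A)"
      using A c by (simp add: ennreal_mult[symmetric] flip: ennreal_plus)
    finally have 1: "potential e \<tau> (X0 real N) x \<le> ennreal (2 * c * A)" .
    have "(\<integral>\<^sup>+r\<in>{0..s}. heat \<tau> (X real N r) x \<partial>lborel)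
        \<le> (\<integral>\<^sup>+r. (ennreal (heat_kernel \<tau> (0 :: 'a)) * ennreal A) * indicator {0..s} r \<partial>lborel)"
    proof (rule nn_integral_mono)
      fix r
      have "heat \<tau> (X real N r) x \<le> ennreal (heat_kernel \<tau> (0 :: 'a)) * ennreal A" if "0 \<le> r"
      proof -
        have "heat \<tau> (X real N r) x \<le> ennreal (heat_kernel \<tau> (0 :: 'a)) * (\<integral>\<^sup>+y. X real N r y \<partial>lborel)"
          using \<tau> by (intro heat_le) auto
        also have "\<dots> \<le> ennreal (heat_kernel \<tau> (0 :: 'a)) * ennreal A"
          by (intro mult_left_mono V that) auto
        finally show ?thesis .
      qed
      then show "heat \<tau> (X real N r) x * indicator {0..s} r
          \<le> (ennreal (heat_kernel \<tau> (0 :: 'a)) * ennreal A) * indicator {0..s} r"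
        by (auto simp: indicator_def)
    qed
    also have "\<dots> = ennreal (s * heat_kernel \<tau> (0 :: 'a) * A)"
      using s A by (simp add: nn_integral_cmult ennreal_mult mult_ac)
    also have "\<dots> \<le> ennreal (\<kappa> * A)"
    proof -
      have "s * heat_kernel \<tau> (0 :: 'a) \<le> T * heat_kernel \<tau> (0 :: 'a)"
        using s by (intro mult_right_mono) auto
      then show ?thesis using kernel A by (intro ennreal_leI mult_right_mono) auto
    qed
    finally have "ennreal B * (\<integral>\<^sup>+r\<in>{0..s}. heat \<tau> (X real N r) x \<partial>lborel) \<le> ennreal B * ennreal (\<kappa> * A)"
      by (rule mult_left_mono) simp
    also have "\<dots> = ennreal (B * \<kappa> * A)"
      using B \<kappa> A by (simp add: ennreal_mult[symmetric] mult.assoc)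
    finally have 2: "ennreal B * (\<integral>\<^sup>+r\<in>{0..s}. heat \<tau> (X real N r) x \<partial>lborel) \<le> ennreal (B * \<kappa> * A)" .
    have "potential e \<tau> (X real N s) x \<le> ennreal (2 * c * A) + ennreal (B * \<kappa> * A)"
      using potential_growth[OF e s(1)] add_mono[OF 1 2] by (rule order_trans)
    also have "\<dots> = ennreal \<Psi>"
      using A B \<kappa> c by (simp add: \<Psi> flip: ennreal_plus)
    finally show ?case .
  qed

  define E where "E e = wsum w N (\<lambda>n. wsum real N (\<lambda>m. ennreal (d n + d m) *
      (\<integral>\<^sup>+s\<in>{0..T}. overlap e (F n s) (F m s) \<partial>lborel)))" for e
  have E_le: "E e \<le> ennreal (K1 + K2 * h)" if e: "0 < e" "e \<le> \<tau>" for e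
  proof -
    have "E e \<le> energy e \<tau> (X0 w N) (X0 real N)
        + ennreal (2 * B) * (\<integral>\<^sup>+s\<in>{0..T}. overlap \<tau> (X w N s) (X real N s) \<partial>lborel)
        + (\<integral>\<^sup>+s\<in>{0..T}. energy e \<tau> (\<lambda>x. ennreal Ca * Yh N s x) (X real N s) \<partial>lborel)"
      unfolding E_def by (intro energy_growth[OF e T] wsum_gain_le_loss_moment) measurable
    also have "\<dots> \<le> ennreal (c * (A + A * A)) + ennreal (2 * B) * ennreal (\<kappa> * ((A + Ca * h) * A)) + ennreal (Ca * \<Psi> * h)"
    proof (intro add_mono mult_left_mono)
      have "energy e \<tau> (X0 w N) (X0 real N)
          \<le> (\<integral>\<^sup>+x. X0 w N x * (ennreal c * ((\<integral>\<^sup>+y. X0 real N y * ennreal (phi0 (x - y)) \<partial>lborel) + (\<integral>\<^sup>+y. X0 real N y \<partial>lborel))) \<partial>lborel)"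
        unfolding energy_def using e by (intro nn_integral_mono mult_left_mono pot) auto
      also have "\<dots> = (\<integral>\<^sup>+x. ennreal c * (X0 w N x * (\<integral>\<^sup>+y. X0 real N y * ennreal (phi0 (x - y)) \<partial>lborel)
          + X0 w N x * (\<integral>\<^sup>+y. X0 real N y \<partial>lborel)) \<partial>lborel)"
        by (intro nn_integral_cong) (simp add: distrib_left mult_ac)
      also have "\<dots> = ennreal c * ((\<integral>\<^sup>+x. X0 w N x * (\<integral>\<^sup>+y. X0 real N y * ennreal (phi0 (x - y)) \<partial>lborel) \<partial>lborel)
          + (\<integral>\<^sup>+x. X0 w N x \<partial>lborel) * (\<integral>\<^sup>+y. X0 real N y \<partial>lborel))"
        by (simp add: nn_integral_cmult nn_integral_add nn_integral_multc)
      also have "\<dots> \<le> ennreal c * (ennreal A + ennreal A * ennreal A)"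
        by (intro mult_left_mono add_mono mult_mono I1 I3 V0) auto
      also have "\<dots> = ennreal (c * (A + A * A))"
        using A c by (simp add: ennreal_mult)
      finally show "energy e \<tau> (X0 w N) (X0 real N) \<le> ennreal (c * (A + A * A))" .
    next
      have "(\<integral>\<^sup>+s\<in>{0..T}. overlap \<tau> (X w N s) (X real N s) \<partial>lborel)
          \<le> (\<integral>\<^sup>+s. ennreal (heat_kernel \<tau> (0 :: 'a) * ((A + Ca * h) * A)) * indicator {0..T} s \<partial>lborel)"
      proof (rule nn_integral_mono)
        fix s :: real
        have "overlap \<tau> (X w N s) (X real N s) \<le> ennreal (heat_kernel \<tau> (0 :: 'a) * ((A + Ca * h) * A))" if s: "0 \<le> s" "s \<le> T"
        proof -
          have "overlap \<tau> (X w N s) (X real N s) \<le> ennreal (heat_kernel \<tau> (0 :: 'a))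
              * ((\<integral>\<^sup>+x. X w N s x \<partial>lborel) * (\<integral>\<^sup>+x. X real N s x \<partial>lborel))"
            using \<tau> by (intro overlap_le) auto
          also have "\<dots> \<le> ennreal (heat_kernel \<tau> (0 :: 'a)) * (ennreal (A + Ca * h) * ennreal A)"
            by (intro mult_left_mono mult_mono X V s) auto
          also have "\<dots> = ennreal (heat_kernel \<tau> (0 :: 'a) * ((A + Ca * h) * A))"
            using A h Ca_pos by (simp add: ennreal_mult[symmetric] del: ennreal_plus)
          finally show ?thesis .
        qed
        then show "overlap \<tau> (X w N s) (X real N s) * indicator {0..T} s
            \<le> ennreal (heat_kernel \<tau> (0 :: 'a) * ((A + Ca * h) * A)) * indicator {0..T} s"
          by (auto simp: indicator_def)
      qed
      also have "\<dots> = ennreal (T * heat_kernel \<tau> (0 :: 'a) * ((A + Ca * h) * A))"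
        using T A h Ca_pos
        by (subst nn_integral_cmult_indicator) (simp_all add: ennreal_mult[symmetric] mult_ac del: ennreal_plus)
      also have "\<dots> \<le> ennreal (\<kappa> * ((A + Ca * h) * A))"
        using kernel A h Ca_pos by (intro ennreal_leI mult_right_mono) auto
      finally show "(\<integral>\<^sup>+s\<in>{0..T}. overlap \<tau> (X w N s) (X real N s) \<partial>lborel) \<le> ennreal (\<kappa> * ((A + Ca * h) * A))" .
    next
      have "(\<integral>\<^sup>+s\<in>{0..T}. energy e \<tau> (\<lambda>x. ennreal Ca * Yh N s x) (X real N s) \<partial>lborel)
          \<le> (\<integral>\<^sup>+s\<in>{0..T}. (ennreal (Ca * \<Psi>) * (\<integral>\<^sup>+x. Yh N s x \<partial>lborel)) \<partial>lborel)"
      proof (rule nn_integral_mono)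
        fix s :: real
        have "energy e \<tau> (\<lambda>x. ennreal Ca * Yh N s x) (X real N s) \<le> ennreal (Ca * \<Psi>) * (\<integral>\<^sup>+x. Yh N s x \<partial>lborel)"
          if s: "0 \<le> s" "s \<le> T"
        proof -
          have "energy e \<tau> (\<lambda>x. ennreal Ca * Yh N s x) (X real N s) \<le> (\<integral>\<^sup>+x. ennreal Ca * Yh N s x * ennreal \<Psi> \<partial>lborel)"
            unfolding energy_def
            using pot_V[OF e s] by (intro nn_integral_mono_AE) (auto elim!: eventually_mono intro: mult_left_mono)
          also have "\<dots> = ennreal (Ca * \<Psi>) * (\<integral>\<^sup>+x. Yh N s x \<partial>lborel)"
            using Ca_pos \<Psi>_nonneg by (simp add: nn_integral_cmult nn_integral_multc ennreal_mult mult_ac)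
          finally show ?thesis .
        qed
        then show "energy e \<tau> (\<lambda>x. ennreal Ca * Yh N s x) (X real N s) * indicator {0..T} s
            \<le> ennreal (Ca * \<Psi>) * (\<integral>\<^sup>+x. Yh N s x \<partial>lborel) * indicator {0..T} s"
          by (auto simp: indicator_def)
      qed
      also have "\<dots> = ennreal (Ca * \<Psi>) * yh"
        unfolding yh_def by (simp add: set_nn_integral_cmult)
      also have "\<dots> = ennreal (Ca * \<Psi> * h)"
        using Ca_pos \<Psi>_nonneg h by (simp add: ennreal_mult)
      finally show "(\<integral>\<^sup>+s\<in>{0..T}. energy e \<tau> (\<lambda>x. ennreal Ca * Yh N s x) (X real N s) \<partial>lborel) \<le> ennreal (Ca * \<Psi> * h)" .
    qed auto
    also have "\<dots> = ennreal (c * (A + A * A) + 2 * B * (\<kappa> * ((A + Ca * h) * A)) + Ca * \<Psi> * h)"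
      using A B \<kappa> c h Ca_pos \<Psi>_nonneg by (simp add: ennreal_mult[symmetric] flip: ennreal_plus)
    also have "\<dots> \<le> ennreal (K1 + K2 * h)"
      using h by (intro ennreal_leI) (simp add: K1 K2 algebra_simps)
    finally show ?thesis .
  qed

  \<comment> \<open>The bound on the regularised dissipation is uniform in \<open>e\<close>; let \<open>e = 1 / (k + 1)\<close> tend to 0.\<close>
  have y_le: "y \<le> ennreal (K1 + K2 * h)"
  proof -
    define e where "e k = 1 / real (Suc k)" for k
    have e: "0 < e k" "e k \<le> \<tau>" for k
      using \<tau> by (auto simp: e_def intro: order_trans[of _ 1])
    have fatou: "(\<integral>\<^sup>+s\<in>{0..T}. (\<integral>\<^sup>+x. F n s x * F m s x \<partial>lborel) \<partial>lborel)
        \<le> liminf (\<lambda>k. \<integral>\<^sup>+s\<in>{0..T}. overlap (e k) (F n s) (F m s) \<partial>lborel)" for n m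
    proof -
      have "(\<integral>\<^sup>+s\<in>{0..T}. (\<integral>\<^sup>+x. F n s x * F m s x \<partial>lborel) \<partial>lborel)
          \<le> (\<integral>\<^sup>+s. liminf (\<lambda>k. overlap (e k) (F n s) (F m s) * indicator {0..T} s) \<partial>lborel)"
      proof (rule nn_integral_mono)
        fix s
        have "(\<integral>\<^sup>+x. F n s x * F m s x \<partial>lborel) \<le> liminf (\<lambda>k. overlap (e k) (F n s) (F m s))"
          unfolding e_def by (rule nn_integral_mult_le_liminf_overlap[OF _ _ F_finite F_finite]) measurable
        then show "(\<integral>\<^sup>+x. F n s x * F m s x \<partial>lborel) * indicator {0..T} s
            \<le> liminf (\<lambda>k. overlap (e k) (F n s) (F m s) * indicator {0..T} s)"
          by (cases "s \<in> {0..T}") auto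
      qed
      also have "\<dots> \<le> liminf (\<lambda>k. \<integral>\<^sup>+s\<in>{0..T}. overlap (e k) (F n s) (F m s) \<partial>lborel)"
        by (rule nn_integral_liminf) measurable
      finally show ?thesis .
    qed
    have "y = wsum w N (\<lambda>n. wsum real N (\<lambda>m. ennreal (d n + d m) *
        (\<integral>\<^sup>+s\<in>{0..T}. (\<integral>\<^sup>+x. F n s x * F m s x \<partial>lborel) \<partial>lborel)))"
    proof -
      have inner: "(\<integral>\<^sup>+x. Yd N s x \<partial>lborel)
          = wsum w N (\<lambda>n. wsum real N (\<lambda>m. ennreal (d n + d m) * (\<integral>\<^sup>+x. F n s x * F m s x \<partial>lborel)))" for s
        by (simp add: nn_integral_wsum nn_integral_cmult)
      show ?thesis
        unfolding y_def inner by (simp add: set_nn_integral_wsum set_nn_integral_cmult)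
    qed
    also have "\<dots> \<le> wsum w N (\<lambda>n. wsum real N (\<lambda>m.
        liminf (\<lambda>k. ennreal (d n + d m) * (\<integral>\<^sup>+s\<in>{0..T}. overlap (e k) (F n s) (F m s) \<partial>lborel))))"
      by (intro wsum_mono) (simp add: liminf_cmult_ennreal mult_left_mono fatou)
    also have "\<dots> \<le> wsum w N (\<lambda>n. liminf (\<lambda>k. wsum real N (\<lambda>m.
        ennreal (d n + d m) * (\<integral>\<^sup>+s\<in>{0..T}. overlap (e k) (F n s) (F m s) \<partial>lborel))))"
      by (intro wsum_mono wsum_liminf_le)
    also have "\<dots> \<le> liminf (\<lambda>k. E (e k))"
      unfolding E_def by (rule wsum_liminf_le)
    also have "\<dots> \<le> liminf (\<lambda>k. ennreal (K1 + K2 * h))"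
      by (intro Liminf_mono always_eventually allI E_le e)
    also have "\<dots> = ennreal (K1 + K2 * h)"
      by (simp add: Liminf_const)
    finally show ?thesis .
  qed
  then obtain g where g: "y = ennreal g" "0 \<le> g"
    by (cases y) (auto simp: top_unique)
  have g_le: "g \<le> K1 + K2 * h"
    using y_le g K1_nonneg K2_ge h by (simp add: ennreal_le_iff del: ennreal_plus)

  have h_le: "h \<le> g / (2 * K2) + M * A"
  proof -
    have "yh \<le> (\<integral>\<^sup>+s\<in>{0..T}. (\<integral>\<^sup>+x. ennreal (4 * (1 / (8 * K2))) * Yd N s x
        + ennreal (2 * k0 powr a) * collisions \<alpha> (\<lambda>_ _. 1) N (\<lambda>k. F k s x) \<partial>lborel) \<partial>lborel)"
      unfolding yh_def
    proof (intro nn_integral_mono mult_right_mono)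
      fix s x
      show "Yh N s x \<le> ennreal (4 * (1 / (8 * K2))) * Yd N s x
        + ennreal (2 * k0 powr a) * collisions \<alpha> (\<lambda>_ _. 1) N (\<lambda>k. F k s x)"
        using K2_ge k0 by (intro collisions_split \<alpha>_le) auto
    qed simp
    also have "\<dots> = ennreal (1 / (2 * K2)) * y + ennreal M * q"
      unfolding y_def q_def M
      by (simp add: nn_integral_add nn_integral_cmult distrib_right mult.assoc)
    also have "\<dots> \<le> ennreal (1 / (2 * K2)) * ennreal g + ennreal M * ennreal A"
      using q by (simp add: g mult_left_mono add_left_mono)
    also have "\<dots> = ennreal (g / (2 * K2) + M * A)"
      using g A M_nonneg K2_ge by (simp add: ennreal_mult[symmetric] flip: ennreal_plus)
    finally show ?thesis
      using h g A M_nonneg K2_ge by (simp add: ennreal_le_iff del: ennreal_plus)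
  qed
  have g_Cy: "g \<le> Cy"
  proof -
    have "K2 * h \<le> K2 * (g / (2 * K2) + M * A)"
      using h_le K2_ge by (intro mult_left_mono) auto
    also have "\<dots> = g / 2 + K2 * M * A"
      using K2_ge by (simp add: field_simps)
    finally show ?thesis using g_le by (simp add: Cy)
  qed
  have h_Cy: "h \<le> Cy + M * A"
  proof -
    have "g / (2 * K2) \<le> g / 1"
      using g K2_ge by (intro divide_left_mono) auto
    then show ?thesis using h_le g_Cy by simp
  qed
  show "y \<le> ennreal Cy"
    using g g_Cy by (simp add: ennreal_leI)
  show "yh \<le> ennreal (Cy + M * A)"
    using h h_Cy by (simp add: ennreal_leI)
  show "(\<integral>\<^sup>+x. X w N t x \<partial>lborel) \<le> ennreal (A + Ca * (Cy + M * A))" if "0 \<le> t" "t \<le> T"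
    by (rule order_trans[OF X[OF that]]) (use h_Cy Ca_pos in \<open>auto intro!: ennreal_leI mult_left_mono\<close>)
qed

end

section \<open>Removing the cut-off\<close>

text \<open>
  Square partial sums match the cut-off at mass \<open>N\<close>.
\<close>

lemma double_suminf_eq_SUP:
  fixes b :: "nat \<Rightarrow> nat \<Rightarrow> ennreal"
  shows "(\<Sum>i. \<Sum>j. b i j) = (SUP N. \<Sum>i<N. \<Sum>j<N. b i j)"
proof (rule antisym)
  show "(\<Sum>i. \<Sum>j. b i j) \<le> (SUP N. \<Sum>i<N. \<Sum>j<N. b i j)"
    unfolding suminf_eq_SUP[of "\<lambda>i. \<Sum>j. b i j"]
  proof (rule SUP_least)
    fix n
    have "(\<Sum>i<n. \<Sum>j. b i j) = (\<Sum>j. \<Sum>i<n. b i j)"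
      by (simp add: suminf_sum)
    also have "\<dots> \<le> (SUP N. \<Sum>i<N. \<Sum>j<N. b i j)"
      unfolding suminf_eq_SUP
    proof (rule SUP_least)
      fix m
      have "(\<Sum>j<m. \<Sum>i<n. b i j) \<le> (\<Sum>j<max n m. \<Sum>i<max n m. b i j)"
        by (intro order_trans[OF sum_mono[OF sum_mono2] sum_mono2]) auto
      also have "\<dots> = (\<Sum>i<max n m. \<Sum>j<max n m. b i j)"
        by (rule sum.swap)
      also have "\<dots> \<le> (SUP N. \<Sum>i<N. \<Sum>j<N. b i j)"
        by (rule SUP_upper) simp
      finally show "(\<Sum>j<m. \<Sum>i<n. b i j) \<le> (SUP N. \<Sum>i<N. \<Sum>j<N. b i j)" .
    qed
    finally show "(\<Sum>i<n. \<Sum>j. b i j) \<le> (SUP N. \<Sum>i<N. \<Sum>j<N. b i j)" .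
  qed
  show "(SUP N. \<Sum>i<N. \<Sum>j<N. b i j) \<le> (\<Sum>i. \<Sum>j. b i j)"
    by (intro SUP_least order_trans[OF sum_mono sum_le_suminf]) (auto intro: sum_le_suminf)
qed

lemma sum_lessThan_Suc_shift: "(\<Sum>i<N. f (Suc i)) = (\<Sum>n = 1..N. f n)"
  using sum.atLeast1_atMost_eq[of f N] by simp

context moment_estimate begin

lemma quadratic_integral_le:
  assumes bound: "\<And>N. (\<integral>\<^sup>+s\<in>{0..T}. (\<integral>\<^sup>+x. (\<Sum>n = 1..N. \<Sum>m = 1..N. ennreal (R n m) * (F n s x * F m s x)) \<partial>lborel) \<partial>lborel) \<le> C"
  shows "(\<integral>\<^sup>+s\<in>{0..T}. (\<integral>\<^sup>+x. (\<Sum>i. \<Sum>j. ennreal (R (Suc i) (Suc j)) * (F (Suc i) s x * F (Suc j) s x)) \<partial>lborel) \<partial>lborel) \<le> C"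
proof -
  define S where "S N s x = (\<Sum>i<N. \<Sum>j<N. ennreal (R (Suc i) (Suc j)) * (F (Suc i) s x * F (Suc j) s x))" for N s x
  have S_meas [measurable]: "case_prod (S N) \<in> borel_measurable (borel \<Otimes>\<^sub>M borel)" for N
    unfolding S_def by measurable
  have S_mono: "S N s x \<le> S N' s x" if "N \<le> N'" for N N' s x
    unfolding S_def using that by (intro order_trans[OF sum_mono[OF sum_mono2] sum_mono2]) auto
  have S_eq: "S N s x = (\<Sum>n = 1..N. \<Sum>m = 1..N. ennreal (R n m) * (F n s x * F m s x))" for N s x
  proof -
    have "(\<Sum>j<N. ennreal (R n (Suc j)) * (F n s x * F (Suc j) s x)) = (\<Sum>m = 1..N. ennreal (R n m) * (F n s x * F m s x))" for n
      by (rule sum_lessThan_Suc_shift)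
    then show ?thesis
      unfolding S_def by (simp only:) (rule sum_lessThan_Suc_shift)
  qed
  have inner: "(\<integral>\<^sup>+x. (SUP N. S N s x) \<partial>lborel) = (SUP N. \<integral>\<^sup>+x. S N s x \<partial>lborel)" for s
    by (rule nn_integral_monotone_convergence_SUP) (auto simp: incseq_def le_fun_def S_mono)
  have "(\<integral>\<^sup>+s\<in>{0..T}. (\<integral>\<^sup>+x. (\<Sum>i. \<Sum>j. ennreal (R (Suc i) (Suc j)) * (F (Suc i) s x * F (Suc j) s x)) \<partial>lborel) \<partial>lborel)
      = (\<integral>\<^sup>+s\<in>{0..T}. (SUP N. \<integral>\<^sup>+x. S N s x \<partial>lborel) \<partial>lborel)"
    unfolding double_suminf_eq_SUP S_def[symmetric] inner ..
  also have "\<dots> = (\<integral>\<^sup>+s. (SUP N. (\<integral>\<^sup>+x. S N s x \<partial>lborel) * indicator {0..T} s) \<partial>lborel)"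
    by (simp add: SUP_mult_right_ennreal)
  also have "\<dots> = (SUP N. \<integral>\<^sup>+s\<in>{0..T}. (\<integral>\<^sup>+x. S N s x \<partial>lborel) \<partial>lborel)"
    by (rule nn_integral_monotone_convergence_SUP)
       (auto simp: incseq_def le_fun_def intro!: mult_right_mono nn_integral_mono S_mono)
  also have "\<dots> \<le> C"
    by (rule SUP_least) (simp only: S_eq bound)
  finally show ?thesis .
qed

end

lemma wsum_le_moment_X:
  assumes "\<And>n. 1 \<le> n \<Longrightarrow> 0 \<le> c n" "\<And>n. 1 \<le> n \<Longrightarrow> ennreal (c n) = c' n"
  shows "wsum (\<lambda>n. real n powr b) N c' \<le> moment_X b c"
proof -
  have "wsum (\<lambda>n. real n powr b) N c' = (\<Sum>i<N. ennreal (real (Suc i) powr b) * c' (Suc i))"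
    unfolding wsum_def by (rule sum_lessThan_Suc_shift[symmetric])
  also have "\<dots> = (\<Sum>i<N. ennreal (real (Suc i) powr b * c (Suc i)))"
    using assms by (intro sum.cong) (simp_all add: ennreal_mult flip: assms(2))
  also have "\<dots> \<le> moment_X b c"
    unfolding moment_X_def Let_def by (intro sum_le_suminf) auto
  finally show ?thesis .
qed

lemma moment_X_integral_le:
  assumes meas: "\<And>n. c' n \<in> borel_measurable lborel"
    and ae: "AE x in lborel. \<forall>n\<ge>1. 0 \<le> c n x \<and> ennreal (c n x) = c' n x"
    and bound: "\<And>N. (\<integral>\<^sup>+x. wsum (\<lambda>n. real n powr b) N (\<lambda>n. c' n x) \<partial>lborel) \<le> C"
  shows "(\<integral>\<^sup>+x. moment_X b (\<lambda>n. c n x) \<partial>lborel) \<le> C"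
proof -
  note [measurable] = meas
  have "(\<integral>\<^sup>+x. moment_X b (\<lambda>n. c n x) \<partial>lborel) = (\<integral>\<^sup>+x. (\<Sum>i. ennreal (real (Suc i) powr b) * c' (Suc i) x) \<partial>lborel)"
    using ae unfolding moment_X_def Let_def
    by (intro nn_integral_cong_AE) (auto elim!: eventually_mono intro!: suminf_cong simp: ennreal_mult)
  also have "\<dots> = (\<Sum>i. \<integral>\<^sup>+x. ennreal (real (Suc i) powr b) * c' (Suc i) x \<partial>lborel)"
    by (rule nn_integral_suminf) measurable
  also have "\<dots> = (SUP N. \<Sum>i<N. \<integral>\<^sup>+x. ennreal (real (Suc i) powr b) * c' (Suc i) x \<partial>lborel)"
    by (rule suminf_eq_SUP)
  also have "\<dots> \<le> C"
  proof (rule SUP_least)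
    fix N
    have "(\<Sum>i<N. \<integral>\<^sup>+x. ennreal (real (Suc i) powr b) * c' (Suc i) x \<partial>lborel)
        = (\<Sum>n = 1..N. \<integral>\<^sup>+x. ennreal (real n powr b) * c' n x \<partial>lborel)"
      by (rule sum_lessThan_Suc_shift)
    also have "\<dots> = (\<integral>\<^sup>+x. wsum (\<lambda>n. real n powr b) N (\<lambda>n. c' n x) \<partial>lborel)"
      unfolding wsum_def by (rule nn_integral_sum[symmetric]) measurable
    finally show "(\<Sum>i<N. \<integral>\<^sup>+x. ennreal (real (Suc i) powr b) * c' (Suc i) x \<partial>lborel) \<le> C"
      using bound by simp
  qed
  finally show ?thesis .
qed

text \<open>
  The constant is fixed before \<open>T\<close>, \<open>\<tau>\<close> and the solution; it depends on the time span only through the bound \<open>\<kappa>\<close>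
  for \<open>T p\<^sub>\<tau>(0)\<close>. Both parts of the theorem are obtained by a choice of \<open>\<tau>\<close> and \<open>\<kappa>\<close>.
\<close>

proposition moment_bounds:
  fixes d :: "nat \<Rightarrow> real" and \<alpha> :: "nat \<Rightarrow> nat \<Rightarrow> real" and a A \<kappa> :: real
  assumes d: "\<And>n. n \<ge> 1 \<Longrightarrow> 0 \<le> d n"
    and \<alpha>: "\<And>n m. n \<ge> 1 \<Longrightarrow> m \<ge> 1 \<Longrightarrow> 0 \<le> \<alpha> n m"
    and \<alpha>_sym: "\<And>n m. n \<ge> 1 \<Longrightarrow> m \<ge> 1 \<Longrightarrow> \<alpha> n m = \<alpha> m n"
    and \<alpha>_small: "\<forall>\<delta>>0. \<exists>k0>0. \<forall>n\<ge>1. \<forall>m\<ge>1. real (n + m) > k0 \<longrightarrow>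
           \<alpha> n m \<le> \<delta> * real (n + m) * (d n + d m)"
    and d_bounded: "\<exists>B. \<forall>n\<ge>1. d n \<le> B"
    and a: "a \<ge> 2" and A: "A > 0" and \<kappa>: "\<kappa> \<ge> 0"
  obtains C where "\<And>T \<tau> f0 (f :: nat \<Rightarrow> 'a::euclidean_space \<Rightarrow> real \<Rightarrow> real).
      T > 0 \<Longrightarrow> \<tau> \<ge> 1 \<Longrightarrow> (DIM('a) \<le> 2 \<Longrightarrow> \<tau> \<le> 1) \<Longrightarrow> T * heat_kernel \<tau> (0 :: 'a) \<le> \<kappa> \<Longrightarrow>
      weak_solution d \<alpha> f0 f \<Longrightarrow> initial_bounds a A f0 \<Longrightarrow> solution_bounds d \<alpha> a T C f"
proof -
  obtain B where B: "\<And>n. n \<ge> 1 \<Longrightarrow> d n \<le> B" using d_bounded by blast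
  have B_nonneg: "0 \<le> B" using B[of 1] d[of 1] by simp
  obtain c :: real where c: "c > 0"
    "\<And>e \<tau> (g :: 'a \<Rightarrow> ennreal) x. 0 < e \<Longrightarrow> (DIM('a) \<le> 2 \<Longrightarrow> \<tau> \<le> 1) \<Longrightarrow> g \<in> borel_measurable borel \<Longrightarrow>
       potential e \<tau> g x \<le> ennreal c * ((\<integral>\<^sup>+y. g y * ennreal (phi0 (x - y)) \<partial>lborel) + (\<integral>\<^sup>+y. g y \<partial>lborel))"
    by (rule potential_le_phi0) blast
  define ca where "ca = a * 2 powr (a - 1)"
  have ca: "0 < ca" using a by (simp add: ca_def)
  define \<Psi> where "\<Psi> = 2 * c * A + B * \<kappa> * A"
  define K1 where "K1 = c * (A + A * A) + 2 * B * \<kappa> * A * A"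
  define K2 where "K2 = ca * \<Psi> + 2 * B * \<kappa> * A * ca + 1"
  have \<Psi>_nonneg: "0 \<le> \<Psi>" using A B_nonneg \<kappa> c(1) by (simp add: \<Psi>_def)
  have K2: "0 < K2" using A B_nonneg \<kappa> \<Psi>_nonneg ca by (simp add: K2_def add_nonneg_pos)
  then have "0 < 1 / (8 * K2)" by simp
  from \<alpha>_small[rule_format, OF this] obtain k0 where k0: "0 < k0" and
    k0_le: "\<forall>n\<ge>1. \<forall>m\<ge>1. real (n + m) > k0 \<longrightarrow> \<alpha> n m \<le> 1 / (8 * K2) * real (n + m) * (d n + d m)"
    by (elim exE conjE)
  have \<alpha>_le: "\<alpha> n m \<le> 1 / (8 * K2) * real (n + m) * (d n + d m)"
    if "n \<ge> 1" "m \<ge> 1" "k0 < real (n + m)" for n m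
    using k0_le that by simp
  define M where "M = 2 * k0 powr a"
  define Cy where "Cy = 2 * (K1 + K2 * M * A)"
  have nonneg: "0 \<le> K1" "0 \<le> M" "0 \<le> Cy"
    using A B_nonneg \<kappa> c(1) K2 by (auto simp: K1_def M_def Cy_def)
  \<comment> \<open>A sum of the three separate bounds; \<open>Y\<close> is twice the quantity that \<open>Cy\<close> bounds.\<close>
  define C where "C = 2 * Cy + M * A + (A + ca * (Cy + M * A))"
  show thesis
  proof (rule that)
    fix T \<tau> :: real and f0 :: "nat \<Rightarrow> 'a \<Rightarrow> real" and f :: "nat \<Rightarrow> 'a \<Rightarrow> real \<Rightarrow> real"
    assume T: "T > 0" and \<tau>: "\<tau> \<ge> 1" "DIM('a) \<le> 2 \<Longrightarrow> \<tau> \<le> 1" and kernel: "T * heat_kernel \<tau> (0 :: 'a) \<le> \<kappa>"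
      and ws: "weak_solution d \<alpha> f0 f" and ib: "initial_bounds a A f0"
    have f0_nonneg: "0 \<le> f0 n x" if "1 \<le> n" for n x
      using ws that unfolding weak_solution_def by auto
    have f_nonneg: "0 \<le> f n x t" if "1 \<le> n" "0 \<le> t" for n x t
      using ws that unfolding weak_solution_def by auto
    have ib1: "(\<integral>\<^sup>+x. \<integral>\<^sup>+y. moment_X a (\<lambda>n. f0 n x) * moment_X 1 (\<lambda>n. f0 n y) * ennreal (phi0 (x - y)) \<partial>lborel \<partial>lborel) \<le> ennreal A"
      and ib2: "AE x in lborel. (\<integral>\<^sup>+y. moment_X a (\<lambda>n. f0 n y) * ennreal (phi0 (x - y)) \<partial>lborel) \<le> ennreal A"
      and ib3: "(\<integral>\<^sup>+x. moment_X a (\<lambda>n. f0 n x) \<partial>lborel) \<le> ennreal A"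
    proof -
      show "(\<integral>\<^sup>+x. \<integral>\<^sup>+y. moment_X a (\<lambda>n. f0 n x) * moment_X 1 (\<lambda>n. f0 n y) * ennreal (phi0 (x - y)) \<partial>lborel \<partial>lborel) \<le> ennreal A"
        and "(\<integral>\<^sup>+x. moment_X a (\<lambda>n. f0 n x) \<partial>lborel) \<le> ennreal A"
        using ib unfolding initial_bounds_def by (simp_all add: nn_integral_completion)
      have "esssup lebesgue (\<lambda>x. \<integral>\<^sup>+y. moment_X a (\<lambda>n. f0 n y) * ennreal (phi0 (x - y)) \<partial>lebesgue) \<le> ennreal A"
        using ib unfolding initial_bounds_def by simp
      with esssup_AE[of "\<lambda>x. \<integral>\<^sup>+y. moment_X a (\<lambda>n. f0 n y) * ennreal (phi0 (x - y)) \<partial>lebesgue" lebesgue]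
      have "AE x in lebesgue. (\<integral>\<^sup>+y. moment_X a (\<lambda>n. f0 n y) * ennreal (phi0 (x - y)) \<partial>lebesgue) \<le> ennreal A"
        by (auto elim!: eventually_mono)
      then show "AE x in lborel. (\<integral>\<^sup>+y. moment_X a (\<lambda>n. f0 n y) * ennreal (phi0 (x - y)) \<partial>lborel) \<le> ennreal A"
        by (simp add: AE_completion_iff nn_integral_completion)
    qed
    have f0_fin: "(\<integral>\<^sup>+x. ennreal (f0 n x) \<partial>lebesgue) < \<infinity>" if n: "1 \<le> n" for n
    proof -
      have le: "ennreal (f0 n x) \<le> moment_X a (\<lambda>n. f0 n x)" for x
      proof -
        have "1 * f0 n x \<le> real n powr a * f0 n x"
          using n a f0_nonneg[OF n] by (intro mult_right_mono) (auto simp: ge_one_powr_ge_zero)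
        then have "ennreal (f0 n x) \<le> (\<Sum>i\<in>{n - 1}. ennreal (real (Suc i) powr a * f0 (Suc i) x))"
          using n by (simp add: ennreal_leI)
        also have "\<dots> \<le> moment_X a (\<lambda>n. f0 n x)"
          unfolding moment_X_def Let_def by (intro sum_le_suminf) auto
        finally show ?thesis .
      qed
      have "(\<integral>\<^sup>+x. ennreal (f0 n x) \<partial>lborel) \<le> ennreal A"
        by (rule order_trans[OF nn_integral_mono ib3]) (rule le)
      then show ?thesis by (simp add: nn_integral_completion order_le_less_trans)
    qed
    show "solution_bounds d \<alpha> a T C f"
    proof (rule weak_solution_imp_mild[OF ws d \<alpha> f0_fin])
      fix F0 :: "nat \<Rightarrow> 'a \<Rightarrow> ennreal" and F :: "nat \<Rightarrow> real \<Rightarrow> 'a \<Rightarrow> ennreal"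
      assume F0_meas: "\<And>n. F0 n \<in> borel_measurable borel" and
        F_meas: "\<And>n. case_prod (F n) \<in> borel_measurable (borel \<Otimes>\<^sub>M borel)" and
        mild: "\<And>n. 1 \<le> n \<Longrightarrow> mild_solution (d n) (F0 n) (F n)
            (\<lambda>t x. gain \<alpha> n (\<lambda>k. F k t x)) (\<lambda>t x. loss \<alpha> n (\<lambda>k. F k t x))" and
        F0_AE: "\<And>n. 1 \<le> n \<Longrightarrow> AE x in lborel. ennreal (f0 n x) = F0 n x" and
        F_AE: "\<And>n t. 1 \<le> n \<Longrightarrow> 0 \<le> t \<Longrightarrow> AE x in lborel. ennreal (f n x t) = F n t x" and
        F_finite: "\<And>n t x. F n t x < \<infinity>"
      interpret moment_estimate d \<alpha> F0 F B a
        by (intro moment_estimate.intro coagulation_diffusion.intro moment_estimate_axioms.intro)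
          (rule B \<alpha> \<alpha>_sym F0_meas F_meas mild F_finite a; assumption)+
      have Ca_eq: "Ca = ca"
        by (simp add: Ca_def ca_def)

      have agree0: "AE x in lborel. \<forall>n\<ge>1. ennreal (f0 n x) = F0 n x"
        unfolding AE_all_countable using F0_AE by (auto intro: AE_impI)
      have X0_le: "X0 w N x \<le> moment_X a (\<lambda>n. f0 n x)" "X0 real N x \<le> moment_X 1 (\<lambda>n. f0 n x)"
        if "\<forall>n\<ge>1. ennreal (f0 n x) = F0 n x" for N x
      proof -
        show "X0 w N x \<le> moment_X a (\<lambda>n. f0 n x)"
          unfolding w_def using that f0_nonneg by (intro wsum_le_moment_X) auto
        have "X0 real N x = wsum (\<lambda>n. real n powr 1) N (\<lambda>n. F0 n x)" by simp
        also have "\<dots> \<le> moment_X 1 (\<lambda>n. f0 n x)"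
          using that f0_nonneg by (intro wsum_le_moment_X) auto
        finally show "X0 real N x \<le> moment_X 1 (\<lambda>n. f0 n x)" .
      qed
      have moment_1_le: "moment_X 1 (\<lambda>n. f0 n x) \<le> moment_X a (\<lambda>n. f0 n x)" for x
        unfolding moment_X_def Let_def using a f0_nonneg
        by (intro suminf_le summableI ennreal_leI mult_right_mono powr_mono) auto
      have I1: "(\<integral>\<^sup>+x. X0 w N x * (\<integral>\<^sup>+y. X0 real N y * ennreal (phi0 (x - y)) \<partial>lborel) \<partial>lborel) \<le> ennreal A" for N
      proof -
        have "(\<integral>\<^sup>+x. X0 w N x * (\<integral>\<^sup>+y. X0 real N y * ennreal (phi0 (x - y)) \<partial>lborel) \<partial>lborel)
            = (\<integral>\<^sup>+x. (\<integral>\<^sup>+y. X0 w N x * (X0 real N y * ennreal (phi0 (x - y))) \<partial>lborel) \<partial>lborel)"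
          by (simp add: nn_integral_cmult)
        also have "\<dots> \<le> (\<integral>\<^sup>+x. \<integral>\<^sup>+y. moment_X a (\<lambda>n. f0 n x) * moment_X 1 (\<lambda>n. f0 n y) * ennreal (phi0 (x - y)) \<partial>lborel \<partial>lborel)"
        proof (rule nn_integral_mono_AE)
          show "AE x in lborel. (\<integral>\<^sup>+y. X0 w N x * (X0 real N y * ennreal (phi0 (x - y))) \<partial>lborel)
              \<le> (\<integral>\<^sup>+y. moment_X a (\<lambda>n. f0 n x) * moment_X 1 (\<lambda>n. f0 n y) * ennreal (phi0 (x - y)) \<partial>lborel)"
            using agree0
          proof eventually_elim
            case (elim x)
            show ?case
              using agree0 X0_le(1)[OF elim] X0_le(2)
              by (intro nn_integral_mono_AE) (auto elim!: eventually_mono simp: mult.assoc intro!: mult_mono)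
          qed
        qed
        finally show ?thesis using ib1 by simp
      qed
      have I2: "AE x in lborel. (\<integral>\<^sup>+y. X0 real N y * ennreal (phi0 (x - y)) \<partial>lborel) \<le> ennreal A" for N
        using ib2
      proof eventually_elim
        case (elim x)
        have "(\<integral>\<^sup>+y. X0 real N y * ennreal (phi0 (x - y)) \<partial>lborel)
            \<le> (\<integral>\<^sup>+y. moment_X a (\<lambda>n. f0 n y) * ennreal (phi0 (x - y)) \<partial>lborel)"
          using agree0
          by (intro nn_integral_mono_AE)
             (auto elim!: eventually_mono intro!: mult_right_mono order_trans[OF X0_le(2) moment_1_le])
        then show ?case using elim by simp
      qed
      have I3: "(\<integral>\<^sup>+x. X0 w N x \<partial>lborel) \<le> ennreal A" for N
        by (rule order_trans[OF nn_integral_mono_AE ib3])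
           (use agree0 in \<open>auto elim!: eventually_mono intro: X0_le(1)\<close>)
      have pot: "potential e \<tau> g x \<le> ennreal c * ((\<integral>\<^sup>+y. g y * ennreal (phi0 (x - y)) \<partial>lborel) + (\<integral>\<^sup>+y. g y \<partial>lborel))"
        if "0 < e" "g \<in> borel_measurable borel" for e and g :: "'a \<Rightarrow> ennreal" and x
        using that \<tau> by (intro c(2)) auto
      have bounds: "(\<integral>\<^sup>+s\<in>{0..T}. (\<integral>\<^sup>+x. Yd N s x \<partial>lborel) \<partial>lborel) \<le> ennreal Cy"
          "(\<integral>\<^sup>+s\<in>{0..T}. (\<integral>\<^sup>+x. Yh N s x \<partial>lborel) \<partial>lborel) \<le> ennreal (Cy + M * A)"
          "0 \<le> t \<Longrightarrow> t \<le> T \<Longrightarrow> (\<integral>\<^sup>+x. X w N t x \<partial>lborel) \<le> ennreal (A + Ca * (Cy + M * A))" for N t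
        by (rule truncated_moment_bounds[OF A B_nonneg \<kappa> c(1) less_imp_le[OF T] \<tau>(1) less_imp_le[OF k0] kernel
          pot I1 I2 I3 \<Psi>_def K1_def K2_def[folded Ca_eq] M_def Cy_def \<alpha>_le]; assumption)+

      have agree: "AE x in lborel. \<forall>n\<ge>1. 0 \<le> f n x t \<and> ennreal (f n x t) = F n t x" if t: "0 \<le> t" for t
      proof -
        have "AE x in lborel. \<forall>n. 1 \<le> n \<longrightarrow> ennreal (f n x t) = F n t x"
          unfolding AE_all_countable using F_AE[OF _ t] by (auto intro: AE_impI)
        then show ?thesis by eventually_elim (use f_nonneg[OF _ t] in auto)
      qed
      have quad: "(\<integral>\<^sup>+t\<in>{0..T}. (\<integral>\<^sup>+x. (\<Sum>i. \<Sum>j. ennreal (R (Suc i) (Suc j) * f (Suc i) x t * f (Suc j) x t)) \<partial>lebesgue) \<partial>lebesgue) \<le> ennreal C"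
        if R: "\<And>n m. 1 \<le> n \<Longrightarrow> 1 \<le> m \<Longrightarrow> 0 \<le> R n m"
          and bound: "\<And>N. (\<integral>\<^sup>+s\<in>{0..T}. (\<integral>\<^sup>+x. (\<Sum>n = 1..N. \<Sum>m = 1..N. ennreal (R n m) * (F n s x * F m s x)) \<partial>lborel) \<partial>lborel) \<le> ennreal C"
        for R :: "nat \<Rightarrow> nat \<Rightarrow> real"
      proof -
        have eq: "(\<integral>\<^sup>+x. (\<Sum>i. \<Sum>j. ennreal (R (Suc i) (Suc j) * f (Suc i) x t * f (Suc j) x t)) \<partial>lborel)
            = (\<integral>\<^sup>+x. (\<Sum>i. \<Sum>j. ennreal (R (Suc i) (Suc j)) * (F (Suc i) t x * F (Suc j) t x)) \<partial>lborel)" if t: "0 \<le> t" for t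
        proof (rule nn_integral_cong_AE)
          show "AE x in lborel. (\<Sum>i. \<Sum>j. ennreal (R (Suc i) (Suc j) * f (Suc i) x t * f (Suc j) x t))
              = (\<Sum>i. \<Sum>j. ennreal (R (Suc i) (Suc j)) * (F (Suc i) t x * F (Suc j) t x))"
            using agree[OF t]
          proof eventually_elim
            case (elim x)
            have "ennreal (R (Suc i) (Suc j) * f (Suc i) x t * f (Suc j) x t)
                = ennreal (R (Suc i) (Suc j)) * (F (Suc i) t x * F (Suc j) t x)" for i j
            proof -
              have "F (Suc i) t x = ennreal (f (Suc i) x t)" "F (Suc j) t x = ennreal (f (Suc j) x t)"
                "0 \<le> f (Suc i) x t" "0 \<le> f (Suc j) x t" "0 \<le> R (Suc i) (Suc j)"
                using elim R by auto
              then show ?thesis by (simp add: ennreal_mult mult.assoc)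
            qed
            then show ?case by simp
          qed
        qed
        have "(\<integral>\<^sup>+t\<in>{0..T}. (\<integral>\<^sup>+x. (\<Sum>i. \<Sum>j. ennreal (R (Suc i) (Suc j) * f (Suc i) x t * f (Suc j) x t)) \<partial>lebesgue) \<partial>lebesgue)
            = (\<integral>\<^sup>+s\<in>{0..T}. (\<integral>\<^sup>+x. (\<Sum>i. \<Sum>j. ennreal (R (Suc i) (Suc j)) * (F (Suc i) s x * F (Suc j) s x)) \<partial>lborel) \<partial>lborel)"
          unfolding nn_integral_completion
          by (intro nn_integral_cong) (auto simp: indicator_def eq)
        also have "\<dots> \<le> ennreal C"
          by (rule quadratic_integral_le[OF bound])
        finally show ?thesis .
      qed
      show "solution_bounds d \<alpha> a T C f"
        unfolding solution_bounds_def
      proof (intro conjI)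
        define RY where "RY n m = real n * real m * (real n powr (a - 1) + real m powr (a - 1)) * (d n + d m)" for n m
        have RY: "ennreal (RY n m) * (F n s x * F m s x)
            = ennreal (w n * real m + w m * real n) * (ennreal (d n + d m) * (F n s x * F m s x))"
          if "1 \<le> n" "1 \<le> m" for n m s x
        proof -
          have p: "real k powr a = real k * real k powr (a - 1)" if "1 \<le> k" for k :: nat
            using that powr_add[of "real k" 1 "a - 1"] by simp
          have "RY n m = (w n * real m + w m * real n) * (d n + d m)"
            unfolding RY_def w_def p[OF that(1)] p[OF that(2)] by (simp add: algebra_simps)
          then show ?thesis
            using d[OF that(1)] d[OF that(2)] by (simp add: w_def ennreal_mult mult.assoc del: ennreal_plus)
        qed
        have "(\<integral>\<^sup>+t\<in>{0..T}. (\<integral>\<^sup>+x. (\<Sum>i. \<Sum>j. ennreal (RY (Suc i) (Suc j) * f (Suc i) x t * f (Suc j) x t)) \<partial>lebesgue) \<partial>lebesgue) \<le> ennreal C"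
        proof (rule quad)
          show "0 \<le> RY n m" if "1 \<le> n" "1 \<le> m" for n m
            using d that by (simp add: RY_def)
          show "(\<integral>\<^sup>+s\<in>{0..T}. (\<integral>\<^sup>+x. (\<Sum>n = 1..N. \<Sum>m = 1..N. ennreal (RY n m) * (F n s x * F m s x)) \<partial>lborel) \<partial>lborel) \<le> ennreal C" for N
          proof -
            have "(\<Sum>n = 1..N. \<Sum>m = 1..N. ennreal (RY n m) * (F n s x * F m s x)) = Yd N s x + Yd N s x" for s x
              unfolding Yd_symmetric[symmetric] by (intro sum.cong refl RY) auto
            then have "(\<integral>\<^sup>+s\<in>{0..T}. (\<integral>\<^sup>+x. (\<Sum>n = 1..N. \<Sum>m = 1..N. ennreal (RY n m) * (F n s x * F m s x)) \<partial>lborel) \<partial>lborel)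
                = (\<integral>\<^sup>+s\<in>{0..T}. (\<integral>\<^sup>+x. Yd N s x \<partial>lborel) \<partial>lborel) + (\<integral>\<^sup>+s\<in>{0..T}. (\<integral>\<^sup>+x. Yd N s x \<partial>lborel) \<partial>lborel)"
              by (simp add: nn_integral_add distrib_right)
            also have "\<dots> \<le> ennreal Cy + ennreal Cy"
              by (intro add_mono bounds(1))
            also have "\<dots> = ennreal (2 * Cy)"
              using nonneg by (simp flip: ennreal_plus)
            also have "\<dots> \<le> ennreal C"
              using nonneg A ca by (intro ennreal_leI) (simp add: C_def)
            finally show ?thesis .
          qed
        qed
        then show "(\<integral>\<^sup>+t\<in>{0..T}. (\<integral>\<^sup>+x. moment_Y d (a - 1) (\<lambda>n. f n x t) \<partial>lebesgue) \<partial>lebesgue) \<le> ennreal C"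
          unfolding moment_Y_def Let_def RY_def .
      next
        have "(\<integral>\<^sup>+t\<in>{0..T}. (\<integral>\<^sup>+x. (\<Sum>i. \<Sum>j. ennreal (r (Suc i) (Suc j) * \<alpha> (Suc i) (Suc j) * f (Suc i) x t * f (Suc j) x t)) \<partial>lebesgue) \<partial>lebesgue) \<le> ennreal C"
        proof (rule quad)
          show "0 \<le> r n m * \<alpha> n m" if "1 \<le> n" "1 \<le> m" for n m
            using \<alpha> r_nonneg that by simp
          show "(\<integral>\<^sup>+s\<in>{0..T}. (\<integral>\<^sup>+x. (\<Sum>n = 1..N. \<Sum>m = 1..N. ennreal (r n m * \<alpha> n m) * (F n s x * F m s x)) \<partial>lborel) \<partial>lborel) \<le> ennreal C" for N
          proof -
            have le: "(\<Sum>n = 1..N. \<Sum>m = 1..N. ennreal (r n m * \<alpha> n m) * (F n s x * F m s x)) \<le> Yh (2 * N) s x" for s x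
            proof -
              have "(\<Sum>n = 1..N. \<Sum>m = 1..N. ennreal (r n m * \<alpha> n m) * (F n s x * F m s x))
                  = (\<Sum>(n, m)\<in>{1..N} \<times> {1..N}. ennreal (r n m) * (ennreal (\<alpha> n m) * F n s x * F m s x))"
                unfolding sum.cartesian_product
                by (intro sum.cong) (auto simp: ennreal_mult r_nonneg \<alpha> mult.assoc)
              also have "\<dots> \<le> Yh (2 * N) s x"
                unfolding collisions_def by (intro sum_mono2) (auto simp: mem_pairs_iff)
              finally show ?thesis .
            qed
            have "(\<integral>\<^sup>+s\<in>{0..T}. (\<integral>\<^sup>+x. (\<Sum>n = 1..N. \<Sum>m = 1..N. ennreal (r n m * \<alpha> n m) * (F n s x * F m s x)) \<partial>lborel) \<partial>lborel)
                \<le> (\<integral>\<^sup>+s\<in>{0..T}. (\<integral>\<^sup>+x. Yh (2 * N) s x \<partial>lborel) \<partial>lborel)"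
              by (intro nn_integral_mono mult_right_mono le) auto
            also have "\<dots> \<le> ennreal (Cy + M * A)"
              by (rule bounds(2))
            also have "\<dots> \<le> ennreal C"
              using nonneg A ca by (intro ennreal_leI) (simp add: C_def)
            finally show ?thesis .
          qed
        qed
        then show "(\<integral>\<^sup>+t\<in>{0..T}. (\<integral>\<^sup>+x. moment_Yhat \<alpha> (a - 1) (\<lambda>n. f n x t) \<partial>lebesgue) \<partial>lebesgue) \<le> ennreal C"
          unfolding moment_Yhat_def Let_def r_def .
      next
        show "(SUP t\<in>{0..T}. \<integral>\<^sup>+x. moment_X a (\<lambda>n. f n x t) \<partial>lebesgue) \<le> ennreal C"
        proof (rule SUP_least)
          fix t assume "t \<in> {0..T}"
          then have t: "0 \<le> t" "t \<le> T" by auto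
          have "(\<integral>\<^sup>+x. X w N t x \<partial>lborel) \<le> ennreal C" for N
          proof -
            have "(\<integral>\<^sup>+x. X w N t x \<partial>lborel) \<le> ennreal (A + ca * (Cy + M * A))"
              using bounds(3)[OF t] by (simp add: Ca_eq)
            also have "\<dots> \<le> ennreal C"
              using nonneg A ca by (intro ennreal_leI) (simp add: C_def)
            finally show ?thesis .
          qed
          then have "(\<integral>\<^sup>+x. moment_X a (\<lambda>n. f n x t) \<partial>lborel) \<le> ennreal C"
            unfolding w_def by (intro moment_X_integral_le[OF _ agree[OF t(1)]]) measurable
          then show "(\<integral>\<^sup>+x. moment_X a (\<lambda>n. f n x t) \<partial>lebesgue) \<le> ennreal C"
            by (simp add: nn_integral_completion)
        qed
      qed
    qed
  qed
qed

theorem theorem1p1: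
  fixes d :: "nat \<Rightarrow> real" and \<alpha> :: "nat \<Rightarrow> nat \<Rightarrow> real" and a :: real
  assumes "\<And>n. n \<ge> 1 \<Longrightarrow> 0 \<le> d n"
    and "\<And>n m. n \<ge> 1 \<Longrightarrow> m \<ge> 1 \<Longrightarrow> 0 \<le> \<alpha> n m"
    and "\<And>n m. n \<ge> 1 \<Longrightarrow> m \<ge> 1 \<Longrightarrow> \<alpha> n m = \<alpha> m n"
    and "\<forall>\<delta>>0. \<exists>k0>0. \<forall>n\<ge>1. \<forall>m\<ge>1. real (n + m) > k0 \<longrightarrow>
           \<alpha> n m \<le> \<delta> * real (n + m) * (d n + d m)"
    and "\<exists>B. \<forall>n\<ge>1. d n \<le> B"
    and "a \<ge> 2"
  shows "(\<forall>A>0. \<forall>T>0. \<exists>C. \<forall>f0 (f :: nat \<Rightarrow> 'a::euclidean_space \<Rightarrow> real \<Rightarrow> real).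
            weak_solution d \<alpha> f0 f \<and> initial_bounds a A f0 \<longrightarrow> solution_bounds d \<alpha> a T C f) \<and>
         (DIM('a) > 2 \<longrightarrow>
           (\<forall>A>0. \<exists>C. \<forall>T>0. \<forall>f0 (f :: nat \<Rightarrow> 'a \<Rightarrow> real \<Rightarrow> real).
              weak_solution d \<alpha> f0 f \<and> initial_bounds a A f0 \<longrightarrow> solution_bounds d \<alpha> a T C f))"
proof (intro conjI allI impI)
  fix A T :: real assume A: "A > 0" and T: "T > 0"
  \<comment> \<open>The choice \<open>\<tau> = 1\<close> is admissible in every dimension, but lets the constant depend on \<open>T\<close>.\<close>
  define \<kappa> where "\<kappa> = T * heat_kernel 1 (0 :: 'a)"
  have "\<kappa> \<ge> 0" using T by (simp add: \<kappa>_def)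
  then obtain C where "\<And>T \<tau> f0 (f :: nat \<Rightarrow> 'a \<Rightarrow> real \<Rightarrow> real).
      T > 0 \<Longrightarrow> \<tau> \<ge> 1 \<Longrightarrow> (DIM('a) \<le> 2 \<Longrightarrow> \<tau> \<le> 1) \<Longrightarrow> T * heat_kernel \<tau> (0 :: 'a) \<le> \<kappa> \<Longrightarrow>
      weak_solution d \<alpha> f0 f \<Longrightarrow> initial_bounds a A f0 \<Longrightarrow> solution_bounds d \<alpha> a T C f"
    using moment_bounds[OF assms A] by blast
  from this[OF T, of 1] show "\<exists>C. \<forall>f0 (f :: nat \<Rightarrow> 'a \<Rightarrow> real \<Rightarrow> real).
      weak_solution d \<alpha> f0 f \<and> initial_bounds a A f0 \<longrightarrow> solution_bounds d \<alpha> a T C f"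
    by (intro exI[of _ C]) (auto simp: \<kappa>_def)
next
  fix A :: real assume dim: "DIM('a) > 2" and A: "A > 0"
  obtain C where C: "\<And>T \<tau> f0 (f :: nat \<Rightarrow> 'a \<Rightarrow> real \<Rightarrow> real).
      T > 0 \<Longrightarrow> \<tau> \<ge> 1 \<Longrightarrow> (DIM('a) \<le> 2 \<Longrightarrow> \<tau> \<le> 1) \<Longrightarrow> T * heat_kernel \<tau> (0 :: 'a) \<le> 1 \<Longrightarrow>
      weak_solution d \<alpha> f0 f \<Longrightarrow> initial_bounds a A f0 \<Longrightarrow> solution_bounds d \<alpha> a T C f"
    using moment_bounds[OF assms A, of 1] by (metis zero_le_one)
  show "\<exists>C. \<forall>T>0. \<forall>f0 (f :: nat \<Rightarrow> 'a \<Rightarrow> real \<Rightarrow> real).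
      weak_solution d \<alpha> f0 f \<and> initial_bounds a A f0 \<longrightarrow> solution_bounds d \<alpha> a T C f"
  proof (intro exI[of _ C] allI impI)
    fix T :: real and f0 and f :: "nat \<Rightarrow> 'a \<Rightarrow> real \<Rightarrow> real"
    assume T: "T > 0" and *: "weak_solution d \<alpha> f0 f \<and> initial_bounds a A f0"
    \<comment> \<open>In dimension at least 3 the kernel at the origin decays at least like \<open>1 / \<tau>\<close>, so \<open>\<tau> \<ge> T\<close> gives \<open>\<kappa> = 1\<close> for all \<open>T\<close>.\<close>
    define \<tau> where "\<tau> = max 1 T"
    have \<tau>: "1 \<le> \<tau>" "T \<le> \<tau>" by (auto simp: \<tau>_def)
    have "heat_kernel \<tau> (0 :: 'a) = (4 * pi * \<tau>) powr (- real DIM('a) / 2)"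
      by (simp add: heat_kernel_def)
    also have "\<dots> \<le> (4 * pi * \<tau>) powr (- 1)"
    proof (rule powr_mono)
      have "1 * 1 \<le> (4 * pi) * \<tau>"
        using \<tau> pi_gt3 by (intro mult_mono) auto
      then show "1 \<le> 4 * pi * \<tau>" by simp
    qed (use dim in simp)
    also have "\<dots> \<le> 1 / \<tau>"
    proof -
      have "1 * \<tau> \<le> 4 * pi * \<tau>"
        using \<tau> pi_gt3 by (intro mult_right_mono) auto
      then show ?thesis using \<tau> by (simp add: powr_minus_divide divide_simps)
    qed
    finally have "T * heat_kernel \<tau> (0 :: 'a) \<le> T * (1 / \<tau>)"
      using T by (intro mult_left_mono) auto
    also have "\<dots> \<le> 1" using \<tau> by simp
    finally show "solution_bounds d \<alpha> a T C f"
      using C[OF T \<tau>(1)] dim * by auto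
  qed
qed

end
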